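(* Let $(X,\mathcal O_{\bullet,X})$ be a localized simplicial $C^\infty$-space. Then $\mathcal O_{0,X}$ is a soft sheaf.
   Context: Let $\mathcal C^\infty$ be the category with objects $\mathbb R^n$, $n\ge 0$, and smooth maps. A $C^\infty$-ring is a product preserving functor $A:\mathcal C^\infty\to Set$, identified with the set $A(\mathbb R)$ with its operations; it is in particular a commutative $\mathbb R$-algebra. It is finitely generated if it is a quotient of some $C^\infty(\mathbb R^n)$, $n<\infty$, and local if it has a unique maximal ideal $\mathfrak m$ and $A/\mathfrak m\cong\mathbb R$. For a sheaf $\mathcal O_{\bullet,X}=\{\mathcal O_{k,X}\}_{k\ge0}$ of simplicial $C^\infty$-rings on a space $X$, $\pi_0(\mathcal O_{\bullet,X})$ is the sheaf of $C^\infty$-rings associated to $U\mapsto\pi_0(\Gamma(U,\mathcal O_{\bullet,X}))$. A simplicial $C^\infty$-space is a pair $(X,\mathcal O_{\bullet,X})$ with $X$ a Hausdorff topological space and $\mathcal O_{\bullet,X}$ a sheaf of simplicial $C^\infty$-rings on $X$ such that $\pi_0(\mathcal O_{\bullet,X})$ is a soft sheaf of finitely generated $C^\infty$-rings whose stalks are local $C^\infty$-rings. It is localized if the stalks of $\mathcal O_{0,X}$ are local $C^\infty$-rings. A sheaf is soft if every section over a closed subset extends to a global section. *)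

theory Defs
  imports "HOL-Analysis.Analysis" "HOL-Algebra.QuotRing"
begin

section \<open>Smooth functions on Euclidean spaces of varying dimension\<close>

text \<open>
  Since the dimension \<open>n\<close> varies inside the notions below, a function from \<open>n\<close>-dimensional real
  space to the reals is represented as a function on all real sequences that depends on the first
  \<open>n\<close> coordinates only.  For such functions, continuity with respect to the product topology on
  sequences is ordinary continuity in \<open>n\<close> variables.
\<close>

definition depends_on_first :: "nat \<Rightarrow> ((nat \<Rightarrow> real) \<Rightarrow> real) \<Rightarrow> bool" where
  "depends_on_first n f \<longleftrightarrow> (\<forall>x y. (\<forall>i<n. x i = y i) \<longrightarrow> f x = f y)"

definition partial_deriv :: "nat \<Rightarrow> ((nat \<Rightarrow> real) \<Rightarrow> real) \<Rightarrow> (nat \<Rightarrow> real) \<Rightarrow> real" where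
  "partial_deriv i f x = deriv (\<lambda>t. f (x(i := t))) (x i)"

primrec diff_class :: "nat \<Rightarrow> nat \<Rightarrow> ((nat \<Rightarrow> real) \<Rightarrow> real) \<Rightarrow> bool" where
  "diff_class n 0 f \<longleftrightarrow> continuous_on UNIV f"
| "diff_class n (Suc k) f \<longleftrightarrow>
     (\<forall>i<n. (\<forall>x. (\<lambda>t. f (x(i := t))) field_differentiable at (x i)) \<and>
            diff_class n k (partial_deriv i f))"

definition smooth :: "nat \<Rightarrow> ((nat \<Rightarrow> real) \<Rightarrow> real) \<Rightarrow> bool" where
  "smooth n f \<longleftrightarrow> depends_on_first n f \<and> (\<forall>k. diff_class n k f)"


section \<open>\<open>C\<^sup>\<infinity>\<close>-rings\<close>

text \<open>
  A product preserving functor \<open>A\<close> on the category of Euclidean spaces and smooth maps is given by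
  the set \<open>A(\<real>)\<close> (the carrier) together with, for every smooth \<open>f\<close> in \<open>n\<close> variables, the \<open>n\<close>-ary
  operation \<open>A(f)\<close>.  The operation \<open>cinf_op A n f\<close> takes its \<open>n\<close> arguments as the values at
  \<open>0, \<dots>, n - 1\<close> of a sequence, the rest of which is ignored.  Product preservation is
  compatibility with projections, and functoriality is compatibility with composition.
\<close>

record 'a cinf_ring = "'a partial_object" +
  cinf_op :: "nat \<Rightarrow> ((nat \<Rightarrow> real) \<Rightarrow> real) \<Rightarrow> (nat \<Rightarrow> 'a) \<Rightarrow> 'a"

locale cinf_ring =
  fixes A :: "'a cinf_ring"
  assumes op_closed:
      "\<lbrakk>smooth n f; \<And>i. i < n \<Longrightarrow> a i \<in> carrier A\<rbrakk> \<Longrightarrow> cinf_op A n f a \<in> carrier A"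
    and op_cong:
      "\<lbrakk>smooth n f; \<And>i. i < n \<Longrightarrow> a i \<in> carrier A; \<And>i. i < n \<Longrightarrow> a i = b i\<rbrakk>
        \<Longrightarrow> cinf_op A n f a = cinf_op A n f b"
    and op_proj:
      "\<lbrakk>i < n; \<And>j. j < n \<Longrightarrow> a j \<in> carrier A\<rbrakk> \<Longrightarrow> cinf_op A n (\<lambda>x. x i) a = a i"
    and op_comp:
      "\<lbrakk>smooth m g; \<And>j. j < m \<Longrightarrow> smooth n (\<phi> j); \<And>i. i < n \<Longrightarrow> a i \<in> carrier A\<rbrakk>
        \<Longrightarrow> cinf_op A m g (\<lambda>j. cinf_op A n (\<phi> j) a) = cinf_op A n (\<lambda>x. g (\<lambda>j. \<phi> j x)) a"

definition cinf_hom :: "'a cinf_ring \<Rightarrow> 'b cinf_ring \<Rightarrow> ('a \<Rightarrow> 'b) set" where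
  "cinf_hom A B = {h \<in> carrier A \<rightarrow> carrier B.
     \<forall>n f a. smooth n f \<longrightarrow> (\<forall>i<n. a i \<in> carrier A) \<longrightarrow>
       h (cinf_op A n f a) = cinf_op B n f (\<lambda>i. h (a i))}"

definition real_cinf :: "real cinf_ring" where
  "real_cinf = \<lparr>carrier = UNIV, cinf_op = (\<lambda>n f x. f x)\<rparr>"

definition smooth_functions :: "nat \<Rightarrow> ((nat \<Rightarrow> real) \<Rightarrow> real) cinf_ring" where
  "smooth_functions n =
     \<lparr>carrier = {f. smooth n f}, cinf_op = (\<lambda>m g F x. g (\<lambda>j. F j x))\<rparr>"

text \<open>A quotient of \<open>B\<close> is the target of a surjective homomorphism from \<open>B\<close>.\<close>

definition finitely_generated :: "'a cinf_ring \<Rightarrow> bool" where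
  "finitely_generated A \<longleftrightarrow>
     (\<exists>n. \<exists>h \<in> cinf_hom (smooth_functions n) A. h ` carrier (smooth_functions n) = carrier A)"

definition cinf_const :: "'a cinf_ring \<Rightarrow> real \<Rightarrow> 'a" where
  "cinf_const A c = cinf_op A 0 (\<lambda>_. c) (\<lambda>_. undefined)"

definition cinf_binop :: "'a cinf_ring \<Rightarrow> (real \<Rightarrow> real \<Rightarrow> real) \<Rightarrow> 'a \<Rightarrow> 'a \<Rightarrow> 'a" where
  "cinf_binop A f a b = cinf_op A 2 (\<lambda>x. f (x 0) (x 1)) (\<lambda>i. if i = 0 then a else b)"

definition ring_of :: "'a cinf_ring \<Rightarrow> 'a ring" where
  "ring_of A = \<lparr>carrier = carrier A,
     mult = cinf_binop A (*), one = cinf_const A 1,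
     zero = cinf_const A 0, add = cinf_binop A (+)\<rparr>"

text \<open>
  The residue field is required to be isomorphic to the reals as an \<open>\<real>\<close>-algebra.
\<close>

definition local_cinf_ring :: "'a cinf_ring \<Rightarrow> bool" where
  "local_cinf_ring A \<longleftrightarrow>
     (\<exists>M. maximalideal M (ring_of A) \<and> (\<forall>N. maximalideal N (ring_of A) \<longrightarrow> N = M) \<and>
       (\<exists>h \<in> ring_iso (ring_of A Quot M) (ring_of real_cinf).
          \<forall>c. h (M +>\<^bsub>ring_of A\<^esub> cinf_const A c) = c))"


section \<open>Simplicial \<open>C\<^sup>\<infinity>\<close>-rings\<close>

text \<open>
  \<open>face A k i\<close> is the face map \<open>d\<^sub>i\<close> from level \<open>k + 1\<close> to level \<open>k\<close>, and \<open>degen A k i\<close> is the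
  degeneracy \<open>s\<^sub>i\<close> from level \<open>k\<close> to level \<open>k + 1\<close>.
\<close>

record 'a simplicial_cinf_ring =
  level :: "nat \<Rightarrow> 'a cinf_ring"
  face :: "nat \<Rightarrow> nat \<Rightarrow> 'a \<Rightarrow> 'a"
  degen :: "nat \<Rightarrow> nat \<Rightarrow> 'a \<Rightarrow> 'a"

locale simplicial_cinf_ring =
  fixes A :: "'a simplicial_cinf_ring"
  assumes level_ring: "cinf_ring (level A k)"
    and face_hom: "i \<le> Suc k \<Longrightarrow> face A k i \<in> cinf_hom (level A (Suc k)) (level A k)"
    and degen_hom: "i \<le> k \<Longrightarrow> degen A k i \<in> cinf_hom (level A k) (level A (Suc k))"
    and face_face:
      "\<lbrakk>i < j; j \<le> Suc (Suc k); x \<in> carrier (level A (Suc (Suc k)))\<rbrakk>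
        \<Longrightarrow> face A k i (face A (Suc k) j x) = face A k (j - 1) (face A (Suc k) i x)"
    and degen_degen:
      "\<lbrakk>i \<le> j; j \<le> k; x \<in> carrier (level A k)\<rbrakk>
        \<Longrightarrow> degen A (Suc k) i (degen A k j x) = degen A (Suc k) (Suc j) (degen A k i x)"
    and face_degen_less:
      "\<lbrakk>i < j; j \<le> Suc k; x \<in> carrier (level A (Suc k))\<rbrakk>
        \<Longrightarrow> face A (Suc k) i (degen A (Suc k) j x) = degen A k (j - 1) (face A k i x)"
    and face_degen_same:
      "\<lbrakk>i \<le> k; x \<in> carrier (level A k)\<rbrakk> \<Longrightarrow> face A k i (degen A k i x) = x"
    and face_degen_Suc:
      "\<lbrakk>i \<le> k; x \<in> carrier (level A k)\<rbrakk> \<Longrightarrow> face A k (Suc i) (degen A k i x) = x"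
    and face_degen_greater:
      "\<lbrakk>Suc j < i; i \<le> Suc (Suc k); x \<in> carrier (level A (Suc k))\<rbrakk>
        \<Longrightarrow> face A (Suc k) i (degen A (Suc k) j x) = degen A k j (face A k (i - 1) x)"

text \<open>
  \<open>\<pi>\<^sub>0\<close> is the quotient of level \<open>0\<close> by the equivalence relation generated by \<open>d\<^sub>0 x \<sim> d\<^sub>1 x\<close>,
  with operations defined on representatives.
\<close>

definition pi0_rel :: "'a simplicial_cinf_ring \<Rightarrow> ('a \<times> 'a) set" where
  "pi0_rel A =
     (let E = {(face A 0 0 x, face A 0 1 x) | x. x \<in> carrier (level A 1)}
      in (E \<union> E\<inverse>)\<^sup>* \<inter> carrier (level A 0) \<times> carrier (level A 0))"

definition pi0 :: "'a simplicial_cinf_ring \<Rightarrow> 'a set cinf_ring" where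
  "pi0 A = \<lparr>carrier = carrier (level A 0) // pi0_rel A,
     cinf_op = (\<lambda>n f C. THE D. \<exists>a. (\<forall>i<n. a i \<in> carrier (level A 0) \<and> C i = pi0_rel A `` {a i}) \<and>
                               D = pi0_rel A `` {cinf_op (level A 0) n f a})\<rparr>"


section \<open>Sheaves of \<open>C\<^sup>\<infinity>\<close>-rings\<close>

record ('x, 'a) cinf_presheaf =
  sec :: "'x set \<Rightarrow> 'a cinf_ring"
  res :: "'x set \<Rightarrow> 'x set \<Rightarrow> 'a \<Rightarrow> 'a"

text \<open>\<open>res F U V\<close> is the restriction from \<open>U\<close> to the smaller open set \<open>V\<close>.\<close>

locale cinf_presheaf =
  fixes X :: "'x topology" and F :: "('x, 'a) cinf_presheaf"
  assumes sec_ring: "openin X U \<Longrightarrow> cinf_ring (sec F U)"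
    and res_hom:
      "\<lbrakk>openin X U; openin X V; V \<subseteq> U\<rbrakk> \<Longrightarrow> res F U V \<in> cinf_hom (sec F U) (sec F V)"
    and res_id: "\<lbrakk>openin X U; s \<in> carrier (sec F U)\<rbrakk> \<Longrightarrow> res F U U s = s"
    and res_comp:
      "\<lbrakk>openin X U; openin X V; openin X W; W \<subseteq> V; V \<subseteq> U; s \<in> carrier (sec F U)\<rbrakk>
        \<Longrightarrow> res F V W (res F U V s) = res F U W s"

text \<open>The empty cover is included, so there is exactly one section over the empty set.\<close>

locale cinf_sheaf = cinf_presheaf +
  assumes glue:
    "\<lbrakk>\<And>V. V \<in> \<V> \<Longrightarrow> openin X V; \<And>V. V \<in> \<V> \<Longrightarrow> s V \<in> carrier (sec F V);
      \<And>V W. \<lbrakk>V \<in> \<V>; W \<in> \<V>\<rbrakk> \<Longrightarrow> res F V (V \<inter> W) (s V) = res F W (V \<inter> W) (s W)\<rbrakk>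
      \<Longrightarrow> \<exists>!t. t \<in> carrier (sec F (\<Union>\<V>)) \<and> (\<forall>V\<in>\<V>. res F (\<Union>\<V>) V t = s V)"

text \<open>A germ is an equivalence class of pairs of an open neighbourhood and a section over it.\<close>

definition germ ::
    "'x topology \<Rightarrow> ('x, 'a) cinf_presheaf \<Rightarrow> 'x \<Rightarrow> 'x set \<Rightarrow> 'a \<Rightarrow> ('x set \<times> 'a) set" where
  "germ X F p U s = {(V, t). openin X V \<and> p \<in> V \<and> t \<in> carrier (sec F V) \<and>
     (\<exists>W. openin X W \<and> p \<in> W \<and> W \<subseteq> U \<inter> V \<and> res F U W s = res F V W t)}"

definition stalk ::
    "'x topology \<Rightarrow> ('x, 'a) cinf_presheaf \<Rightarrow> 'x \<Rightarrow> ('x set \<times> 'a) set cinf_ring" where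
  "stalk X F p =
     \<lparr>carrier = {germ X F p U s | U s. openin X U \<and> p \<in> U \<and> s \<in> carrier (sec F U)},
      cinf_op = (\<lambda>n f g. THE \<gamma>. \<exists>U s. openin X U \<and> p \<in> U \<and>
         (\<forall>i<n. s i \<in> carrier (sec F U) \<and> g i = germ X F p U (s i)) \<and>
         \<gamma> = germ X F p U (cinf_op (sec F U) n f s))\<rparr>"

text \<open>
  The sections over an arbitrary subset \<open>S\<close>, i.e. the global sections of the inverse image sheaf
  on \<open>S\<close>: families of germs that are locally induced by sections over open sets.
\<close>

definition sections_over ::
    "'x topology \<Rightarrow> ('x, 'a) cinf_presheaf \<Rightarrow> 'x set \<Rightarrow> ('x \<Rightarrow> ('x set \<times> 'a) set) set" where
  "sections_over X F S = {\<sigma> \<in> extensional S.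
     \<forall>p\<in>S. \<exists>V. openin X V \<and> p \<in> V \<and>
       (\<exists>t \<in> carrier (sec F V). \<forall>q \<in> V \<inter> S. \<sigma> q = germ X F q V t)}"

definition sheafification ::
    "'x topology \<Rightarrow> ('x, 'a) cinf_presheaf \<Rightarrow> ('x, 'x \<Rightarrow> ('x set \<times> 'a) set) cinf_presheaf" where
  "sheafification X F =
     \<lparr>sec = (\<lambda>U. \<lparr>carrier = sections_over X F U,
                  cinf_op = (\<lambda>n f \<sigma>. \<lambda>p\<in>U. cinf_op (stalk X F p) n f (\<lambda>i. \<sigma> i p))\<rparr>),
      res = (\<lambda>U V \<sigma>. restrict \<sigma> V)\<rparr>"

definition soft_sheaf :: "'x topology \<Rightarrow> ('x, 'a) cinf_presheaf \<Rightarrow> bool" where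
  "soft_sheaf X F \<longleftrightarrow> cinf_sheaf X F \<and>
     (\<forall>S \<sigma>. closedin X S \<longrightarrow> \<sigma> \<in> sections_over X F S \<longrightarrow>
        (\<exists>t \<in> carrier (sec F (topspace X)). \<forall>p\<in>S. germ X F p (topspace X) t = \<sigma> p))"


section \<open>Simplicial \<open>C\<^sup>\<infinity>\<close>-spaces\<close>

text \<open>\<open>sres F k U V\<close> is the restriction from \<open>U\<close> to \<open>V\<close> in simplicial degree \<open>k\<close>.\<close>

record ('x, 'a) simplicial_presheaf =
  ssec :: "'x set \<Rightarrow> 'a simplicial_cinf_ring"
  sres :: "nat \<Rightarrow> 'x set \<Rightarrow> 'x set \<Rightarrow> 'a \<Rightarrow> 'a"

definition sheaf_level :: "('x, 'a) simplicial_presheaf \<Rightarrow> nat \<Rightarrow> ('x, 'a) cinf_presheaf" where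
  "sheaf_level F k = \<lparr>sec = (\<lambda>U. level (ssec F U) k), res = sres F k\<rparr>"

locale simplicial_cinf_sheaf =
  fixes X :: "'x topology" and F :: "('x, 'a) simplicial_presheaf"
  assumes ssec_simplicial: "openin X U \<Longrightarrow> simplicial_cinf_ring (ssec F U)"
    and level_sheaf: "cinf_sheaf X (sheaf_level F k)"
    and sres_face:
      "\<lbrakk>openin X U; openin X V; V \<subseteq> U; i \<le> Suc k; s \<in> carrier (level (ssec F U) (Suc k))\<rbrakk>
        \<Longrightarrow> sres F k U V (face (ssec F U) k i s) = face (ssec F V) k i (sres F (Suc k) U V s)"
    and sres_degen:
      "\<lbrakk>openin X U; openin X V; V \<subseteq> U; i \<le> k; s \<in> carrier (level (ssec F U) k)\<rbrakk>
        \<Longrightarrow> sres F (Suc k) U V (degen (ssec F U) k i s) = degen (ssec F V) k i (sres F k U V s)"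

text \<open>
  The restriction of a class in \<open>\<pi>\<^sub>0\<close> is the class of the restriction of any representative; it is
  written as the union of the classes of the restrictions of all representatives.
\<close>

definition pi0_presheaf :: "('x, 'a) simplicial_presheaf \<Rightarrow> ('x, 'a set) cinf_presheaf" where
  "pi0_presheaf F =
     \<lparr>sec = (\<lambda>U. pi0 (ssec F U)),
      res = (\<lambda>U V C. pi0_rel (ssec F V) `` (sres F 0 U V ` C))\<rparr>"

definition pi0_sheaf ::
    "'x topology \<Rightarrow> ('x, 'a) simplicial_presheaf
      \<Rightarrow> ('x, 'x \<Rightarrow> ('x set \<times> 'a set) set) cinf_presheaf" where
  "pi0_sheaf X F = sheafification X (pi0_presheaf F)"

locale simplicial_cinf_space = simplicial_cinf_sheaf +
  assumes Hausdorff: "Hausdorff_space X"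
    and pi0_soft: "soft_sheaf X (pi0_sheaf X F)"
    and pi0_finitely_generated: "openin X U \<Longrightarrow> finitely_generated (sec (pi0_sheaf X F) U)"
    and pi0_local: "p \<in> topspace X \<Longrightarrow> local_cinf_ring (stalk X (pi0_sheaf X F) p)"

locale localized_simplicial_cinf_space = simplicial_cinf_space +
  assumes stalk_local: "p \<in> topspace X \<Longrightarrow> local_cinf_ring (stalk X (sheaf_level F 0) p)"

end

theory Submission
  imports Defs "HOL-Algebra.Ring_Divisibility"
begin

text \<open>
  The idea is to build partitions of unity in the structure sheaf \<open>O\<^sub>0\<close> itself and to glue local
  extensions of a given section with them.  Two facts make this possible.

  First, there are enough bump sections of \<open>O\<^sub>0\<close> (\<open>bump_sections\<close>).  Softness of \<open>\<pi>\<^sub>0\<close> yields, for a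
  point \<open>p\<close> of an open set \<open>V\<close>, a global section \<open>u\<close> of \<open>\<pi>\<^sub>0\<close> with germ \<open>1\<close> at \<open>p\<close> and germ \<open>0\<close> off \<open>V\<close>.
  Sections of \<open>\<pi>\<^sub>0\<close> lift to \<open>O\<^sub>0\<close> only locally, and the domain of a lift could depend on the section.
  Finite generation avoids the circularity: the finitely many generators \<open>x\<close> lift over one
  neighbourhood \<open>V\<close> of \<open>p\<close>; then \<open>u\<close> is chosen for this \<open>V\<close>, and since \<open>u = f(x)\<close> for a smooth \<open>f\<close>, it
  lifts over all of \<open>V\<close>.  Where \<open>u\<close> has germ \<open>0\<close> or \<open>1\<close>, the lift \<open>a\<close> need not, but its germ has residue
  \<open>0\<close> or \<open>1\<close>, because a unit of \<open>O\<^sub>0\<close> maps to a unit of \<open>\<pi>\<^sub>0\<close> and both stalks are local.  In a local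
  \<open>C\<^sup>\<infinity>\<close>-ring with residue field \<open>\<real>\<close> an element with residue \<open>c\<close> is killed by every smooth function that vanishes
  near \<open>c\<close> (\<open>op_eq_0_if_vanishing_near\<close>).  So a smooth step function that is constant near \<open>0\<close> and near
  \<open>1\<close> turns \<open>a\<close> into a section whose germs are exactly \<open>0\<close> and \<open>1\<close> there, and this section extends by zero.

  Secondly, the space is Lindelof (\<open>Lindelof_topology\<close>): the residues of the generators define a map \<open>\<xi>\<close>
  to real sequences, and the functions \<open>f\<close> above show that every open neighbourhood of a point
  contains the preimage under \<open>\<xi>\<close> of an open set around its image, so countable subcovers come
  from the second countable space of real sequences.

  Countably many bump sections \<open>e\<^sub>i\<close> suffice then, and the partition of unity
  \<open>e\<^sub>i (1 - e\<^sub>0) \<dots> (1 - e\<^bsub>i-1\<^esub>)\<close> is locally finite without any refinement of covers, because its terms vanish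
  from the index \<open>j + 1\<close> on where \<open>e\<^sub>j = 1\<close> (\<open>soft_if_bump_sections\<close>).
\<close>

section \<open>Smooth functions\<close>

text \<open>
  Closing \<open>diff_class\<close> downwards in the order makes the product rule an induction: the derivative of
  \<open>f g\<close> involves \<open>f\<close> and \<open>g\<close> themselves, which have to be available at the smaller order.
\<close>

definition diff_upto :: "nat \<Rightarrow> nat \<Rightarrow> ((nat \<Rightarrow> real) \<Rightarrow> real) \<Rightarrow> bool" where
  "diff_upto n k f \<longleftrightarrow> (\<forall>j\<le>k. diff_class n j f)"

definition has_partial ::
    "nat \<Rightarrow> ((nat \<Rightarrow> real) \<Rightarrow> real) \<Rightarrow> ((nat \<Rightarrow> real) \<Rightarrow> real) \<Rightarrow> bool" where
  "has_partial i f f' \<longleftrightarrow> (\<forall>x. ((\<lambda>t. f (x(i := t))) has_field_derivative f' x) (at (x i)))"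

lemma smooth_iff_diff_upto: "smooth n f \<longleftrightarrow> depends_on_first n f \<and> (\<forall>k. diff_upto n k f)"
  unfolding smooth_def diff_upto_def by auto

lemma diff_upto_0: "diff_upto n 0 f \<longleftrightarrow> continuous_on UNIV f"
  by (simp add: diff_upto_def)

text \<open>
  Allowing any function \<open>f'\<close> that is a partial derivative in place of \<open>partial_deriv i f\<close> turns each
  closure property below into an application of a rule of differentiation.
\<close>

lemma diff_upto_Suc:
  "diff_upto n (Suc k) f \<longleftrightarrow>
     continuous_on UNIV f \<and> (\<forall>i<n. \<exists>f'. has_partial i f f' \<and> diff_upto n k f')"
    (is "?L \<longleftrightarrow> ?R")
proof
  assume L: ?L
  have "has_partial i f (partial_deriv i f)" if "i < n" for i
    using L[unfolded diff_upto_def, rule_format, of "Suc 0"] that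
    by (auto simp: has_partial_def partial_deriv_def DERIV_deriv_iff_field_differentiable)
  moreover have "diff_upto n k (partial_deriv i f)" if "i < n" for i
    unfolding diff_upto_def
  proof (intro allI impI)
    fix j assume "j \<le> k"
    then show "diff_class n j (partial_deriv i f)"
      using L[unfolded diff_upto_def, rule_format, of "Suc j"] that by auto
  qed
  moreover have "continuous_on UNIV f"
    using L[unfolded diff_upto_def, rule_format, of 0] by simp
  ultimately show ?R by blast
next
  assume R: ?R
  show ?L unfolding diff_upto_def
  proof (intro allI impI)
    fix j assume "j \<le> Suc k"
    show "diff_class n j f"
    proof (cases j)
      case 0
      then show ?thesis using R by simp
    next
      case (Suc j')
      have "(\<forall>x. (\<lambda>t. f (x(i := t))) field_differentiable at (x i)) \<and>
            diff_class n j' (partial_deriv i f)" if i: "i < n" for i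
      proof -
        obtain f' where f': "has_partial i f f'" "diff_upto n k f'" using R i by blast
        have "partial_deriv i f = f'"
          using f'(1) by (auto simp: partial_deriv_def has_partial_def DERIV_imp_deriv)
        then show ?thesis
          using f' Suc \<open>j \<le> Suc k\<close> by (auto simp: has_partial_def diff_upto_def field_differentiable_def)
      qed
      then show ?thesis using Suc by simp
    qed
  qed
qed

lemma diff_upto_SucE:
  assumes "diff_upto n (Suc k) f" "i < n"
  obtains f' where "has_partial i f f'" "diff_upto n k f'"
  using assms unfolding diff_upto_Suc by blast

lemma diff_upto_mono: "diff_upto n k f \<Longrightarrow> j \<le> k \<Longrightarrow> diff_upto n j f"
  by (auto simp: diff_upto_def)

lemma diff_upto_continuous: "diff_upto n k f \<Longrightarrow> continuous_on UNIV f"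
  using diff_upto_mono[of n k f 0] by (simp add: diff_upto_0)

lemma diff_upto_const: "diff_upto n k (\<lambda>_. c)"
proof (induction k arbitrary: c)
  case 0
  show ?case by (simp add: diff_upto_0)
next
  case (Suc k)
  have "has_partial i (\<lambda>_. c) (\<lambda>_. 0)" for i
    by (simp add: has_partial_def)
  then show ?case using Suc by (auto simp: diff_upto_Suc)
qed

lemma diff_upto_proj: "diff_upto n k (\<lambda>x. x j)"
proof (cases k)
  case 0
  show ?thesis by (simp add: 0 diff_upto_0)
next
  case (Suc k')
  have proj: "has_partial i (\<lambda>x. x j) (\<lambda>_. if i = j then 1 else 0)" for i
    by (auto simp: has_partial_def)
  show ?thesis
    unfolding Suc diff_upto_Suc
  proof (intro conjI allI impI)
    fix i
    have "diff_upto n k' (\<lambda>_. if i = j then 1 else 0)"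
      by (rule diff_upto_const)
    with proj show "\<exists>f'. has_partial i (\<lambda>x. x j) f' \<and> diff_upto n k' f'" by blast
  qed simp
qed

lemma diff_upto_add: "diff_upto n k f \<Longrightarrow> diff_upto n k g \<Longrightarrow> diff_upto n k (\<lambda>x. f x + g x)"
proof (induction k arbitrary: f g)
  case 0
  then show ?case unfolding diff_upto_0 by (intro continuous_intros) auto
next
  case (Suc k)
  show ?case unfolding diff_upto_Suc
  proof (intro conjI allI impI)
    show "continuous_on UNIV (\<lambda>x. f x + g x)"
      using Suc.prems by (intro continuous_intros) (auto simp: diff_upto_continuous)
    fix i assume "i < n"
    obtain f' where f: "has_partial i f f'" "diff_upto n k f'"
      using diff_upto_SucE[OF Suc.prems(1) \<open>i < n\<close>] .
    obtain g' where g: "has_partial i g g'" "diff_upto n k g'"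
      using diff_upto_SucE[OF Suc.prems(2) \<open>i < n\<close>] .
    note fg = f g
    have "has_partial i (\<lambda>x. f x + g x) (\<lambda>x. f' x + g' x)"
      using fg unfolding has_partial_def by (auto intro!: derivative_eq_intros)
    then show "\<exists>h. has_partial i (\<lambda>x. f x + g x) h \<and> diff_upto n k h"
      using Suc.IH fg by blast
  qed
qed

lemma diff_upto_mult: "diff_upto n k f \<Longrightarrow> diff_upto n k g \<Longrightarrow> diff_upto n k (\<lambda>x. f x * g x)"
proof (induction k arbitrary: f g)
  case 0
  then show ?case unfolding diff_upto_0 by (intro continuous_intros) auto
next
  case (Suc k)
  show ?case unfolding diff_upto_Suc
  proof (intro conjI allI impI)
    show "continuous_on UNIV (\<lambda>x. f x * g x)"
      using Suc.prems by (intro continuous_intros) (auto simp: diff_upto_continuous)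
    fix i assume "i < n"
    obtain f' where f: "has_partial i f f'" "diff_upto n k f'"
      using diff_upto_SucE[OF Suc.prems(1) \<open>i < n\<close>] .
    obtain g' where g: "has_partial i g g'" "diff_upto n k g'"
      using diff_upto_SucE[OF Suc.prems(2) \<open>i < n\<close>] .
    note fg = f g
    have "has_partial i (\<lambda>x. f x * g x) (\<lambda>x. f' x * g x + f x * g' x)"
      unfolding has_partial_def
    proof
      fix x
      show "((\<lambda>t. f (x(i := t)) * g (x(i := t))) has_field_derivative f' x * g x + f x * g' x) (at (x i))"
        by (rule derivative_eq_intros fg[unfolded has_partial_def, rule_format] | simp)+
    qed
    moreover have "diff_upto n k (\<lambda>x. f' x * g x + f x * g' x)"
      using Suc fg diff_upto_mono[of n "Suc k" _ k] by (intro diff_upto_add Suc.IH) auto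
    ultimately show "\<exists>h. has_partial i (\<lambda>x. f x * g x) h \<and> diff_upto n k h"
      by blast
  qed
qed

lemma diff_upto_inverse:
  "diff_upto n k f \<Longrightarrow> (\<And>x. f x \<noteq> 0) \<Longrightarrow> diff_upto n k (\<lambda>x. inverse (f x))"
proof (induction k arbitrary: f)
  case 0
  then show ?case unfolding diff_upto_0 by (intro continuous_intros) auto
next
  case (Suc k)
  show ?case unfolding diff_upto_Suc
  proof (intro conjI allI impI)
    show "continuous_on UNIV (\<lambda>x. inverse (f x))"
      using Suc.prems by (intro continuous_intros) (auto simp: diff_upto_continuous)
    fix i assume "i < n"
    obtain f' where f: "has_partial i f f'" "diff_upto n k f'"
      using diff_upto_SucE[OF Suc.prems(1) \<open>i < n\<close>] .
    have "has_partial i (\<lambda>x. inverse (f x)) (\<lambda>x. - 1 * (inverse (f x) * (f' x * inverse (f x))))"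
      unfolding has_partial_def
    proof
      fix x
      show "((\<lambda>t. inverse (f (x(i := t)))) has_field_derivative
             - 1 * (inverse (f x) * (f' x * inverse (f x)))) (at (x i))"
        using DERIV_inverse_fun[OF f(1)[unfolded has_partial_def, rule_format], of x] Suc.prems(2)
        by (simp add: algebra_simps)
    qed
    moreover have "diff_upto n k (\<lambda>x. - 1 * (inverse (f x) * (f' x * inverse (f x))))"
      using Suc f diff_upto_mono[of n "Suc k" f k]
      by (intro diff_upto_mult diff_upto_const Suc.IH) auto
    ultimately show "\<exists>h. has_partial i (\<lambda>x. inverse (f x)) h \<and> diff_upto n k h"
      by blast
  qed
qed

lemma smooth_continuous: "smooth n f \<Longrightarrow> continuous_on UNIV f"
  using diff_upto_0 by (auto simp: smooth_iff_diff_upto)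

lemma depends_on_first_pair:
  "depends_on_first n f \<Longrightarrow> depends_on_first n g \<Longrightarrow> depends_on_first n (\<lambda>x. h (f x) (g x))"
  unfolding depends_on_first_def by metis

lemma smooth_const: "smooth n (\<lambda>_. c)"
  by (simp add: smooth_iff_diff_upto depends_on_first_def diff_upto_const)

lemma smooth_proj: "j < n \<Longrightarrow> smooth n (\<lambda>x. x j)"
  by (simp add: smooth_iff_diff_upto depends_on_first_def diff_upto_proj)

lemma smooth_add: "smooth n f \<Longrightarrow> smooth n g \<Longrightarrow> smooth n (\<lambda>x. f x + g x)"
  by (simp add: smooth_iff_diff_upto diff_upto_add depends_on_first_pair[where h = "(+)"])

lemma smooth_mult: "smooth n f \<Longrightarrow> smooth n g \<Longrightarrow> smooth n (\<lambda>x. f x * g x)"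
  by (simp add: smooth_iff_diff_upto diff_upto_mult depends_on_first_pair[where h = "(*)"])

lemma smooth_uminus: "smooth n f \<Longrightarrow> smooth n (\<lambda>x. - f x)"
  using smooth_mult[OF smooth_const[of n "- 1"]] by simp

lemma smooth_diff: "smooth n f \<Longrightarrow> smooth n g \<Longrightarrow> smooth n (\<lambda>x. f x - g x)"
  using smooth_add[OF _ smooth_uminus, of n f g] by simp

lemma smooth_inverse: "smooth n f \<Longrightarrow> (\<And>x. f x \<noteq> 0) \<Longrightarrow> smooth n (\<lambda>x. inverse (f x))"
  by (simp add: smooth_iff_diff_upto diff_upto_inverse depends_on_first_pair[of n f f "\<lambda>t _. inverse t"])

lemma smooth_sum: "(\<And>i. i < (m::nat) \<Longrightarrow> smooth n (f i)) \<Longrightarrow> smooth n (\<lambda>x. \<Sum>i<m. f i x)"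
  by (induction m) (auto intro: smooth_const smooth_add)

text \<open>
  For \<open>m = 0\<close> this is the standard smooth function \<open>exp (-1/t)\<close>, extended by \<open>0\<close> to \<open>t \<le> 0\<close>.  Differentiating
  it produces factors \<open>1/t\<close>, so the family indexed by their number \<open>m\<close> is closed under derivatives up to
  linear combinations, and all its members can be shown to be smooth in one induction.
\<close>

definition flat :: "nat \<Rightarrow> real \<Rightarrow> real" where
  "flat m t = (if t > 0 then inverse t ^ m * exp (- inverse t) else 0)"

text \<open>
  Comparing \<open>exp s\<close> at \<open>s = 1/t\<close> with the single term of degree \<open>m + 2\<close> of its series.  A quadratic bound is what
  is needed at \<open>t = 0\<close>, where it makes the difference quotient tend to \<open>0\<close>.
\<close>

lemma flat_quadratic_bound: "\<bar>flat m t\<bar> \<le> fact (m + 2) * t\<^sup>2"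
proof (cases "t > 0")
  case True
  define s where "s = inverse t"
  have s: "s > 0" "t = inverse s" using True by (auto simp: s_def)
  have "s ^ (m + 2) /\<^sub>R fact (m + 2) \<le> exp s"
  proof -
    have "(\<Sum>k\<in>{m + 2}. s ^ k /\<^sub>R fact k) \<le> exp s"
      unfolding exp_def by (rule sum_le_suminf) (use s summable_exp_generic[of s] in auto)
    then show ?thesis by simp
  qed
  then have "s ^ (m + 2) \<le> fact (m + 2) * exp s"
    using fact_gt_zero[of "m + 2", where 'a = real]
    by (simp add: field_simps del: fact_Suc power_Suc add_2_eq_Suc')
  then have "s ^ m * exp (- s) \<le> fact (m + 2) * (inverse s)\<^sup>2"
    using s by (simp add: exp_minus field_simps power2_eq_square del: fact_Suc)
  then show ?thesis
    using s True by (simp add: flat_def s_def[symmetric])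
qed (simp add: flat_def)

lemma flat_DERIV: "(flat m has_field_derivative flat (m + 2) t - real m * flat (m + 1) t) (at t)"
proof -
  consider "t > 0" | "t < 0" | "t = 0" by linarith
  then show ?thesis
  proof cases
    case 1
    have "((\<lambda>t. inverse t ^ m * exp (- inverse t)) has_field_derivative
        flat (m + 2) t - real m * flat (m + 1) t) (at t)"
    proof -
      have "((\<lambda>t. inverse t ^ m * exp (- inverse t)) has_field_derivative
          real m * inverse t ^ (m - 1) * (- (inverse t * inverse t)) * exp (- inverse t)
          + inverse t ^ m * (exp (- inverse t) * (inverse t * inverse t))) (at t)"
        using 1 by (auto intro!: derivative_eq_intros simp: algebra_simps)
      moreover have "real m * inverse t ^ (m - 1) * (- (inverse t * inverse t)) * exp (- inverse t)
          + inverse t ^ m * (exp (- inverse t) * (inverse t * inverse t))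
          = flat (m + 2) t - real m * flat (m + 1) t"
        using 1 by (cases m) (simp_all add: flat_def algebra_simps)
      ultimately show ?thesis by metis
    qed
    moreover have ev: "eventually (\<lambda>t. inverse t ^ m * exp (- inverse t) = flat m t) (nhds t)"
      using eventually_nhds_in_open[of "{0<..}" t] 1 by (auto simp: flat_def elim!: eventually_mono)
    ultimately show ?thesis using DERIV_cong_ev[OF refl ev refl] by iprover
  next
    case 2
    have ev: "eventually (\<lambda>t. 0 = flat m t) (nhds t)"
      using eventually_nhds_in_open[of "{..<0}" t] 2 by (auto simp: flat_def elim!: eventually_mono)
    moreover have "((\<lambda>_. 0) has_field_derivative flat (m + 2) t - real m * flat (m + 1) t) (at t)"
      using 2 by (simp add: flat_def)
    ultimately show ?thesis using DERIV_cong_ev[OF refl ev refl] by iprover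
  next
    case 3
    \<comment> \<open>Both terms of the claimed derivative vanish at \<open>0\<close>.\<close>
    have "((\<lambda>h. (flat m (0 + h) - flat m 0) / h) \<longlongrightarrow> 0) (at 0)"
    proof (rule Lim_null_comparison)
      show "eventually (\<lambda>h. norm ((flat m (0 + h) - flat m 0) / h) \<le> fact (m + 2) * \<bar>h\<bar>) (at 0)"
      proof (rule always_eventually, rule allI)
        fix h :: real
        show "norm ((flat m (0 + h) - flat m 0) / h) \<le> fact (m + 2) * \<bar>h\<bar>"
        proof (cases "h = 0")
          case False
          have "\<bar>flat m h\<bar> / \<bar>h\<bar> \<le> fact (m + 2) * h\<^sup>2 / \<bar>h\<bar>"
            by (rule divide_right_mono[OF flat_quadratic_bound]) simp
          also have "\<dots> = fact (m + 2) * \<bar>h\<bar>"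
            using False by (simp add: power2_eq_square abs_if)
          finally show ?thesis by (simp add: flat_def[of m 0])
        qed simp
      qed
      show "((\<lambda>h. fact (m + 2) * \<bar>h\<bar>) \<longlongrightarrow> 0) (at (0::real))"
        by (rule tendsto_eq_intros | simp)+
    qed
    then show ?thesis using 3 by (simp add: DERIV_def flat_def)
  qed
qed

lemma continuous_on_flat: "continuous_on UNIV (flat m)"
  by (rule DERIV_continuous_on[OF flat_DERIV])

lemma diff_upto_flat: "diff_upto n k f \<Longrightarrow> diff_upto n k (\<lambda>x. flat m (f x))"
proof (induction k arbitrary: m)
  case 0
  then show ?case
    using continuous_on_compose2[OF continuous_on_flat] by (simp add: diff_upto_0)
next
  case (Suc k)
  show ?case unfolding diff_upto_Suc
  proof (intro conjI allI impI)
    show "continuous_on UNIV (\<lambda>x. flat m (f x))"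
      by (rule continuous_on_compose2[OF continuous_on_flat diff_upto_continuous[OF Suc.prems]]) simp
    fix i assume "i < n"
    obtain f' where f: "has_partial i f f'" "diff_upto n k f'"
      using diff_upto_SucE[OF Suc.prems(1) \<open>i < n\<close>] .
    have "has_partial i (\<lambda>x. flat m (f x))
        (\<lambda>x. (flat (m + 2) (f x) + (- real m) * flat (m + 1) (f x)) * f' x)"
      unfolding has_partial_def
    proof
      fix x
      show "((\<lambda>t. flat m (f (x(i := t)))) has_field_derivative
             (flat (m + 2) (f x) + (- real m) * flat (m + 1) (f x)) * f' x) (at (x i))"
        using DERIV_chain2[of "flat m" _ "\<lambda>t. f (x(i := t))" "x i", OF flat_DERIV
            f(1)[unfolded has_partial_def, rule_format]] by simp
    qed
    moreover have "diff_upto n k (\<lambda>x. (flat (m + 2) (f x) + (- real m) * flat (m + 1) (f x)) * f' x)"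
      using Suc.IH Suc.prems f diff_upto_mono[of n "Suc k" f k]
      by (intro diff_upto_mult diff_upto_add diff_upto_const) auto
    ultimately show "\<exists>h. has_partial i (\<lambda>x. flat m (f x)) h \<and> diff_upto n k h"
      by blast
  qed
qed

lemma smooth_flat: "smooth n f \<Longrightarrow> smooth n (\<lambda>x. flat m (f x))"
  by (simp add: smooth_iff_diff_upto diff_upto_flat depends_on_first_pair[of n f f "\<lambda>t _. flat m t"])

lemma flat_0_sign: "flat 0 t \<noteq> 0 \<longleftrightarrow> t > 0" "flat 0 t \<ge> 0"
  by (auto simp: flat_def)

text \<open>
  The step function is locally constant around \<open>0\<close> and \<open>1\<close>.  This is recorded multiplicatively below,
  as the vanishing of a product with a smooth function that is nonzero at \<open>0\<close> respectively at \<open>1\<close>, because an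
  identity between smooth functions is what carries over to a \<open>C\<^sup>\<infinity>\<close>-ring.
\<close>

definition smooth_step :: "real \<Rightarrow> real" where
  "smooth_step t = flat 0 (t - 1/3) * inverse (flat 0 (t - 1/3) + flat 0 (2/3 - t))"

lemma smooth_step_denominator: "flat 0 (t - 1/3) + flat 0 (2/3 - t) \<noteq> 0"
  using flat_0_sign[of "t - 1/3"] flat_0_sign[of "2/3 - t"] by linarith

lemma smooth_smooth_step: "smooth n f \<Longrightarrow> smooth n (\<lambda>x. smooth_step (f x))"
  unfolding smooth_step_def
  by (rule smooth_mult smooth_inverse smooth_add smooth_flat smooth_diff smooth_const
      smooth_step_denominator | assumption)+

lemma smooth_step_near_0: "flat 0 (1/3 - t) * smooth_step t = 0"
  by (cases "t < 1/3") (simp_all add: smooth_step_def flat_def)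

lemma smooth_step_near_1: "flat 0 (t - 2/3) * (1 - smooth_step t) = 0"
proof (cases "t > 2/3")
  case True
  then have "flat 0 (2/3 - t) = 0" "flat 0 (t - 1/3) \<noteq> 0"
    by (auto simp: flat_def)
  then show ?thesis by (simp add: smooth_step_def)
qed (simp add: flat_def)

section \<open>Local \<open>C\<^sup>\<infinity>\<close>-rings\<close>

lemma ring_of_simps [simp]:
  "carrier (ring_of A) = carrier A"
  "mult (ring_of A) = cinf_binop A (*)"
  "add (ring_of A) = cinf_binop A (+)"
  "one (ring_of A) = cinf_const A 1"
  "zero (ring_of A) = cinf_const A 0"
  by (simp_all add: ring_of_def)

lemma cinf_hom_binop:
  assumes h: "h \<in> cinf_hom A B" and "smooth 2 (\<lambda>x. k (x 0) (x 1))"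
    and "a \<in> carrier A" "b \<in> carrier A"
  shows "h (cinf_binop A k a b) = cinf_binop B k (h a) (h b)"
proof -
  have "(\<lambda>i. h (if i = (0::nat) then a else b)) = (\<lambda>i. if i = 0 then h a else h b)"
    by auto
  then show ?thesis
    using assms unfolding cinf_hom_def cinf_binop_def by simp
qed

lemma smooth_plus_times: "smooth 2 (\<lambda>x. x 0 + x 1)" "smooth 2 (\<lambda>x. x 0 * x 1)"
  by (rule smooth_add smooth_mult smooth_proj | simp)+

context cinf_ring
begin

lemma binop_op:
  assumes "smooth 2 (\<lambda>x. h (x 0) (x 1))" "smooth n f" "smooth n g"
    and "\<And>i. i < n \<Longrightarrow> a i \<in> carrier A"
  shows "cinf_binop A h (cinf_op A n f a) (cinf_op A n g a) = cinf_op A n (\<lambda>x. h (f x) (g x)) a"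
proof -
  have "smooth n (if j = 0 then f else g)" for j :: nat
    using assms by simp
  from op_comp[OF assms(1) this assms(4)]
  have "cinf_op A 2 (\<lambda>x. h (x 0) (x 1)) (\<lambda>j. cinf_op A n (if j = 0 then f else g) a)
      = cinf_op A n (\<lambda>x. h (f x) (g x)) a"
    by simp
  moreover have "(\<lambda>j. cinf_op A n (if j = (0::nat) then f else g) a)
      = (\<lambda>i. if i = 0 then cinf_op A n f a else cinf_op A n g a)"
    by auto
  ultimately show ?thesis unfolding cinf_binop_def by simp
qed

lemma const_op:
  assumes "\<And>i. i < n \<Longrightarrow> a i \<in> carrier A"
  shows "cinf_const A c = cinf_op A n (\<lambda>_. c) a"
proof -
  have "cinf_op A 0 (\<lambda>_. c) (\<lambda>j. cinf_op A n (\<lambda>_. 0) a) = cinf_op A n (\<lambda>x. c) a"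
    using op_comp[of 0 "\<lambda>_. c" n "\<lambda>_ _. 0" a] assms smooth_const by simp
  moreover have "cinf_op A 0 (\<lambda>_. c) (\<lambda>j. cinf_op A n (\<lambda>_. 0) a) = cinf_const A c"
    unfolding cinf_const_def by (rule op_cong) (auto intro: smooth_const)
  ultimately show ?thesis by simp
qed

lemma op_add:
  "smooth n f \<Longrightarrow> smooth n g \<Longrightarrow> (\<And>i. i < n \<Longrightarrow> a i \<in> carrier A) \<Longrightarrow>
    cinf_op A n f a \<oplus>\<^bsub>ring_of A\<^esub> cinf_op A n g a = cinf_op A n (\<lambda>x. f x + g x) a"
  using binop_op[of "(+)"] smooth_plus_times by simp

lemma op_mult:
  "smooth n f \<Longrightarrow> smooth n g \<Longrightarrow> (\<And>i. i < n \<Longrightarrow> a i \<in> carrier A) \<Longrightarrow>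
    cinf_op A n f a \<otimes>\<^bsub>ring_of A\<^esub> cinf_op A n g a = cinf_op A n (\<lambda>x. f x * g x) a"
  using binop_op[of "(*)"] smooth_plus_times by simp

lemma const_closed: "cinf_const A c \<in> carrier A"
  unfolding cinf_const_def by (rule op_closed) (auto intro: smooth_const)

text \<open>
  Three elements are the values of coordinate functions at one tuple.  Hence every polynomial identity
  between real numbers holds in a \<open>C\<^sup>\<infinity>\<close>-ring, which gives the ring axioms below.
\<close>

lemma triple_as_op:
  assumes "a \<in> carrier A" "b \<in> carrier A" "c \<in> carrier A"
  obtains t where "\<And>i. i < 3 \<Longrightarrow> t i \<in> carrier A"
    "a = cinf_op A 3 (\<lambda>x. x 0) t" "b = cinf_op A 3 (\<lambda>x. x 1) t" "c = cinf_op A 3 (\<lambda>x. x 2) t"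
proof
  let ?t = "\<lambda>i::nat. if i = 0 then a else if i = 1 then b else c"
  show "?t i \<in> carrier A" for i using assms by simp
  then show "a = cinf_op A 3 (\<lambda>x. x 0) ?t" "b = cinf_op A 3 (\<lambda>x. x 1) ?t"
      "c = cinf_op A 3 (\<lambda>x. x 2) ?t"
    using op_proj[of _ 3 ?t] by simp_all
qed

lemma cring_ring_of: "cring (ring_of A)"
proof -
  let ?R = "ring_of A"
  have sm: "smooth 3 (\<lambda>x. x 0)" "smooth 3 (\<lambda>x. x 1)" "smooth 3 (\<lambda>x. x 2)"
    by (simp_all del: One_nat_def add: smooth_proj)
  note sms = sm smooth_const smooth_add smooth_mult
  note rw = op_add[unfolded ring_of_simps] op_mult[unfolded ring_of_simps]
  have closed: "x \<oplus>\<^bsub>?R\<^esub> y \<in> carrier A" "x \<otimes>\<^bsub>?R\<^esub> y \<in> carrier A"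
      and comm: "x \<oplus>\<^bsub>?R\<^esub> y = y \<oplus>\<^bsub>?R\<^esub> x" "x \<otimes>\<^bsub>?R\<^esub> y = y \<otimes>\<^bsub>?R\<^esub> x"
      and assoc: "(x \<oplus>\<^bsub>?R\<^esub> y) \<oplus>\<^bsub>?R\<^esub> z = x \<oplus>\<^bsub>?R\<^esub> (y \<oplus>\<^bsub>?R\<^esub> z)"
        "(x \<otimes>\<^bsub>?R\<^esub> y) \<otimes>\<^bsub>?R\<^esub> z = x \<otimes>\<^bsub>?R\<^esub> (y \<otimes>\<^bsub>?R\<^esub> z)"
      and distr: "(x \<oplus>\<^bsub>?R\<^esub> y) \<otimes>\<^bsub>?R\<^esub> z = x \<otimes>\<^bsub>?R\<^esub> z \<oplus>\<^bsub>?R\<^esub> y \<otimes>\<^bsub>?R\<^esub> z"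
      and unit: "\<zero>\<^bsub>?R\<^esub> \<oplus>\<^bsub>?R\<^esub> x = x" "\<one>\<^bsub>?R\<^esub> \<otimes>\<^bsub>?R\<^esub> x = x"
      and neg: "\<exists>y \<in> carrier A. y \<oplus>\<^bsub>?R\<^esub> x = \<zero>\<^bsub>?R\<^esub>"
    if xyz: "x \<in> carrier A" "y \<in> carrier A" "z \<in> carrier A" for x y z
  proof -
    obtain t where t: "\<And>i. i < 3 \<Longrightarrow> t i \<in> carrier A"
      and xyz_t: "x = cinf_op A 3 (\<lambda>x. x 0) t" "y = cinf_op A 3 (\<lambda>x. x 1) t" "z = cinf_op A 3 (\<lambda>x. x 2) t"
      using triple_as_op[OF xyz] by metis
    note const = const_op[of 3 t, OF t]
    show "x \<oplus>\<^bsub>?R\<^esub> y \<in> carrier A" "x \<otimes>\<^bsub>?R\<^esub> y \<in> carrier A"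
      unfolding xyz_t by (simp_all del: One_nat_def add: rw sms t op_closed)
    show "x \<oplus>\<^bsub>?R\<^esub> y = y \<oplus>\<^bsub>?R\<^esub> x" "x \<otimes>\<^bsub>?R\<^esub> y = y \<otimes>\<^bsub>?R\<^esub> x"
      unfolding xyz_t by (simp_all del: One_nat_def add: rw sms t add.commute mult.commute)
    show "(x \<oplus>\<^bsub>?R\<^esub> y) \<oplus>\<^bsub>?R\<^esub> z = x \<oplus>\<^bsub>?R\<^esub> (y \<oplus>\<^bsub>?R\<^esub> z)"
        "(x \<otimes>\<^bsub>?R\<^esub> y) \<otimes>\<^bsub>?R\<^esub> z = x \<otimes>\<^bsub>?R\<^esub> (y \<otimes>\<^bsub>?R\<^esub> z)"
        "(x \<oplus>\<^bsub>?R\<^esub> y) \<otimes>\<^bsub>?R\<^esub> z = x \<otimes>\<^bsub>?R\<^esub> z \<oplus>\<^bsub>?R\<^esub> y \<otimes>\<^bsub>?R\<^esub> z"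
      unfolding xyz_t by (simp_all del: One_nat_def add: rw sms t add.assoc mult.assoc distrib_right)
    show "\<zero>\<^bsub>?R\<^esub> \<oplus>\<^bsub>?R\<^esub> x = x" "\<one>\<^bsub>?R\<^esub> \<otimes>\<^bsub>?R\<^esub> x = x"
      unfolding xyz_t by (simp_all del: One_nat_def add: const rw sms t)
    have "cinf_op A 3 (\<lambda>x. - x 0) t \<oplus>\<^bsub>?R\<^esub> x = \<zero>\<^bsub>?R\<^esub>"
      unfolding xyz_t by (simp del: One_nat_def add: const rw sms t smooth_uminus)
    then show "\<exists>y \<in> carrier A. y \<oplus>\<^bsub>?R\<^esub> x = \<zero>\<^bsub>?R\<^esub>"
      using op_closed[OF smooth_uminus[OF sm(1)], of t] t by blast
  qed
  show ?thesis
  proof (rule cringI)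
    show "abelian_group ?R"
      by (rule abelian_groupI)
         (use closed comm assoc unit neg in \<open>simp_all add: const_closed\<close>)
    show "comm_monoid ?R"
      by (rule comm_monoidI) (use closed comm assoc unit in \<open>simp_all add: const_closed\<close>)
  qed (use distr in simp)
qed

lemma op_minus:
  assumes "smooth n f" "smooth n g" "\<And>i. i < n \<Longrightarrow> a i \<in> carrier A"
  shows "cinf_op A n f a \<ominus>\<^bsub>ring_of A\<^esub> cinf_op A n g a = cinf_op A n (\<lambda>x. f x - g x) a"
proof -
  interpret R: cring "ring_of A" by (rule cring_ring_of)
  have cl: "cinf_op A n h a \<in> carrier (ring_of A)" if "smooth n h" for h
    using op_closed assms that by simp
  have "cinf_op A n f a = cinf_op A n (\<lambda>x. f x - g x) a \<oplus>\<^bsub>ring_of A\<^esub> cinf_op A n g a"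
    by (subst op_add) (auto intro: smooth_diff assms)
  then show ?thesis
    using cl[OF assms(1)] cl[OF assms(2)] cl[OF smooth_diff[OF assms(1,2)]]
    by (simp add: R.minus_eq R.add.m_assoc R.r_neg del: ring_of_simps)
qed

lemma nonzero_const_unit: "c \<noteq> 0 \<Longrightarrow> cinf_const A c \<in> Units (ring_of A)"
proof -
  assume "c \<noteq> 0"
  interpret R: cring "ring_of A" by (rule cring_ring_of)
  have "cinf_const A c \<otimes>\<^bsub>ring_of A\<^esub> cinf_const A (inverse c) = \<one>\<^bsub>ring_of A\<^esub>"
    using op_mult[of 0 "\<lambda>_. c" "\<lambda>_. inverse c" "\<lambda>_. undefined"] \<open>c \<noteq> 0\<close>
    by (simp add: cinf_const_def smooth_const)
  then show ?thesis
    using R.Units_one_closed R.unit_factor const_closed by (metis ring_of_simps(1))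
qed

end

text \<open>
  Zorn's lemma for the ideals that contain \<open>a\<close> and avoid \<open>1\<close>; the principal ideal of \<open>a\<close> is one of them.
\<close>

lemma (in cring) nonunit_in_maximalideal:
  assumes a: "a \<in> carrier R" "a \<notin> Units R"
  obtains M where "maximalideal M R" "a \<in> M"
proof -
  let ?P = "{I. ideal I R \<and> a \<in> I \<and> \<one> \<notin> I}"
  have "\<one> \<notin> PIdl a"
  proof
    assume "\<one> \<in> PIdl a"
    then obtain x where x: "x \<in> carrier R" "x \<otimes> a = \<one>" by (auto simp: cgenideal_def)
    then have "a \<otimes> x = \<one>" using a m_comm by simp
    then show False using x a by (auto simp: Units_def)
  qed
  then have "PIdl a \<in> ?P"
    using cgenideal_ideal cgenideal_self a by blast
  moreover have "\<Union>C \<in> ?P" if "C \<noteq> {}" "subset.chain ?P C" for C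
  proof -
    have "subset.chain {I. ideal I R} C"
      using that(2) unfolding subset.chain_def by blast
    from chain_Union_is_ideal[OF this] have "ideal (\<Union>C) R" using that(1) by simp
    then show ?thesis using that unfolding subset.chain_def by blast
  qed
  ultimately have "\<exists>M\<in>?P. \<forall>J\<in>?P. M \<subseteq> J \<longrightarrow> J = M"
    by (intro subset_Zorn_nonempty) auto
  then obtain M where M: "M \<in> ?P" "\<And>J. J \<in> ?P \<Longrightarrow> M \<subseteq> J \<Longrightarrow> J = M"
    by (elim bexE) simp
  have "maximalideal M R"
  proof (rule maximalidealI)
    fix J assume J: "ideal J R" "M \<subseteq> J" "J \<subseteq> carrier R"
    show "J = M \<or> J = carrier R"
    proof (cases "\<one> \<in> J")
      case True
      then show ?thesis using ideal.one_imp_carrier[OF J(1)] by blast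
    next
      case False
      then show ?thesis using M J by blast
    qed
  qed (use M in auto)
  then show thesis using that M by blast
qed

text \<open>
  What is used of a local \<open>C\<^sup>\<infinity>\<close>-ring: \<open>c\<close> in the last condition is the residue of \<open>a\<close>.
\<close>

locale cinf_residue_ideal = cinf_ring +
  fixes M
  assumes M_ideal: "ideal M (ring_of A)"
    and M_proper: "\<one>\<^bsub>ring_of A\<^esub> \<notin> M"
    and nonunit_in_M: "\<lbrakk>a \<in> carrier A; a \<notin> Units (ring_of A)\<rbrakk> \<Longrightarrow> a \<in> M"
    and real_residue: "a \<in> carrier A \<Longrightarrow> \<exists>c. a \<ominus>\<^bsub>ring_of A\<^esub> cinf_const A c \<in> M"

text \<open>
  Uniqueness of the maximal ideal puts all nonunits into it.  The isomorphism of the residue field with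
  \<open>\<real>\<close> identifies the classes of constants with all of \<open>\<real>\<close>, so every class contains a constant.
\<close>

lemma local_cinf_ring_residue_ideal:
  assumes "cinf_ring A" "local_cinf_ring A"
  obtains M where "cinf_residue_ideal A M"
proof -
  interpret cinf_ring A by fact
  interpret R: cring "ring_of A" by (rule cring_ring_of)
  obtain M h where M: "maximalideal M (ring_of A)" "\<And>N. maximalideal N (ring_of A) \<Longrightarrow> N = M"
    and h: "h \<in> ring_iso (ring_of A Quot M) (ring_of real_cinf)"
    and hc: "\<And>c. h (M +>\<^bsub>ring_of A\<^esub> cinf_const A c) = c"
    using assms(2) unfolding local_cinf_ring_def by blast
  interpret M: maximalideal M "ring_of A" by (rule M(1))
  have "cinf_residue_ideal A M"
  proof (intro cinf_residue_ideal.intro cinf_residue_ideal_axioms.intro)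
    show "cinf_ring A" by fact
    show "ideal M (ring_of A)" by (rule M.is_ideal)
    show "\<one>\<^bsub>ring_of A\<^esub> \<notin> M" using M.one_imp_carrier M.I_notcarr by blast
    show "a \<in> M" if "a \<in> carrier A" "a \<notin> Units (ring_of A)" for a
      using R.nonunit_in_maximalideal[of a] that M(2) by (metis ring_of_simps(1))
    show "\<exists>c. a \<ominus>\<^bsub>ring_of A\<^esub> cinf_const A c \<in> M" if a: "a \<in> carrier A" for a
    proof -
      define c where "c = h (M +>\<^bsub>ring_of A\<^esub> a)"
      have "inj_on h (carrier (ring_of A Quot M))"
        using h by (auto simp: ring_iso_def bij_betw_def)
      moreover have "M +>\<^bsub>ring_of A\<^esub> b \<in> carrier (ring_of A Quot M)" if "b \<in> carrier A" for b
        using that by (auto simp: FactRing_def A_RCOSETS_def')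
      ultimately have "M +>\<^bsub>ring_of A\<^esub> a = M +>\<^bsub>ring_of A\<^esub> cinf_const A c"
        using a const_closed hc c_def by (metis inj_onD)
      then show ?thesis
        using R.quotient_eq_iff_same_a_r_cos[OF M.is_ideal] a const_closed by auto
    qed
  qed
  then show thesis by (rule that)
qed

context cinf_residue_ideal
begin

lemma M_subset: "M \<subseteq> carrier A"
  using ideal.Icarr[OF M_ideal] by auto

lemma unit_notin_M: "u \<in> Units (ring_of A) \<Longrightarrow> u \<notin> M"
proof
  assume u: "u \<in> Units (ring_of A)" "u \<in> M"
  interpret R: cring "ring_of A" by (rule cring_ring_of)
  from u have "inv\<^bsub>ring_of A\<^esub> u \<otimes>\<^bsub>ring_of A\<^esub> u \<in> M"
    using ideal.I_l_closed[OF M_ideal] R.Units_inv_closed by blast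
  then show False using u R.Units_l_inv M_proper by simp
qed

lemma const_in_M_iff: "cinf_const A c \<in> M \<longleftrightarrow> c = 0"
  using unit_notin_M nonzero_const_unit additive_subgroup.zero_closed[OF ideal.axioms(1)[OF M_ideal]]
  by (metis ring_of_simps(5))

lemma square_sum_in_M:
  assumes "\<And>i. i < (m::nat) \<Longrightarrow> smooth n (g i)" "\<And>i. i < n \<Longrightarrow> a i \<in> carrier A"
    and "\<And>i. i < m \<Longrightarrow> cinf_op A n (g i) a \<in> M"
  shows "cinf_op A n (\<lambda>x. \<Sum>i<m. g i x * g i x) a \<in> M"
  using assms(1,3)
proof (induction m)
  case 0
  then show ?case
    using const_in_M_iff[of 0] const_op[of n a 0] assms(2) by simp
next
  case (Suc m)
  have "cinf_op A n (\<lambda>x. (\<Sum>i<m. g i x * g i x) + g m x * g m x) a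
      = cinf_op A n (\<lambda>x. \<Sum>i<m. g i x * g i x) a
        \<oplus>\<^bsub>ring_of A\<^esub> (cinf_op A n (g m) a \<otimes>\<^bsub>ring_of A\<^esub> cinf_op A n (g m) a)"
    using Suc.prems assms(2)
    by (simp add: op_add[unfolded ring_of_simps] op_mult[unfolded ring_of_simps] smooth_sum smooth_mult)
  moreover have "\<dots> \<in> M"
    using Suc assms(2) op_closed[of n "g m" a] M_subset
    by (intro additive_subgroup.a_closed[OF ideal.axioms(1)[OF M_ideal]] ideal.I_l_closed[OF M_ideal]) auto
  ultimately show ?case by simp
qed

text \<open>
  The residue map, a priori only a homomorphism of \<open>\<real>\<close>-algebras, commutes with all smooth operations.
  If the residue \<open>d\<close> of \<open>f(a)\<close> differed from \<open>f(c)\<close>, the smooth function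
  \<open>(f - d)\<^sup>2 + \<Sum>\<^sub>i (x\<^sub>i - c\<^sub>i)\<^sup>2\<close> would have no zero, so its value at \<open>a\<close> would be a unit; but this value lies in \<open>M\<close>.
\<close>

lemma residue_op:
  assumes f: "smooth n f" and a: "\<And>i. i < n \<Longrightarrow> a i \<in> carrier A"
    and c: "\<And>i. i < n \<Longrightarrow> a i \<ominus>\<^bsub>ring_of A\<^esub> cinf_const A (c i) \<in> M"
  shows "cinf_op A n f a \<ominus>\<^bsub>ring_of A\<^esub> cinf_const A (f c) \<in> M"
proof -
  obtain d where d: "cinf_op A n f a \<ominus>\<^bsub>ring_of A\<^esub> cinf_const A d \<in> M"
    using real_residue op_closed[OF f, of a] a by blast
  have "d = f c"
  proof (rule ccontr)
    assume "d \<noteq> f c"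
    \<comment> \<open>The summand with index \<open>n\<close> is \<open>f - d\<close>, so that one sum of squares over \<open>i \<le> n\<close> covers all terms.\<close>
    define g where "g i x = (if i < n then x i - c i else f x - d)" for i x
    define s where "s x = (\<Sum>i<Suc n. g i x * g i x)" for x
    have g: "smooth n (g i)" for i
      unfolding g_def using f by (cases "i < n") (auto intro: smooth_diff smooth_proj smooth_const)
    have "cinf_op A n (g i) a \<in> M" if "i < Suc n" for i
    proof (cases "i < n")
      case True
      then have "g i = (\<lambda>x. x i - c i)" by (simp add: g_def fun_eq_iff)
      then have "a i \<ominus>\<^bsub>ring_of A\<^esub> cinf_const A (c i) = cinf_op A n (g i) a"
        using op_minus[of n "\<lambda>x. x i" "\<lambda>_. c i" a] op_proj[of i n a] a const_op[of n a "c i"] True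
        by (simp add: smooth_proj smooth_const)
      then show ?thesis using c[OF True] by simp
    next
      case False
      then have "g i = (\<lambda>x. f x - d)" by (simp add: g_def fun_eq_iff)
      then have "cinf_op A n f a \<ominus>\<^bsub>ring_of A\<^esub> cinf_const A d = cinf_op A n (g i) a"
        using op_minus[of n f "\<lambda>_. d" a] a const_op[of n a d] f
        by (simp add: smooth_const)
      then show ?thesis using d by simp
    qed
    then have "cinf_op A n s a \<in> M"
      unfolding s_def using square_sum_in_M[of "Suc n" n g a] g a by simp
    have s0: "s x \<noteq> 0" for x
    proof
      assume "s x = 0"
      then have "\<forall>i\<in>{..<Suc n}. g i x * g i x = 0"
        unfolding s_def by (subst (asm) sum_nonneg_eq_0_iff) auto
      then have "x i = c i" if "i < n" for i using that by (auto simp: g_def split: if_splits)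
      moreover have "f x = d"
        using \<open>\<forall>i\<in>{..<Suc n}. g i x * g i x = 0\<close>[rule_format, of n] by (simp add: g_def)
      ultimately show False
        using f \<open>d \<noteq> f c\<close> unfolding smooth_def depends_on_first_def by metis
    qed
    have s: "smooth n s"
      unfolding s_def using smooth_sum[of "Suc n" n "\<lambda>i x. g i x * g i x"] g smooth_mult by blast
    have "cinf_op A n (\<lambda>x. inverse (s x)) a \<otimes>\<^bsub>ring_of A\<^esub> cinf_op A n s a = cinf_const A 1"
      using op_mult[of n "\<lambda>x. inverse (s x)" s a] s s0 a const_op[of n a 1]
      by (simp add: smooth_inverse)
    moreover have "\<dots> \<notin> M" by (simp add: const_in_M_iff)
    moreover have "cinf_op A n (\<lambda>x. inverse (s x)) a \<in> carrier (ring_of A)"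
      using op_closed[OF smooth_inverse[OF s s0], of a] a by simp
    ultimately show False
      using ideal.I_l_closed[OF M_ideal \<open>cinf_op A n s a \<in> M\<close>] by fastforce
  qed
  then show ?thesis using d by simp
qed

text \<open>
  If \<open>k\<close> does not vanish at the point \<open>c\<close> of residues of \<open>a\<close>, then \<open>k(a)\<close> has a nonzero residue and is a unit,
  so it can be cancelled from \<open>k(a) f(a) = 0\<close>.
\<close>

lemma op_eq_0_if_vanishing_near:
  assumes f: "smooth n f" and k: "smooth n k" and "\<And>x. k x * f x = 0" and "k c \<noteq> 0"
    and a: "\<And>i. i < n \<Longrightarrow> a i \<in> carrier A"
    and c: "\<And>i. i < n \<Longrightarrow> a i \<ominus>\<^bsub>ring_of A\<^esub> cinf_const A (c i) \<in> M"
  shows "cinf_op A n f a = \<zero>\<^bsub>ring_of A\<^esub>"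
proof -
  interpret R: cring "ring_of A" by (rule cring_ring_of)
  interpret M: ideal M "ring_of A" by (rule M_ideal)
  let ?k = "cinf_op A n k a"
  have kc: "?k \<in> carrier (ring_of A)" "cinf_op A n f a \<in> carrier (ring_of A)"
    using op_closed f k a by auto
  have "?k \<in> Units (ring_of A)"
  proof (rule ccontr)
    assume "?k \<notin> Units (ring_of A)"
    then have "?k \<in> M" using nonunit_in_M kc by simp
    from M.a_closed[OF this M.a_inv_closed[OF residue_op[OF k a c]]] have "?k \<ominus>\<^bsub>ring_of A\<^esub> (?k \<ominus>\<^bsub>ring_of A\<^esub> cinf_const A (k c)) \<in> M" by (simp add: R.minus_eq del: ring_of_simps)
    moreover have "?k \<ominus>\<^bsub>ring_of A\<^esub> (?k \<ominus>\<^bsub>ring_of A\<^esub> cinf_const A (k c)) = cinf_const A (k c)"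
      using kc const_closed[of "k c", folded ring_of_simps(1)]
      by (simp add: R.minus_eq R.minus_add R.r_neg2 del: ring_of_simps)
    ultimately show False using const_in_M_iff assms(4) by simp
  qed
  moreover have "?k \<otimes>\<^bsub>ring_of A\<^esub> cinf_op A n f a = \<zero>\<^bsub>ring_of A\<^esub>"
    using op_mult[OF k f a] assms(3) const_op[of n a 0] a by simp
  ultimately show ?thesis
    using kc R.Units_l_cancel[of ?k "cinf_op A n f a" "\<zero>\<^bsub>ring_of A\<^esub>"] R.r_null R.zero_closed by metis
qed

lemma smooth_step_op_M:
  assumes "a \<in> M"
  shows "cinf_op A 1 (\<lambda>x. smooth_step (x 0)) (\<lambda>_. a) = \<zero>\<^bsub>ring_of A\<^esub>"
proof (rule op_eq_0_if_vanishing_near[where k = "\<lambda>x. flat 0 (1/3 - x 0)" and c = "\<lambda>_. 0"])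
  interpret R: cring "ring_of A" by (rule cring_ring_of)
  show a: "\<And>i. i < 1 \<Longrightarrow> a \<in> carrier A" using assms M_subset by blast
  show "\<And>i. i < 1 \<Longrightarrow> a \<ominus>\<^bsub>ring_of A\<^esub> cinf_const A 0 \<in> M"
    using assms R.minus_eq R.minus_zero R.r_zero a by (metis less_one ring_of_simps(1,5))
  show "smooth 1 (\<lambda>x. smooth_step (x 0))" "smooth 1 (\<lambda>x. flat 0 (1/3 - x 0))"
    by (auto intro!: smooth_smooth_step smooth_flat smooth_proj smooth_diff smooth_const)
  show "flat 0 (1/3 - x 0) * smooth_step (x 0) = 0" for x :: "nat \<Rightarrow> real"
    by (rule smooth_step_near_0)
  show "flat 0 (1/3 - 0) \<noteq> 0" by (simp add: flat_def)
qed

lemma smooth_step_op_1: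
  assumes a: "a \<in> carrier A" and "a \<ominus>\<^bsub>ring_of A\<^esub> \<one>\<^bsub>ring_of A\<^esub> \<in> M"
  shows "cinf_op A 1 (\<lambda>x. smooth_step (x 0)) (\<lambda>_. a) = \<one>\<^bsub>ring_of A\<^esub>"
proof -
  interpret R: cring "ring_of A" by (rule cring_ring_of)
  have sm: "smooth 1 (\<lambda>x. smooth_step (x 0))"
    by (auto intro!: smooth_smooth_step smooth_proj)
  have "cinf_op A 1 (\<lambda>x. 1 - smooth_step (x 0)) (\<lambda>_. a) = \<zero>\<^bsub>ring_of A\<^esub>"
  proof (rule op_eq_0_if_vanishing_near[where k = "\<lambda>x. flat 0 (x 0 - 2/3)" and c = "\<lambda>_. 1"])
    show "smooth 1 (\<lambda>x. 1 - smooth_step (x 0))" "smooth 1 (\<lambda>x. flat 0 (x 0 - 2/3))"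
      by (auto intro!: smooth_smooth_step smooth_flat smooth_proj smooth_diff smooth_const)
    show "flat 0 (x 0 - 2/3) * (1 - smooth_step (x 0)) = 0" for x :: "nat \<Rightarrow> real"
      by (rule smooth_step_near_1)
    show "flat 0 (1 - 2/3) \<noteq> 0" by (simp add: flat_def)
  qed (use assms in simp_all)
  moreover have "cinf_op A 1 (\<lambda>x. 1 - smooth_step (x 0)) (\<lambda>_. a)
      = \<one>\<^bsub>ring_of A\<^esub> \<ominus>\<^bsub>ring_of A\<^esub> cinf_op A 1 (\<lambda>x. smooth_step (x 0)) (\<lambda>_. a)"
    using op_minus[of 1 "\<lambda>_. 1" "\<lambda>x. smooth_step (x 0)" "\<lambda>_. a"] sm a const_op[of 1 "\<lambda>_. a" 1]
    by (simp add: smooth_const)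
  moreover have "cinf_op A 1 (\<lambda>x. smooth_step (x 0)) (\<lambda>_. a) \<in> carrier (ring_of A)"
    using op_closed[OF sm] a by simp
  ultimately show ?thesis
    using R.r_right_minus_eq R.one_closed by metis
qed

end

section \<open>Stalks and germs\<close>

text \<open>
  From here on sums and products are handled by the laws of commutative rings, so the simplifier
  should no longer rewrite them to smooth operations.
\<close>

declare ring_of_simps(2-5) [simp del]

lemma cinf_hom_closed: "h \<in> cinf_hom A B \<Longrightarrow> a \<in> carrier A \<Longrightarrow> h a \<in> carrier B"
  by (auto simp: cinf_hom_def)

lemma cinf_hom_op:
  "\<lbrakk>h \<in> cinf_hom A B; smooth n f; \<And>i. i < n \<Longrightarrow> a i \<in> carrier A\<rbrakk>
    \<Longrightarrow> h (cinf_op A n f a) = cinf_op B n f (\<lambda>i. h (a i))"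
  by (auto simp: cinf_hom_def)

lemma cinf_hom_const:
  assumes "h \<in> cinf_hom A B" "cinf_ring B"
  shows "h (cinf_const A c) = cinf_const B c"
proof -
  have "h (cinf_const A c) = cinf_op B 0 (\<lambda>_. c) (\<lambda>_. h undefined)"
    unfolding cinf_const_def by (rule cinf_hom_op[OF assms(1)]) (auto intro: smooth_const)
  also have "\<dots> = cinf_const B c"
    unfolding cinf_const_def by (rule cinf_ring.op_cong[OF assms(2)]) (auto intro: smooth_const)
  finally show ?thesis .
qed

lemma cinf_hom_ring_hom:
  assumes "h \<in> cinf_hom A B" "cinf_ring A" "cinf_ring B"
  shows "ring_hom_ring (ring_of A) (ring_of B) h"
proof -
  interpret A: cring "ring_of A" by (rule cinf_ring.cring_ring_of[OF assms(2)])
  interpret B: cring "ring_of B" by (rule cinf_ring.cring_ring_of[OF assms(3)])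
  show ?thesis
    by (rule ring_hom_ringI[OF A.ring_axioms B.ring_axioms])
       (use assms(1) in \<open>auto simp: ring_of_simps(2-5) cinf_hom_closed cinf_hom_const[OF assms(1,3)]
          cinf_hom_binop[OF assms(1) smooth_plus_times(1)]
          cinf_hom_binop[OF assms(1) smooth_plus_times(2)]\<close>)
qed

context cinf_presheaf
begin

lemma res_closed:
  "\<lbrakk>openin X U; openin X V; V \<subseteq> U; s \<in> carrier (sec F U)\<rbrakk> \<Longrightarrow> res F U V s \<in> carrier (sec F V)"
  using res_hom cinf_hom_closed by metis

lemma germ_eq_iff:
  assumes U: "openin X U" "p \<in> U" "s \<in> carrier (sec F U)"
    and V: "openin X V" "p \<in> V" "t \<in> carrier (sec F V)"
  shows "germ X F p U s = germ X F p V t \<longleftrightarrow>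
    (\<exists>W. openin X W \<and> p \<in> W \<and> W \<subseteq> U \<inter> V \<and> res F U W s = res F V W t)"
proof
  assume eq: "germ X F p U s = germ X F p V t"
  have "(V, t) \<in> germ X F p V t"
    unfolding germ_def using V by auto
  then have "(V, t) \<in> germ X F p U s" by (simp add: eq)
  then show "\<exists>W. openin X W \<and> p \<in> W \<and> W \<subseteq> U \<inter> V \<and> res F U W s = res F V W t"
    unfolding germ_def by blast
next
  have sub: "germ X F p U s \<subseteq> germ X F p V t"
    if U: "openin X U" "p \<in> U" "s \<in> carrier (sec F U)"
      and V: "openin X V" "p \<in> V" "t \<in> carrier (sec F V)"
      and W: "openin X W" "p \<in> W" "W \<subseteq> U \<inter> V" "res F U W s = res F V W t" for U s V t W
  proof
    fix z assume "z \<in> germ X F p U s"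
    then obtain V' t' W' where z: "z = (V', t')" "openin X V'" "p \<in> V'" "t' \<in> carrier (sec F V')"
      and W': "openin X W'" "p \<in> W'" "W' \<subseteq> U \<inter> V'" "res F U W' s = res F V' W' t'"
      unfolding germ_def by blast
    let ?W = "W \<inter> W'"
    have o: "openin X ?W" using W W' by blast
    have "res F V ?W t = res F W ?W (res F V W t)"
      using o res_comp[of V W ?W t] V W W' by auto
    also have "\<dots> = res F U ?W s"
      using o res_comp[of U W ?W s] U W W' by auto
    also have "\<dots> = res F W' ?W (res F V' W' t')"
      using o res_comp[of U W' ?W s] U W W' by auto
    also have "\<dots> = res F V' ?W t'"
      using o res_comp[of V' W' ?W t'] z W W' by auto
    finally have "openin X ?W \<and> p \<in> ?W \<and> ?W \<subseteq> V \<inter> V' \<and> res F V ?W t = res F V' ?W t'"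
      using W W' by auto
    then show "z \<in> germ X F p V t"
      unfolding germ_def using z by blast
  qed
  assume "\<exists>W. openin X W \<and> p \<in> W \<and> W \<subseteq> U \<inter> V \<and> res F U W s = res F V W t"
  then obtain W where W: "openin X W" "p \<in> W" "W \<subseteq> U \<inter> V" "res F U W s = res F V W t" by blast
  show "germ X F p U s = germ X F p V t"
    using sub[OF U V W] sub[OF V U, of W] W by auto
qed

lemma germ_res:
  assumes "openin X U" "openin X V" "V \<subseteq> U" "p \<in> V" "s \<in> carrier (sec F U)"
  shows "germ X F p V (res F U V s) = germ X F p U s"
proof -
  have "res F V V (res F U V s) = res F U V s"
    using assms res_closed res_id by blast
  then show ?thesis
    using assms res_closed[of U V s] by (subst germ_eq_iff) auto
qed

lemma germ_eq_nearby:
  assumes "openin X U" "p \<in> U" "s \<in> carrier (sec F U)" "openin X V" "p \<in> V" "t \<in> carrier (sec F V)"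
    and "germ X F p U s = germ X F p V t"
  obtains W where "openin X W" "p \<in> W" "W \<subseteq> U \<inter> V"
    "\<And>q. q \<in> W \<Longrightarrow> germ X F q U s = germ X F q V t"
proof -
  obtain W where W: "openin X W" "p \<in> W" "W \<subseteq> U \<inter> V" "res F U W s = res F V W t"
    using assms by (auto simp: germ_eq_iff)
  have "germ X F q U s = germ X F q V t" if "q \<in> W" for q
    using germ_res[of U W q s] germ_res[of V W q t] assms W that by auto
  then show thesis using that W by blast
qed

lemma germ_in_stalk:
  "openin X U \<Longrightarrow> p \<in> U \<Longrightarrow> s \<in> carrier (sec F U) \<Longrightarrow> germ X F p U s \<in> carrier (stalk X F p)"
  by (auto simp: stalk_def)

text \<open>
  Finitely many germs are represented over one neighbourhood; this, together with the next lemma, makes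
  the operations on stalks well defined.
\<close>

lemma stalk_representatives:
  fixes n :: nat
  assumes "p \<in> topspace X" "\<And>i. i < n \<Longrightarrow> g i \<in> carrier (stalk X F p)"
  shows "\<exists>U s. openin X U \<and> p \<in> U \<and> (\<forall>i<n. s i \<in> carrier (sec F U) \<and> g i = germ X F p U (s i))"
  using assms(2)
proof (induction n)
  case 0
  then show ?case using assms(1) by blast
next
  case (Suc n)
  have "\<And>i. i < n \<Longrightarrow> g i \<in> carrier (stalk X F p)" using Suc.prems by simp
  from Suc.IH[OF this] obtain U s where U: "openin X U" "p \<in> U"
    "\<forall>i<n. s i \<in> carrier (sec F U) \<and> g i = germ X F p U (s i)"
    by blast
  obtain V t where V: "openin X V" "p \<in> V" "t \<in> carrier (sec F V)" "g n = germ X F p V t"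
    using Suc.prems[of n] by (auto simp: stalk_def)
  let ?W = "U \<inter> V"
  let ?s = "\<lambda>i. if i < n then res F U ?W (s i) else res F V ?W t"
  have W: "openin X ?W" using U V by blast
  have "?s i \<in> carrier (sec F ?W)" "g i = germ X F p ?W (?s i)" if "i < Suc n" for i
  proof -
    show "?s i \<in> carrier (sec F ?W)"
      using U V W res_closed by auto
    show "g i = germ X F p ?W (?s i)"
      using U V W germ_res[of U ?W p "s i"] germ_res[of V ?W p t] that by (auto simp: less_Suc_eq)
  qed
  then have "\<forall>i<Suc n. ?s i \<in> carrier (sec F ?W) \<and> g i = germ X F p ?W (?s i)"
    by blast
  then show ?case
    using W U(2) V(2) by (intro exI[of _ ?W] exI[of _ ?s] conjI) auto
qed

lemma germs_eq_common_nbhd: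
  fixes n :: nat
  assumes "openin X U" "p \<in> U" "openin X V" "p \<in> V"
    and "\<And>i. i < n \<Longrightarrow> s i \<in> carrier (sec F U)" "\<And>i. i < n \<Longrightarrow> t i \<in> carrier (sec F V)"
    and "\<And>i. i < n \<Longrightarrow> germ X F p U (s i) = germ X F p V (t i)"
  obtains W where "openin X W" "p \<in> W" "W \<subseteq> U \<inter> V" "\<And>i. i < n \<Longrightarrow> res F U W (s i) = res F V W (t i)"
  using assms(5-7)
proof (induction n arbitrary: thesis)
  case 0
  then show ?case using assms(1-4) by (metis IntI openin_Int order_refl not_less0)
next
  case (Suc n)
  obtain W where W: "openin X W" "p \<in> W" "W \<subseteq> U \<inter> V" "\<And>i. i < n \<Longrightarrow> res F U W (s i) = res F V W (t i)"
    using Suc.IH Suc.prems(2-4) by (metis less_Suc_eq)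
  obtain W' where W': "openin X W'" "p \<in> W'" "W' \<subseteq> U \<inter> V" "res F U W' (s n) = res F V W' (t n)"
    using Suc.prems(2-4)[of n] assms(1-4) by (auto simp: germ_eq_iff)
  let ?W = "W \<inter> W'"
  have o: "openin X ?W" using W W' by blast
  have "res F U ?W (s i) = res F V ?W (t i)" if "i < Suc n" for i
  proof (cases "i < n")
    case True
    then show ?thesis
      using W res_comp[of U W ?W "s i"] res_comp[of V W ?W "t i"] Suc.prems(2-4)[OF that] assms(1,3) o
      by auto
  next
    case False
    then have "i = n" using that by simp
    then show ?thesis
      using W' res_comp[of U W' ?W "s i"] res_comp[of V W' ?W "t i"] Suc.prems(2-4)[OF that] assms(1,3) o
      by auto
  qed
  then show ?case using Suc.prems(1)[of ?W] W W' o by blast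
qed

text \<open>
  An operation that can be computed on representatives of germs.  Smooth functions give such operations,
  and so do their composites, which are the operations that the composition law of the stalks
  is about.
\<close>

definition natural_op :: "nat \<Rightarrow> ((nat \<Rightarrow> real) \<Rightarrow> real) \<Rightarrow> bool" where
  "natural_op n f \<longleftrightarrow> (\<forall>U s. openin X U \<longrightarrow> (\<forall>i<n. s i \<in> carrier (sec F U)) \<longrightarrow>
     cinf_op (sec F U) n f s \<in> carrier (sec F U) \<and>
     (\<forall>V t. openin X V \<longrightarrow> V \<subseteq> U \<longrightarrow> (\<forall>i<n. t i = res F U V (s i)) \<longrightarrow>
        cinf_op (sec F V) n f t = res F U V (cinf_op (sec F U) n f s)))"

lemma natural_opD:
  assumes "natural_op n f" "openin X U" "\<And>i. i < n \<Longrightarrow> s i \<in> carrier (sec F U)"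
  shows "cinf_op (sec F U) n f s \<in> carrier (sec F U)"
    and "\<lbrakk>openin X V; V \<subseteq> U; \<And>i. i < n \<Longrightarrow> t i = res F U V (s i)\<rbrakk> \<Longrightarrow>
        cinf_op (sec F V) n f t = res F U V (cinf_op (sec F U) n f s)"
  using assms unfolding natural_op_def by blast+

lemma smooth_natural_op: "smooth n f \<Longrightarrow> natural_op n f"
  unfolding natural_op_def
proof (intro allI impI conjI)
  fix U s assume f: "smooth n f" and U: "openin X U" and s: "\<forall>i<n. s i \<in> carrier (sec F U)"
  then show "cinf_op (sec F U) n f s \<in> carrier (sec F U)"
    using cinf_ring.op_closed[OF sec_ring] by blast
  fix V t assume V: "openin X V" "V \<subseteq> U" and t: "\<forall>i<n. t i = res F U V (s i)"
  have "res F U V (cinf_op (sec F U) n f s) = cinf_op (sec F V) n f (\<lambda>i. res F U V (s i))"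
    using cinf_hom_op[OF res_hom[OF U V] f, of s] s by blast
  also have "\<dots> = cinf_op (sec F V) n f t"
    using t s res_closed[OF U V] by (intro cinf_ring.op_cong[OF sec_ring[OF V(1)] f]) auto
  finally show "cinf_op (sec F V) n f t = res F U V (cinf_op (sec F U) n f s)" by simp
qed

lemma composite_natural_op:
  assumes "smooth m g" "\<And>j. j < m \<Longrightarrow> smooth n (\<phi> j)"
  shows "natural_op n (\<lambda>x. g (\<lambda>j. \<phi> j x))"
  unfolding natural_op_def
proof (intro allI impI conjI)
  fix U s assume U: "openin X U" and s: "\<forall>i<n. s i \<in> carrier (sec F U)"
  have comp: "cinf_op (sec F V) n (\<lambda>x. g (\<lambda>j. \<phi> j x)) s = cinf_op (sec F V) m g (\<lambda>j. cinf_op (sec F V) n (\<phi> j) s)"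
    if "openin X V" "\<forall>i<n. s i \<in> carrier (sec F V)" for V s
    using cinf_ring.op_comp[OF sec_ring[OF that(1)], of m g n \<phi> s] assms that(2) by simp
  have phi: "cinf_op (sec F U) n (\<phi> j) s \<in> carrier (sec F U)" if "j < m" for j
    using natural_opD(1)[OF smooth_natural_op U] assms that s by blast
  then show "cinf_op (sec F U) n (\<lambda>x. g (\<lambda>j. \<phi> j x)) s \<in> carrier (sec F U)"
    unfolding comp[OF U s] by (intro natural_opD(1)[OF smooth_natural_op[OF assms(1)] U] phi)
  fix V t assume V: "openin X V" "V \<subseteq> U" and t: "\<forall>i<n. t i = res F U V (s i)"
  have tV: "\<forall>i<n. t i \<in> carrier (sec F V)" using t s res_closed[OF U V] by auto
  have "cinf_op (sec F V) n (\<phi> j) t = res F U V (cinf_op (sec F U) n (\<phi> j) s)" if "j < m" for j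
    by (rule natural_opD(2)[OF smooth_natural_op[OF assms(2)[OF that]] U _ V]) (use s t in auto)
  then show "cinf_op (sec F V) n (\<lambda>x. g (\<lambda>j. \<phi> j x)) t
      = res F U V (cinf_op (sec F U) n (\<lambda>x. g (\<lambda>j. \<phi> j x)) s)"
    unfolding comp[OF U s] comp[OF V(1) tV]
    by (intro natural_opD(2)[OF smooth_natural_op[OF assms(1)] U _ V] phi)
qed

lemma stalk_natural_op:
  assumes f: "natural_op n f" and U: "openin X U" "p \<in> U"
    and s: "\<And>i. i < n \<Longrightarrow> s i \<in> carrier (sec F U)"
    and g: "\<And>i. i < n \<Longrightarrow> g i = germ X F p U (s i)"
  shows "cinf_op (stalk X F p) n f g = germ X F p U (cinf_op (sec F U) n f s)"
proof -
  have "germ X F p V (cinf_op (sec F V) n f t) = germ X F p U (cinf_op (sec F U) n f s)"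
    if V: "openin X V" "p \<in> V" and t: "\<forall>i<n. t i \<in> carrier (sec F V) \<and> g i = germ X F p V (t i)" for V t
  proof -
    have t': "\<And>i. i < n \<Longrightarrow> t i \<in> carrier (sec F V)" using t by blast
    have eq: "germ X F p U (s i) = germ X F p V (t i)" if "i < n" for i
      using g t that by metis
    obtain W where W: "openin X W" "p \<in> W" "W \<subseteq> U \<inter> V" "\<And>i. i < n \<Longrightarrow> res F U W (s i) = res F V W (t i)"
      using germs_eq_common_nbhd[where s = s and t = t, OF U V s t' eq] by blast
    have "cinf_op (sec F W) n f (\<lambda>i. res F U W (s i)) = res F U W (cinf_op (sec F U) n f s)"
      by (rule natural_opD(2)[OF f U(1) s W(1)]) (use W in auto)
    moreover have "cinf_op (sec F W) n f (\<lambda>i. res F U W (s i)) = res F V W (cinf_op (sec F V) n f t)"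
      by (rule natural_opD(2)[OF f V(1) t' W(1)]) (use W in auto)
    ultimately have "res F V W (cinf_op (sec F V) n f t) = res F U W (cinf_op (sec F U) n f s)"
      by simp
    then show ?thesis
      using W by (subst germ_eq_iff[OF V natural_opD(1)[OF f V(1) t'] U natural_opD(1)[OF f U(1) s]]) auto
  qed
  then have unique: "\<gamma> = germ X F p U (cinf_op (sec F U) n f s)"
    if "\<exists>V t. openin X V \<and> p \<in> V \<and> (\<forall>i<n. t i \<in> carrier (sec F V) \<and> g i = germ X F p V (t i)) \<and>
         \<gamma> = germ X F p V (cinf_op (sec F V) n f t)" for \<gamma>
    using that by (elim exE conjE) simp
  have "(THE \<gamma>. \<exists>U s. openin X U \<and> p \<in> U \<and>
         (\<forall>i<n. s i \<in> carrier (sec F U) \<and> g i = germ X F p U (s i)) \<and>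
         \<gamma> = germ X F p U (cinf_op (sec F U) n f s)) = germ X F p U (cinf_op (sec F U) n f s)"
    by (rule the_equality[OF _ unique], intro exI[of _ U] exI[of _ s]) (use U s g in auto)
  then show ?thesis by (simp add: stalk_def)
qed

lemma stalk_cinf_ring:
  assumes p: "p \<in> topspace X"
  shows "cinf_ring (stalk X F p)"
proof
  fix n :: nat and f a assume f: "smooth n f" and a: "\<And>i. i < n \<Longrightarrow> a i \<in> carrier (stalk X F p)"
  obtain U s where U: "openin X U" "p \<in> U"
      and "\<forall>i<n. s i \<in> carrier (sec F U) \<and> a i = germ X F p U (s i)"
    using stalk_representatives[where n = n and g = a, OF p a] by blast
  then have s: "\<And>i. i < n \<Longrightarrow> s i \<in> carrier (sec F U)" "\<And>i. i < n \<Longrightarrow> a i = germ X F p U (s i)"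
    by simp_all
  have a_eq: "cinf_op (stalk X F p) n f a = germ X F p U (cinf_op (sec F U) n f s)"
    by (rule stalk_natural_op[OF smooth_natural_op[OF f] U s])
  show "cinf_op (stalk X F p) n f a \<in> carrier (stalk X F p)"
    unfolding a_eq by (intro germ_in_stalk[OF U] natural_opD(1)[OF smooth_natural_op[OF f] U(1)] s(1))
  fix b assume b: "\<And>i. i < n \<Longrightarrow> a i = b i"
  show "cinf_op (stalk X F p) n f a = cinf_op (stalk X F p) n f b"
    unfolding a_eq
    by (rule stalk_natural_op[OF smooth_natural_op[OF f] U s(1), symmetric]) (simp_all add: b[symmetric] s(2))
next
  fix i n :: nat and a assume i: "i < n" and a: "\<And>i. i < n \<Longrightarrow> a i \<in> carrier (stalk X F p)"
  obtain U s where U: "openin X U" "p \<in> U"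
      and "\<forall>i<n. s i \<in> carrier (sec F U) \<and> a i = germ X F p U (s i)"
    using stalk_representatives[where n = n and g = a, OF p a] by blast
  then have s: "\<And>i. i < n \<Longrightarrow> s i \<in> carrier (sec F U)" "\<And>i. i < n \<Longrightarrow> a i = germ X F p U (s i)"
    by simp_all
  show "cinf_op (stalk X F p) n (\<lambda>x. x i) a = a i"
    using stalk_natural_op[OF smooth_natural_op[OF smooth_proj[OF i]] U s]
      cinf_ring.op_proj[OF sec_ring[OF U(1)] i, of s] s i by simp
next
  fix m n :: nat and g \<phi> a
  assume g: "smooth m g" and \<phi>: "\<And>j. j < m \<Longrightarrow> smooth n (\<phi> j)"
    and a: "\<And>i. i < n \<Longrightarrow> a i \<in> carrier (stalk X F p)"
  obtain U s where U: "openin X U" "p \<in> U"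
      and "\<forall>i<n. s i \<in> carrier (sec F U) \<and> a i = germ X F p U (s i)"
    using stalk_representatives[where n = n and g = a, OF p a] by blast
  then have s: "\<And>i. i < n \<Longrightarrow> s i \<in> carrier (sec F U)" "\<And>i. i < n \<Longrightarrow> a i = germ X F p U (s i)"
    by simp_all
  have phi: "cinf_op (stalk X F p) n (\<phi> j) a = germ X F p U (cinf_op (sec F U) n (\<phi> j) s)"
      "cinf_op (sec F U) n (\<phi> j) s \<in> carrier (sec F U)" if "j < m" for j
    using stalk_natural_op[OF smooth_natural_op[OF \<phi>[OF that]] U s]
      natural_opD(1)[OF smooth_natural_op[OF \<phi>[OF that]] U(1) s(1)] by simp_all
  have "cinf_op (stalk X F p) m g (\<lambda>j. cinf_op (stalk X F p) n (\<phi> j) a)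
      = germ X F p U (cinf_op (sec F U) m g (\<lambda>j. cinf_op (sec F U) n (\<phi> j) s))"
    by (rule stalk_natural_op[OF smooth_natural_op[OF g] U]) (use phi in auto)
  also have "\<dots> = germ X F p U (cinf_op (sec F U) n (\<lambda>x. g (\<lambda>j. \<phi> j x)) s)"
    using cinf_ring.op_comp[OF sec_ring[OF U(1)], of m g n \<phi> s] g \<phi> s(1) by simp
  also have "\<dots> = cinf_op (stalk X F p) n (\<lambda>x. g (\<lambda>j. \<phi> j x)) a"
    using stalk_natural_op[OF composite_natural_op[of m g n \<phi>, OF g \<phi>] U s] by simp
  finally show "cinf_op (stalk X F p) m g (\<lambda>j. cinf_op (stalk X F p) n (\<phi> j) a)
      = cinf_op (stalk X F p) n (\<lambda>x. g (\<lambda>j. \<phi> j x)) a" .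
qed

lemma germ_hom:
  assumes U: "openin X U" "p \<in> U"
  shows "germ X F p U \<in> cinf_hom (sec F U) (stalk X F p)"
proof -
  have "germ X F p U (cinf_op (sec F U) n f a) = cinf_op (stalk X F p) n f (\<lambda>i. germ X F p U (a i))"
    if "smooth n f" "\<forall>i<n. a i \<in> carrier (sec F U)" for n f a
    using stalk_natural_op[OF smooth_natural_op[OF that(1)] U, of a] that(2) by simp
  then show ?thesis
    unfolding cinf_hom_def using germ_in_stalk[OF U] by blast
qed

lemma germ_ring_hom:
  assumes U: "openin X U" "p \<in> U"
  shows "ring_hom_ring (ring_of (sec F U)) (ring_of (stalk X F p)) (germ X F p U)"
  using cinf_hom_ring_hom[OF germ_hom[OF U] sec_ring stalk_cinf_ring] U openin_subset by blast

lemma germ_const: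
  assumes U: "openin X U" "p \<in> U"
  shows "germ X F p U (cinf_const (sec F U) c) = cinf_const (stalk X F p) c"
  using cinf_hom_const[OF germ_hom[OF U] stalk_cinf_ring] U openin_subset by blast

end

context cinf_sheaf
begin

text \<open>
  Sections with the same germs agree on the members of an open cover, so uniqueness of gluing applies.
\<close>

lemma section_eqI:
  assumes U: "openin X U" and s: "s \<in> carrier (sec F U)" and t: "t \<in> carrier (sec F U)"
    and eq: "\<And>p. p \<in> U \<Longrightarrow> germ X F p U s = germ X F p U t"
  shows "s = t"
proof -
  let ?\<V> = "{W. openin X W \<and> W \<subseteq> U \<and> res F U W s = res F U W t}"
  have Un: "\<Union>?\<V> = U"
  proof
    show "U \<subseteq> \<Union>?\<V>"
    proof
      fix p assume p: "p \<in> U"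
      from eq[OF p] obtain W where "openin X W" "p \<in> W" "W \<subseteq> U" "res F U W s = res F U W t"
        using U s t p by (auto simp: germ_eq_iff)
      then show "p \<in> \<Union>?\<V>" by blast
    qed
  qed blast
  have "\<exists>!u. u \<in> carrier (sec F (\<Union>?\<V>)) \<and> (\<forall>V\<in>?\<V>. res F (\<Union>?\<V>) V u = res F U V s)"
  proof (rule glue)
    fix V W assume "V \<in> ?\<V>" "W \<in> ?\<V>"
    then show "res F V (V \<inter> W) (res F U V s) = res F W (V \<inter> W) (res F U W s)"
      using res_comp[of U V "V \<inter> W" s] res_comp[of U W "V \<inter> W" s] U s
        openin_Int[of X V W] by (auto simp del: Int_iff)
  qed (use res_closed[OF U _ _ t] in auto)
  then have ex1: "\<exists>!u. u \<in> carrier (sec F U) \<and> (\<forall>V\<in>?\<V>. res F U V u = res F U V s)"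
    unfolding Un .
  have "s \<in> carrier (sec F U) \<and> (\<forall>V\<in>?\<V>. res F U V s = res F U V s)"
      "t \<in> carrier (sec F U) \<and> (\<forall>V\<in>?\<V>. res F U V t = res F U V s)"
    using s t by auto
  from trans[OF sym[OF the1_equality[OF ex1 this(1)]] the1_equality[OF ex1 this(2)]] show ?thesis .
qed

text \<open>
  A family of germs that is locally induced by sections is induced by one section.  With this lemma sections
  can be prescribed pointwise, and all computations take place in the stalks.
\<close>

lemma glue_germs:
  assumes U: "openin X U"
    and \<sigma>: "\<And>p. p \<in> U \<Longrightarrow> \<exists>V. openin X V \<and> p \<in> V \<and> V \<subseteq> U \<and> (\<exists>t \<in> carrier (sec F V). \<forall>q \<in> V. \<sigma> q = germ X F q V t)"
  obtains s where "s \<in> carrier (sec F U)" "\<And>q. q \<in> U \<Longrightarrow> germ X F q U s = \<sigma> q"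
proof -
  \<comment> \<open>The cover consists of all open sets on which \<open>\<sigma>\<close> is induced by a section, so that sections can be chosen per member of the cover.\<close>
  define \<V> where "\<V> = {V. openin X V \<and> V \<subseteq> U \<and> (\<exists>t \<in> carrier (sec F V). \<forall>q \<in> V. \<sigma> q = germ X F q V t)}"
  have \<V>: "openin X V" "V \<subseteq> U" if "V \<in> \<V>" for V using that by (auto simp: \<V>_def)
  have "\<forall>V\<in>\<V>. \<exists>t. t \<in> carrier (sec F V) \<and> (\<forall>q \<in> V. \<sigma> q = germ X F q V t)"
    unfolding \<V>_def by blast
  from bchoice[OF this] obtain s where s0:
      "\<forall>V\<in>\<V>. s V \<in> carrier (sec F V) \<and> (\<forall>q \<in> V. \<sigma> q = germ X F q V (s V))" ..
  then have s: "\<And>V. V \<in> \<V> \<Longrightarrow> s V \<in> carrier (sec F V)"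
      "\<And>V q. V \<in> \<V> \<Longrightarrow> q \<in> V \<Longrightarrow> \<sigma> q = germ X F q V (s V)"
    by simp_all
  have Un: "\<Union>\<V> = U"
  proof (intro equalityI subsetI)
    fix p assume "p \<in> U"
    from \<sigma>[OF this] obtain V where "V \<in> \<V>" "p \<in> V" unfolding \<V>_def by blast
    then show "p \<in> \<Union>\<V>" by blast
  qed (use \<V> in blast)
  have "\<exists>!u. u \<in> carrier (sec F (\<Union>\<V>)) \<and> (\<forall>V\<in>\<V>. res F (\<Union>\<V>) V u = s V)"
  proof (rule glue)
    fix V W assume V: "V \<in> \<V>" and W: "W \<in> \<V>"
    then have o: "openin X V" "openin X W" "openin X (V \<inter> W)" using \<V> by auto
    show "res F V (V \<inter> W) (s V) = res F W (V \<inter> W) (s W)"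
    proof (rule section_eqI[OF o(3)])
      fix p assume "p \<in> V \<inter> W"
      then show "germ X F p (V \<inter> W) (res F V (V \<inter> W) (s V)) = germ X F p (V \<inter> W) (res F W (V \<inter> W) (s W))"
        using germ_res[of V "V \<inter> W" p "s V"] germ_res[of W "V \<inter> W" p "s W"] o
          s(1)[OF V] s(1)[OF W] s(2)[OF V, of p] s(2)[OF W, of p] by simp
    qed (use res_closed o s V W in auto)
  qed (use s \<V> in auto)
  then obtain u where u: "u \<in> carrier (sec F U)" "\<And>V. V \<in> \<V> \<Longrightarrow> res F U V u = s V"
    unfolding Un by blast
  have "germ X F q U u = \<sigma> q" if "q \<in> U" for q
  proof -
    obtain V where V: "V \<in> \<V>" "q \<in> V" using Un \<open>q \<in> U\<close> by blast
    then have "germ X F q U u = germ X F q V (s V)"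
      using germ_res[of U V q u] U u \<V> by auto
    then show ?thesis using s(2)[OF V] by simp
  qed
  then show thesis using that u(1) by blast
qed

end

section \<open>Softness from bump sections\<close>

lemma sections_over_local:
  assumes "\<sigma> \<in> sections_over X F S" "p \<in> S"
  shows "\<exists>V t. openin X V \<and> p \<in> V \<and> t \<in> carrier (sec F V) \<and> (\<forall>q \<in> V \<inter> S. \<sigma> q = germ X F q V t)"
proof -
  have *: "\<forall>p\<in>S. \<exists>V. openin X V \<and> p \<in> V \<and> (\<exists>t \<in> carrier (sec F V). \<forall>q \<in> V \<inter> S. \<sigma> q = germ X F q V t)"
    using assms(1) unfolding sections_over_def mem_Collect_eq by (rule conjunct2)
  show ?thesis
    using bspec[OF * assms(2)] unfolding Bex_def by iprover
qed

lemma (in cring) partition_step: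
  assumes "g \<in> carrier R" "e \<in> carrier R" "s \<in> carrier R"
  shows "(\<one> \<ominus> g) \<otimes> s \<oplus> g \<otimes> (e \<otimes> s) = (\<one> \<ominus> g \<otimes> (\<one> \<ominus> e)) \<otimes> s"
  using assms by algebra

context cinf_sheaf
begin

text \<open>
  The constants on the right are the germs of one global section, and two sections with the same germ at
  a point agree near this point.
\<close>

lemma openin_germ_eq_const:
  assumes s: "s \<in> carrier (sec F (topspace X))"
  shows "openin X {q \<in> topspace X. germ X F q (topspace X) s = cinf_const (stalk X F q) c}"
    (is "openin X ?E")
proof (subst openin_subopen, intro ballI)
  let ?X = "topspace X"
  let ?c = "cinf_const (sec F ?X) c"
  have c: "?c \<in> carrier (sec F ?X)"
    using cinf_ring.const_closed[OF sec_ring] by simp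
  have germ_c: "germ X F q ?X ?c = cinf_const (stalk X F q) c" if "q \<in> ?X" for q
    using germ_const[of ?X q c] that by simp
  fix p assume p: "p \<in> ?E"
  then have "germ X F p ?X s = germ X F p ?X ?c" using germ_c by simp
  then obtain N where N: "openin X N" "p \<in> N" "N \<subseteq> ?X \<inter> ?X"
      "\<And>q. q \<in> N \<Longrightarrow> germ X F q ?X s = germ X F q ?X ?c"
    using germ_eq_nearby[of ?X p s ?X ?c] s c p by (metis (lifting) mem_Collect_eq openin_topspace)
  then have "N \<subseteq> ?E" using germ_c by auto
  then show "\<exists>T. openin X T \<and> p \<in> T \<and> T \<subseteq> ?E" using N by blast
qed

lemma extend_by_zero:
  assumes W: "openin X W" and N: "openin X N" and cover: "topspace X \<subseteq> W \<union> N"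
    and t: "t \<in> carrier (sec F W)"
    and t0: "\<And>q. q \<in> W \<inter> N \<Longrightarrow> germ X F q W t = \<zero>\<^bsub>ring_of (stalk X F q)\<^esub>"
  obtains w where "w \<in> carrier (sec F (topspace X))"
    "\<And>q. q \<in> W \<Longrightarrow> germ X F q (topspace X) w = germ X F q W t"
    "\<And>q. q \<in> topspace X - W \<Longrightarrow> germ X F q (topspace X) w = \<zero>\<^bsub>ring_of (stalk X F q)\<^esub>"
proof -
  let ?X = "topspace X"
  define \<sigma> where "\<sigma> q = (if q \<in> W then germ X F q W t else \<zero>\<^bsub>ring_of (stalk X F q)\<^esub>)" for q
  have sub: "W \<subseteq> ?X" "N \<subseteq> ?X" using W N openin_subset by blast+
  have "\<exists>V. openin X V \<and> p \<in> V \<and> V \<subseteq> ?X \<and> (\<exists>u \<in> carrier (sec F V). \<forall>q \<in> V. \<sigma> q = germ X F q V u)"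
    if p: "p \<in> ?X" for p
  proof (cases "p \<in> W")
    case True
    have "\<forall>q\<in>W. \<sigma> q = germ X F q W t" by (simp add: \<sigma>_def)
    then show ?thesis using W sub t True by blast
  next
    case False
    then have pN: "p \<in> N" using p cover by blast
    let ?zero = "cinf_const (sec F N) 0"
    have zero: "?zero \<in> carrier (sec F N)"
      using cinf_ring.const_closed[OF sec_ring[OF N]] .
    have "\<forall>q\<in>N. \<sigma> q = germ X F q N ?zero"
      using t0 germ_const[OF N] by (auto simp: \<sigma>_def ring_of_simps)
    then show ?thesis using N sub zero pN by blast
  qed
  then obtain w where "w \<in> carrier (sec F ?X)" "\<And>q. q \<in> ?X \<Longrightarrow> germ X F q ?X w = \<sigma> q"
    using glue_germs[of ?X \<sigma>] by (metis openin_topspace)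
  then show thesis
    using that[of w] sub unfolding \<sigma>_def by (simp add: subset_iff)
qed

text \<open>
  The product \<open>e t\<close> vanishes on the open set where the germ of \<open>e\<close> is \<open>0\<close>, and this set covers
  the complement of \<open>W\<close>.
\<close>

lemma extend_product_by_zero:
  assumes e: "e \<in> carrier (sec F (topspace X))"
    and W: "openin X W" and t: "t \<in> carrier (sec F W)"
    and e0: "\<And>q. q \<in> topspace X - W \<Longrightarrow> germ X F q (topspace X) e = \<zero>\<^bsub>ring_of (stalk X F q)\<^esub>"
  obtains w where "w \<in> carrier (sec F (topspace X))"
    "\<And>q. q \<in> W \<Longrightarrow> germ X F q (topspace X) w
       = germ X F q (topspace X) e \<otimes>\<^bsub>ring_of (stalk X F q)\<^esub> germ X F q W t"
    "\<And>q. q \<in> topspace X - W \<Longrightarrow> germ X F q (topspace X) w = \<zero>\<^bsub>ring_of (stalk X F q)\<^esub>"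
proof -
  let ?X = "topspace X"
  let ?N = "{q \<in> ?X. germ X F q ?X e = cinf_const (stalk X F q) 0}"
  have WX: "W \<subseteq> ?X" using W openin_subset by blast
  interpret R: cring "ring_of (sec F W)" by (rule cinf_ring.cring_ring_of[OF sec_ring[OF W]])
  let ?e = "res F ?X W e"
  have e': "?e \<in> carrier (sec F W)" using res_closed[OF _ W WX e] by simp
  let ?et = "?e \<otimes>\<^bsub>ring_of (sec F W)\<^esub> t"
  have germ_et: "germ X F q W ?et = germ X F q ?X e \<otimes>\<^bsub>ring_of (stalk X F q)\<^esub> germ X F q W t"
    if "q \<in> W" for q
  proof -
    interpret g: ring_hom_ring "ring_of (sec F W)" "ring_of (stalk X F q)" "germ X F q W"
      by (rule germ_ring_hom[OF W that])
    show ?thesis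
      using g.hom_mult[of ?e t] e' t germ_res[of ?X W q e] W WX that e by simp
  qed
  have "germ X F q W ?et = \<zero>\<^bsub>ring_of (stalk X F q)\<^esub>" if q: "q \<in> W \<inter> ?N" for q
  proof -
    interpret S: cring "ring_of (stalk X F q)"
      using cinf_ring.cring_ring_of[OF stalk_cinf_ring] q by blast
    show ?thesis
      using q germ_et[of q] germ_in_stalk[OF W _ t, of q] S.l_null by (simp add: ring_of_simps(5)[symmetric])
  qed
  moreover have "?et \<in> carrier (sec F W)"
    using R.m_closed[of ?e t] e' t by simp
  moreover have "?X \<subseteq> W \<union> ?N" using e0 by (auto simp: ring_of_simps)
  ultimately obtain w where "w \<in> carrier (sec F ?X)"
    "\<And>q. q \<in> W \<Longrightarrow> germ X F q ?X w = germ X F q W ?et"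
    "\<And>q. q \<in> ?X - W \<Longrightarrow> germ X F q ?X w = \<zero>\<^bsub>ring_of (stalk X F q)\<^esub>"
    using extend_by_zero[OF W openin_germ_eq_const[OF e, of 0], of ?et] by blast
  then show thesis using that[of w] germ_et by simp
qed

text \<open>
  Near every point \<open>p\<close> there are a bump section \<open>e\<close>, equal to \<open>1\<close> on a neighbourhood \<open>P\<close> of \<open>p\<close>, and a global section \<open>w\<close>
  with \<open>w = e \<sigma>\<close> on \<open>S\<close>.  Countably many of the sets \<open>P\<close> cover the space.  The products
  \<open>g\<^sub>i = (1 - e\<^sub>0) \<dots> (1 - e\<^bsub>i-1\<^esub>)\<close> and the sums \<open>T\<^sub>i = \<Sum>\<^bsub>j<i\<^esub> g\<^sub>j w\<^sub>j\<close> satisfy \<open>T\<^sub>i = (1 - g\<^sub>i) \<sigma>\<close> on \<open>S\<close>.  On \<open>P\<^sub>j\<close> the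
  products vanish from \<open>g\<^bsub>j+1\<^esub>\<close> on, so the sums become stationary there with value \<open>\<sigma>\<close> on \<open>S\<close>, and
  their limits glue.
\<close>

theorem soft_if_bump_sections:
  assumes "Lindelof_space X"
    and bump: "\<And>p W. \<lbrakk>openin X W; p \<in> W\<rbrakk> \<Longrightarrow>
      \<exists>e P. e \<in> carrier (sec F (topspace X)) \<and> openin X P \<and> p \<in> P \<and>
        (\<forall>q\<in>P. germ X F q (topspace X) e = \<one>\<^bsub>ring_of (stalk X F q)\<^esub>) \<and>
        (\<forall>q\<in>topspace X - W. germ X F q (topspace X) e = \<zero>\<^bsub>ring_of (stalk X F q)\<^esub>)"
  shows "soft_sheaf X F"
  unfolding soft_sheaf_def
proof (intro conjI allI impI)
  show "cinf_sheaf X F" by (rule cinf_sheaf_axioms)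
  fix S \<sigma> assume S: "closedin X S" and \<sigma>: "\<sigma> \<in> sections_over X F S"
  let ?X = "topspace X"
  let ?\<Gamma> = "ring_of (sec F ?X)"
  let ?germ = "\<lambda>q s. germ X F q ?X s"
  interpret \<Gamma>: cring ?\<Gamma> by (rule cinf_ring.cring_ring_of[OF sec_ring[OF openin_topspace]])
  have SX: "S \<subseteq> ?X" using S closedin_subset by blast
  have \<sigma>_carrier: "\<sigma> q \<in> carrier (stalk X F q)" if "q \<in> S" for q
  proof -
    obtain V t where "openin X V" "q \<in> V" "t \<in> carrier (sec F V)" "\<sigma> q = germ X F q V t"
      using sections_over_local[OF \<sigma> \<open>q \<in> S\<close>] \<open>q \<in> S\<close> by (metis IntI)
    then show ?thesis using germ_in_stalk[of V q t] by simp
  qed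
  define good where "good P e w \<longleftrightarrow> openin X P \<and> e \<in> carrier (sec F ?X) \<and> w \<in> carrier (sec F ?X) \<and>
      (\<forall>q\<in>P. ?germ q e = \<one>\<^bsub>ring_of (stalk X F q)\<^esub>) \<and>
      (\<forall>q\<in>S. ?germ q w = ?germ q e \<otimes>\<^bsub>ring_of (stalk X F q)\<^esub> \<sigma> q)" for P e w
  have local: "\<exists>P e w. p \<in> P \<and> good P e w" if p: "p \<in> ?X" for p
  proof -
    \<comment> \<open>Off \<open>S\<close> a neighbourhood disjoint from \<open>S\<close> is taken, where the condition on \<open>t\<close> is void; then \<open>w\<close> has germ \<open>0\<close> on \<open>S\<close>.\<close>
    obtain V t where V: "openin X V" "p \<in> V" "t \<in> carrier (sec F V)" "\<And>q. q \<in> V \<inter> S \<Longrightarrow> \<sigma> q = germ X F q V t"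
    proof (cases "p \<in> S")
      case True
      show thesis using sections_over_local[OF \<sigma> True] that by (elim exE conjE) simp
    next
      case False
      have "openin X (?X - S)" using S by blast
      moreover have "cinf_const (sec F (?X - S)) 0 \<in> carrier (sec F (?X - S))"
        using cinf_ring.const_closed[OF sec_ring] calculation by blast
      ultimately show thesis using that[of "?X - S"] p False by blast
    qed
    obtain e P where e: "e \<in> carrier (sec F ?X)" and P: "openin X P" "p \<in> P"
      and e1: "\<forall>q\<in>P. ?germ q e = \<one>\<^bsub>ring_of (stalk X F q)\<^esub>"
      and e0: "\<forall>q\<in>?X - V. ?germ q e = \<zero>\<^bsub>ring_of (stalk X F q)\<^esub>"
      using bump[OF V(1,2)] by blast
    obtain w where w: "w \<in> carrier (sec F ?X)"
      "\<And>q. q \<in> V \<Longrightarrow> ?germ q w = ?germ q e \<otimes>\<^bsub>ring_of (stalk X F q)\<^esub> germ X F q V t"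
      "\<And>q. q \<in> ?X - V \<Longrightarrow> ?germ q w = \<zero>\<^bsub>ring_of (stalk X F q)\<^esub>"
      using extend_product_by_zero[OF e V(1,3)] e0 by blast
    have "?germ q w = ?germ q e \<otimes>\<^bsub>ring_of (stalk X F q)\<^esub> \<sigma> q" if q: "q \<in> S" for q
    proof (cases "q \<in> V")
      case True
      then show ?thesis using w(2) V(4) q by simp
    next
      case False
      then have qV: "q \<in> ?X - V" using q SX by blast
      interpret S: cring "ring_of (stalk X F q)"
        using cinf_ring.cring_ring_of[OF stalk_cinf_ring] qV by blast
      show ?thesis
        using w(3)[OF qV] e0 qV \<sigma>_carrier[OF q] by (simp add: S.l_null)
    qed
    then show ?thesis using P e w(1) e1 unfolding good_def by blast
  qed
  show "\<exists>t \<in> carrier (sec F ?X). \<forall>p\<in>S. ?germ p t = \<sigma> p"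
  proof (cases "?X = {}")
    case True
    then have "S = {}" using SX by blast
    moreover have "cinf_const (sec F ?X) 0 \<in> carrier (sec F ?X)"
      using cinf_ring.const_closed[OF sec_ring] by simp
    ultimately show ?thesis by blast
  next
    case False
    let ?\<U> = "{P. openin X P \<and> (\<exists>e w. good P e w)}"
    have U1: "openin X P" if "P \<in> ?\<U>" for P using that by blast
    have U2: "\<Union>?\<U> = ?X"
    proof (intro equalityI subsetI)
      fix p assume "p \<in> ?X"
      from local[OF this] obtain P e w where P: "p \<in> P" "good P e w" by blast
      then have "openin X P" by (simp add: good_def)
      then show "p \<in> \<Union>?\<U>" using P by blast
    qed (use openin_subset in blast)
    obtain \<V> where \<V>: "countable \<V>" "\<V> \<subseteq> ?\<U>" "\<Union>\<V> = ?X"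
      using Lindelof_spaceD[OF assms(1) U1 U2] by metis
    then have ne: "\<V> \<noteq> {}" using False by (metis Union_empty)
    define P where "P = from_nat_into \<V>"
    have "\<exists>e w. good (P i) e w" for i
      using from_nat_into[OF ne, of i] \<V>(2) unfolding P_def by blast
    then obtain e w where good: "\<And>i. good (P i) (e i) (w i)" by metis
    have cover: "\<exists>j. q \<in> P j" if "q \<in> ?X" for q
      using that \<V>(3) range_from_nat_into[OF ne \<V>(1)] unfolding P_def by blast
    have ew: "e i \<in> carrier ?\<Gamma>" "w i \<in> carrier ?\<Gamma>" for i
      using good unfolding good_def by simp_all
    define g where "g = rec_nat \<one>\<^bsub>?\<Gamma>\<^esub> (\<lambda>i gi. gi \<otimes>\<^bsub>?\<Gamma>\<^esub> (\<one>\<^bsub>?\<Gamma>\<^esub> \<ominus>\<^bsub>?\<Gamma>\<^esub> e i))"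
    define T where "T = rec_nat \<zero>\<^bsub>?\<Gamma>\<^esub> (\<lambda>i Ti. Ti \<oplus>\<^bsub>?\<Gamma>\<^esub> g i \<otimes>\<^bsub>?\<Gamma>\<^esub> w i)"
    have g_Suc: "g (Suc i) = g i \<otimes>\<^bsub>?\<Gamma>\<^esub> (\<one>\<^bsub>?\<Gamma>\<^esub> \<ominus>\<^bsub>?\<Gamma>\<^esub> e i)" and g_0: "g 0 = \<one>\<^bsub>?\<Gamma>\<^esub>" for i
      by (simp_all add: g_def)
    have T_Suc: "T (Suc i) = T i \<oplus>\<^bsub>?\<Gamma>\<^esub> g i \<otimes>\<^bsub>?\<Gamma>\<^esub> w i" and T_0: "T 0 = \<zero>\<^bsub>?\<Gamma>\<^esub>" for i
      by (simp_all add: T_def)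
    have g_cl: "g i \<in> carrier ?\<Gamma>" for i
    proof (induction i)
      case (Suc i)
      then show ?case unfolding g_Suc by (intro \<Gamma>.m_closed \<Gamma>.minus_closed \<Gamma>.one_closed ew)
    qed (simp only: g_0 \<Gamma>.one_closed)
    have T_cl: "T i \<in> carrier ?\<Gamma>" for i
    proof (induction i)
      case (Suc i)
      then show ?case unfolding T_Suc by (intro \<Gamma>.m_closed \<Gamma>.a_closed g_cl ew)
    qed (simp only: T_0 \<Gamma>.zero_closed)
    have sums: "?germ q (T i) = (\<one>\<^bsub>ring_of (stalk X F q)\<^esub> \<ominus>\<^bsub>ring_of (stalk X F q)\<^esub> ?germ q (g i))
        \<otimes>\<^bsub>ring_of (stalk X F q)\<^esub> \<sigma> q" if q: "q \<in> S" for q i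
    proof -
      have qX: "q \<in> ?X" using q SX by blast
      let ?S = "ring_of (stalk X F q)"
      interpret S: cring ?S
        by (rule cinf_ring.cring_ring_of[OF stalk_cinf_ring[OF qX]])
      interpret h: ring_hom_ring ?\<Gamma> ?S "germ X F q ?X"
        by (rule germ_ring_hom[OF openin_topspace qX])
      have \<sigma>q: "\<sigma> q \<in> carrier ?S" using \<sigma>_carrier[OF q] by simp
      show ?thesis
      proof (induction i)
        case 0
        have "\<one>\<^bsub>?S\<^esub> \<ominus>\<^bsub>?S\<^esub> \<one>\<^bsub>?S\<^esub> = \<zero>\<^bsub>?S\<^esub>"
          by (simp only: S.minus_eq S.r_neg S.one_closed)
        then show ?case
          by (simp only: g_0 T_0 h.hom_one h.hom_zero S.l_null[OF \<sigma>q])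
      next
        case (Suc i)
        have hw: "?germ q (w i) = ?germ q (e i) \<otimes>\<^bsub>?S\<^esub> \<sigma> q"
          using good[of i] q unfolding good_def by blast
        have "?germ q (T (Suc i)) = ?germ q (T i) \<oplus>\<^bsub>?S\<^esub> ?germ q (g i) \<otimes>\<^bsub>?S\<^esub> ?germ q (w i)"
          unfolding T_Suc using T_cl g_cl ew by (simp only: h.hom_add h.hom_mult \<Gamma>.m_closed)
        also have "\<dots> = (\<one>\<^bsub>?S\<^esub> \<ominus>\<^bsub>?S\<^esub> ?germ q (g i) \<otimes>\<^bsub>?S\<^esub> (\<one>\<^bsub>?S\<^esub> \<ominus>\<^bsub>?S\<^esub> ?germ q (e i))) \<otimes>\<^bsub>?S\<^esub> \<sigma> q"
          unfolding Suc hw by (intro S.partition_step h.hom_closed g_cl ew \<sigma>q)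
        also have "?germ q (g i) \<otimes>\<^bsub>?S\<^esub> (\<one>\<^bsub>?S\<^esub> \<ominus>\<^bsub>?S\<^esub> ?germ q (e i)) = ?germ q (g (Suc i))"
          unfolding g_Suc using g_cl ew
          by (simp only: h.hom_mult \<Gamma>.minus_closed \<Gamma>.one_closed \<Gamma>.minus_eq S.minus_eq h.hom_add
              \<Gamma>.a_inv_closed h.hom_a_inv h.hom_one \<Gamma>.a_closed)
        finally show ?case .
      qed
    qed
    have stationary: "?germ q (g i) = \<zero>\<^bsub>ring_of (stalk X F q)\<^esub> \<and> ?germ q (T i) = ?germ q (T (Suc j))"
      if q: "q \<in> P j" and i: "i \<ge> Suc j" for q i j
    proof -
      have qX: "q \<in> ?X" using q good[of j] openin_subset unfolding good_def by blast
      let ?S = "ring_of (stalk X F q)"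
      interpret S: cring ?S
        by (rule cinf_ring.cring_ring_of[OF stalk_cinf_ring[OF qX]])
      interpret h: ring_hom_ring ?\<Gamma> ?S "germ X F q ?X"
        by (rule germ_ring_hom[OF openin_topspace qX])
      have germ_g_Suc: "?germ q (g (Suc i)) = ?germ q (g i) \<otimes>\<^bsub>?S\<^esub> (\<one>\<^bsub>?S\<^esub> \<ominus>\<^bsub>?S\<^esub> ?germ q (e i))" for i
          unfolding g_Suc using g_cl ew
          by (simp only: h.hom_mult \<Gamma>.minus_closed \<Gamma>.one_closed \<Gamma>.minus_eq S.minus_eq h.hom_add
              \<Gamma>.a_inv_closed h.hom_a_inv h.hom_one \<Gamma>.a_closed)
      show ?thesis
        using i
      proof (induction i rule: dec_induct)
        case base
        have "?germ q (e j) = \<one>\<^bsub>?S\<^esub>"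
          using good[of j] q unfolding good_def by blast
        moreover have "\<one>\<^bsub>?S\<^esub> \<ominus>\<^bsub>?S\<^esub> \<one>\<^bsub>?S\<^esub> = \<zero>\<^bsub>?S\<^esub>"
          by (simp only: S.minus_eq S.r_neg S.one_closed)
        ultimately show ?case
          by (simp only: germ_g_Suc S.r_null[OF h.hom_closed[OF g_cl]])
      next
        case (step i)
        have "?germ q (T (Suc i)) = ?germ q (T i) \<oplus>\<^bsub>?S\<^esub> ?germ q (g i) \<otimes>\<^bsub>?S\<^esub> ?germ q (w i)"
          unfolding T_Suc using T_cl g_cl ew by (simp only: h.hom_add h.hom_mult \<Gamma>.m_closed)
        also have "\<dots> = ?germ q (T i)"
          using step.IH h.hom_closed[OF ew(2)] h.hom_closed[OF T_cl]
          by (simp only: S.l_null S.r_zero)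
        finally show ?case
          using step.IH germ_g_Suc[of i]
          by (simp only: S.l_null[OF S.minus_closed[OF S.one_closed h.hom_closed[OF ew(1)]]])
      qed
    qed
    \<comment> \<open>Any other index \<open>j\<close> with \<open>q \<in> P j\<close> gives the same germ, since the sequence is stationary from the least one on.\<close>
    define \<tau> where "\<tau> q = ?germ q (T (Suc (LEAST j. q \<in> P j)))" for q
    have \<tau>: "\<tau> q = ?germ q (T (Suc j))" if "q \<in> P j" for q j
      using stationary[of q "LEAST j. q \<in> P j" "Suc j"] LeastI[of "\<lambda>j. q \<in> P j" j]
        Least_le[of "\<lambda>j. q \<in> P j" j] that unfolding \<tau>_def by simp
    have "\<exists>V. openin X V \<and> p \<in> V \<and> V \<subseteq> ?X \<and> (\<exists>u \<in> carrier (sec F V). \<forall>q \<in> V. \<tau> q = germ X F q V u)"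
      if p: "p \<in> ?X" for p
    proof -
      obtain j where j: "p \<in> P j" using cover[OF p] by blast
      have Pj: "openin X (P j)" "P j \<subseteq> ?X" using good[of j] openin_subset unfolding good_def by blast+
      have Tj: "T (Suc j) \<in> carrier (sec F ?X)" using T_cl[of "Suc j"] by simp
      have "res F ?X (P j) (T (Suc j)) \<in> carrier (sec F (P j))"
        using res_closed[OF openin_topspace Pj Tj] .
      moreover have "\<forall>q\<in>P j. \<tau> q = germ X F q (P j) (res F ?X (P j) (T (Suc j)))"
        using germ_res[OF openin_topspace Pj _ Tj] \<tau> by simp
      ultimately show ?thesis using Pj j by blast
    qed
    then obtain t where t: "t \<in> carrier (sec F ?X)" "\<And>q. q \<in> ?X \<Longrightarrow> ?germ q t = \<tau> q"
      using glue_germs[of ?X \<tau>] by (metis openin_topspace)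
    have "?germ q t = \<sigma> q" if q: "q \<in> S" for q
    proof -
      have qX: "q \<in> ?X" using q SX by blast
      let ?S = "ring_of (stalk X F q)"
      interpret S: cring ?S
        by (rule cinf_ring.cring_ring_of[OF stalk_cinf_ring[OF qX]])
      obtain j where j: "q \<in> P j" using cover[OF qX] by blast
      have \<sigma>q: "\<sigma> q \<in> carrier ?S" using \<sigma>_carrier[OF q] by simp
      have "?germ q t = ?germ q (T (Suc j))" using t(2)[OF qX] \<tau>[OF j] by simp
      also have "\<dots> = (\<one>\<^bsub>?S\<^esub> \<ominus>\<^bsub>?S\<^esub> \<zero>\<^bsub>?S\<^esub>) \<otimes>\<^bsub>?S\<^esub> \<sigma> q"
        using sums[OF q, of "Suc j"] stationary[OF j, of "Suc j"] by simp
      also have "\<dots> = \<sigma> q"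
        using \<sigma>q by (simp only: S.minus_eq S.minus_zero S.r_zero S.one_closed S.l_one)
      finally show ?thesis .
    qed
    then show ?thesis using t(1) by blast
  qed
qed

end

section \<open>Connected components of simplicial \<open>C\<^sup>\<infinity>\<close>-rings\<close>

definition pi0_class :: "'a simplicial_cinf_ring \<Rightarrow> 'a \<Rightarrow> 'a set" where
  "pi0_class A a = pi0_rel A `` {a}"

context simplicial_cinf_ring
begin

definition edges :: "('a \<times> 'a) set" where
  "edges = {(face A 0 0 x, face A 0 1 x) | x. x \<in> carrier (level A 1)}"

lemma pi0_rel_edges:
  "pi0_rel A = (edges \<union> edges\<inverse>)\<^sup>* \<inter> carrier (level A 0) \<times> carrier (level A 0)"
  unfolding pi0_rel_def edges_def Let_def ..

lemma face_closed: "i \<le> 1 \<Longrightarrow> x \<in> carrier (level A 1) \<Longrightarrow> face A 0 i x \<in> carrier (level A 0)"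
  using face_hom[of i 0] cinf_hom_closed by fastforce

lemma equiv_pi0_rel: "equiv (carrier (level A 0)) (pi0_rel A)"
proof (rule equivI)
  show "refl_on (carrier (level A 0)) (pi0_rel A)"
    by (auto simp: pi0_rel_edges refl_on_def)
  have "sym ((edges \<union> edges\<inverse>)\<^sup>*)"
    by (rule sym_rtrancl) (auto simp: sym_def)
  then show "sym (pi0_rel A)"
    unfolding pi0_rel_edges sym_def by blast
  show "trans (pi0_rel A)"
    unfolding pi0_rel_edges by (rule transI) (auto intro: rtrancl_trans)
qed (auto simp: pi0_rel_edges)

text \<open>
  Degenerate \<open>1\<close>-simplices at the other coordinates keep these coordinates fixed while \<open>x\<close> moves to \<open>y\<close> along
  an edge; the operation in degree \<open>1\<close> then yields an edge between the two values.
\<close>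

lemma edges_op:
  assumes f: "smooth n f" and a: "\<And>j. j < n \<Longrightarrow> a j \<in> carrier (level A 0)"
    and xy: "(x, y) \<in> edges"
  shows "(cinf_op (level A 0) n f (a(i := x)), cinf_op (level A 0) n f (a(i := y))) \<in> edges"
proof -
  obtain z where z: "z \<in> carrier (level A 1)" "x = face A 0 0 z" "y = face A 0 1 z"
    using xy by (auto simp: edges_def)
  define b where "b = (\<lambda>j. if j = i then z else degen A 0 0 (a j))"
  have b: "b j \<in> carrier (level A 1)" if "j < n" for j
    using z a[OF that] cinf_hom_closed[OF degen_hom[of 0 0]] by (auto simp: b_def)
  have w: "cinf_op (level A 1) n f b \<in> carrier (level A 1)"
    using cinf_ring.op_closed[OF level_ring f, of b 1] b by simp
  have fc: "face A 0 k (cinf_op (level A 1) n f b) = cinf_op (level A 0) n f (\<lambda>j. face A 0 k (b j))" if "k \<le> 1" for k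
    using cinf_hom_op[OF face_hom[of k 0] f, of b] b that by simp
  have "cinf_op (level A 0) n f (\<lambda>j. face A 0 0 (b j)) = cinf_op (level A 0) n f (a(i := x))"
    by (rule cinf_ring.op_cong[OF level_ring f])
       (use b face_closed z a face_degen_same[of 0 0] in \<open>auto simp: b_def\<close>)
  moreover have "cinf_op (level A 0) n f (\<lambda>j. face A 0 1 (b j)) = cinf_op (level A 0) n f (a(i := y))"
    by (rule cinf_ring.op_cong[OF level_ring f])
       (use b face_closed z a face_degen_Suc[of 0 0] in \<open>auto simp: b_def\<close>)
  ultimately show ?thesis
    using w fc[of 0] fc[of 1] unfolding edges_def by force
qed

lemma pi0_rel_op_coordinate:
  assumes f: "smooth n f" and a: "\<And>j. j < n \<Longrightarrow> a j \<in> carrier (level A 0)"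
    and xy: "(x, y) \<in> pi0_rel A"
  shows "(cinf_op (level A 0) n f (a(i := x)), cinf_op (level A 0) n f (a(i := y))) \<in> pi0_rel A"
proof -
  have "(x, y) \<in> (edges \<union> edges\<inverse>)\<^sup>*" using xy by (simp add: pi0_rel_edges)
  then have "(cinf_op (level A 0) n f (a(i := x)), cinf_op (level A 0) n f (a(i := y))) \<in> (edges \<union> edges\<inverse>)\<^sup>*"
  proof (induction rule: rtrancl_induct)
    case base
    then show ?case by simp
  next
    case (step y z)
    from step.hyps(2) have "(cinf_op (level A 0) n f (a(i := y)), cinf_op (level A 0) n f (a(i := z))) \<in> edges \<union> edges\<inverse>"
      using edges_op[of n f a _ _ i, OF f a] by blast
    with step.IH show ?case by (rule rtrancl_into_rtrancl)
  qed
  moreover have "cinf_op (level A 0) n f (a(i := x)) \<in> carrier (level A 0)"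
    "cinf_op (level A 0) n f (a(i := y)) \<in> carrier (level A 0)"
    using xy a by (auto simp: pi0_rel_edges intro!: cinf_ring.op_closed[OF level_ring f])
  ultimately show ?thesis by (simp add: pi0_rel_edges)
qed

text \<open>
  The relation is generated by edges in a single coordinate only, so the arguments are exchanged one
  coordinate at a time.
\<close>

lemma pi0_rel_op:
  assumes f: "smooth n f" and ab: "\<And>i. i < n \<Longrightarrow> (a i, b i) \<in> pi0_rel A"
  shows "(cinf_op (level A 0) n f a, cinf_op (level A 0) n f b) \<in> pi0_rel A"
proof -
  have ab': "a i \<in> carrier (level A 0)" "b i \<in> carrier (level A 0)" if "i < n" for i
    using ab[OF that] by (auto simp: pi0_rel_edges)
  have trans: "trans (pi0_rel A)" using equiv_pi0_rel by (simp add: equiv_def)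
  have "(cinf_op (level A 0) n f a, cinf_op (level A 0) n f (\<lambda>i. if i < m then b i else a i)) \<in> pi0_rel A"
    if "m \<le> n" for m
    using that
  proof (induction m)
    case 0
    have "cinf_op (level A 0) n f a \<in> carrier (level A 0)"
      using ab' by (intro cinf_ring.op_closed[OF level_ring f])
    then show ?case by (simp add: pi0_rel_edges)
  next
    case (Suc m)
    let ?c = "\<lambda>i. if i < m then b i else a i"
    have "(cinf_op (level A 0) n f (?c(m := a m)), cinf_op (level A 0) n f (?c(m := b m))) \<in> pi0_rel A"
      using Suc.prems ab ab' by (intro pi0_rel_op_coordinate[OF f]) auto
    moreover have "?c(m := a m) = ?c" "?c(m := b m) = (\<lambda>i. if i < Suc m then b i else a i)"
      by (auto simp: less_Suc_eq)
    ultimately show ?case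
      using Suc transD[OF trans] by simp
  qed
  from this[of n] have "(cinf_op (level A 0) n f a, cinf_op (level A 0) n f (\<lambda>i. if i < n then b i else a i)) \<in> pi0_rel A"
    by simp
  also have "cinf_op (level A 0) n f (\<lambda>i. if i < n then b i else a i) = cinf_op (level A 0) n f b"
    using ab' by (intro cinf_ring.op_cong[OF level_ring f]) auto
  finally show ?thesis .
qed

lemma pi0_class_eq_iff:
  "a \<in> carrier (level A 0) \<Longrightarrow> b \<in> carrier (level A 0) \<Longrightarrow>
    pi0_class A a = pi0_class A b \<longleftrightarrow> (a, b) \<in> pi0_rel A"
  unfolding pi0_class_def using eq_equiv_class_iff[OF equiv_pi0_rel] by blast

lemma carrier_pi0: "carrier (pi0 A) = pi0_class A ` carrier (level A 0)"
  by (auto simp: pi0_def quotient_def pi0_class_def)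

text \<open>
  As for stalks, operations on classes are computed on representatives for smooth functions and for
  composites of these, the latter being needed in the composition law.
\<close>

definition respects_pi0 :: "nat \<Rightarrow> ((nat \<Rightarrow> real) \<Rightarrow> real) \<Rightarrow> bool" where
  "respects_pi0 n f \<longleftrightarrow> (\<forall>a b. (\<forall>i<n. (a i, b i) \<in> pi0_rel A) \<longrightarrow>
     (cinf_op (level A 0) n f a, cinf_op (level A 0) n f b) \<in> pi0_rel A)"

lemma pi0_op:
  assumes f: "respects_pi0 n f" and a: "\<And>i. i < n \<Longrightarrow> a i \<in> carrier (level A 0)"
    and C: "\<And>i. i < n \<Longrightarrow> C i = pi0_class A (a i)"
  shows "cinf_op (pi0 A) n f C = pi0_class A (cinf_op (level A 0) n f a)"
proof -
  have "(THE D. \<exists>a. (\<forall>i<n. a i \<in> carrier (level A 0) \<and> C i = pi0_class A (a i)) \<and>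
         D = pi0_class A (cinf_op (level A 0) n f a)) = pi0_class A (cinf_op (level A 0) n f a)"
  proof (rule the_equality)
    show "\<exists>a'. (\<forall>i<n. a' i \<in> carrier (level A 0) \<and> C i = pi0_class A (a' i)) \<and>
         pi0_class A (cinf_op (level A 0) n f a) = pi0_class A (cinf_op (level A 0) n f a')"
      using a C by (intro exI[of _ a]) auto
    fix D
    assume "\<exists>b. (\<forall>i<n. b i \<in> carrier (level A 0) \<and> C i = pi0_class A (b i)) \<and>
         D = pi0_class A (cinf_op (level A 0) n f b)"
    then obtain b where b: "\<forall>i<n. b i \<in> carrier (level A 0) \<and> C i = pi0_class A (b i)"
      and D: "D = pi0_class A (cinf_op (level A 0) n f b)" by blast
    have "(b i, a i) \<in> pi0_rel A" if "i < n" for i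
      using pi0_class_eq_iff[of "b i" "a i"] b C[OF that] a[OF that] that by metis
    then have *: "(cinf_op (level A 0) n f b, cinf_op (level A 0) n f a) \<in> pi0_rel A"
      using f unfolding respects_pi0_def by blast
    then show "D = pi0_class A (cinf_op (level A 0) n f a)"
      unfolding D using pi0_class_eq_iff by (simp add: pi0_rel_edges)
  qed
  then show ?thesis by (simp add: pi0_def pi0_class_def)
qed

lemma smooth_respects_pi0: "smooth n f \<Longrightarrow> respects_pi0 n f"
  unfolding respects_pi0_def using pi0_rel_op by blast

lemma composite_respects_pi0:
  assumes g: "smooth m g" and \<phi>: "\<And>j. j < m \<Longrightarrow> smooth n (\<phi> j)"
  shows "respects_pi0 n (\<lambda>x. g (\<lambda>j. \<phi> j x))"
  unfolding respects_pi0_def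
proof (intro allI impI)
  fix a b assume ab: "\<forall>i<n. (a i, b i) \<in> pi0_rel A"
  have "(cinf_op (level A 0) m g (\<lambda>j. cinf_op (level A 0) n (\<phi> j) a),
         cinf_op (level A 0) m g (\<lambda>j. cinf_op (level A 0) n (\<phi> j) b)) \<in> pi0_rel A"
    using \<phi> ab by (intro pi0_rel_op[OF g] pi0_rel_op) auto
  then show "(cinf_op (level A 0) n (\<lambda>x. g (\<lambda>j. \<phi> j x)) a,
         cinf_op (level A 0) n (\<lambda>x. g (\<lambda>j. \<phi> j x)) b) \<in> pi0_rel A"
    using cinf_ring.op_comp[OF level_ring, of m g n \<phi> a 0] cinf_ring.op_comp[OF level_ring, of m g n \<phi> b 0]
      g \<phi> ab by (simp add: pi0_rel_edges)
qed

lemma pi0_representatives: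
  fixes n :: nat
  assumes "\<And>i. i < n \<Longrightarrow> C i \<in> carrier (pi0 A)"
  shows "\<exists>a. \<forall>i<n. a i \<in> carrier (level A 0) \<and> C i = pi0_class A (a i)"
proof -
  have "\<forall>i. \<exists>a. i < n \<longrightarrow> a \<in> carrier (level A 0) \<and> C i = pi0_class A a"
    using assms by (auto simp: carrier_pi0)
  from choice[OF this] show ?thesis by blast
qed

lemma pi0_cinf_ring: "cinf_ring (pi0 A)"
proof
  fix n :: nat and f C assume f: "smooth n f" and C: "\<And>i. i < n \<Longrightarrow> C i \<in> carrier (pi0 A)"
  obtain a where "\<forall>i<n. a i \<in> carrier (level A 0) \<and> C i = pi0_class A (a i)"
    using pi0_representatives[of n C, OF C] by blast
  then have a: "\<And>i. i < n \<Longrightarrow> a i \<in> carrier (level A 0)" "\<And>i. i < n \<Longrightarrow> C i = pi0_class A (a i)"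
    by simp_all
  have C_eq: "cinf_op (pi0 A) n f C = pi0_class A (cinf_op (level A 0) n f a)"
    by (rule pi0_op[OF smooth_respects_pi0[OF f] a])
  show "cinf_op (pi0 A) n f C \<in> carrier (pi0 A)"
    unfolding C_eq carrier_pi0 by (intro imageI cinf_ring.op_closed[OF level_ring f] a(1))
  fix D assume D: "\<And>i. i < n \<Longrightarrow> C i = D i"
  show "cinf_op (pi0 A) n f C = cinf_op (pi0 A) n f D"
    unfolding C_eq by (rule pi0_op[OF smooth_respects_pi0[OF f] a(1), symmetric]) (simp_all add: D[symmetric] a(2))
next
  fix i n :: nat and C assume i: "i < n" and C: "\<And>i. i < n \<Longrightarrow> C i \<in> carrier (pi0 A)"
  obtain a where "\<forall>i<n. a i \<in> carrier (level A 0) \<and> C i = pi0_class A (a i)"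
    using pi0_representatives[of n C, OF C] by blast
  then have a: "\<And>i. i < n \<Longrightarrow> a i \<in> carrier (level A 0)" "\<And>i. i < n \<Longrightarrow> C i = pi0_class A (a i)"
    by simp_all
  have "cinf_op (pi0 A) n (\<lambda>x. x i) C = pi0_class A (cinf_op (level A 0) n (\<lambda>x. x i) a)"
    by (rule pi0_op[OF smooth_respects_pi0[OF smooth_proj[OF i]] a])
  then show "cinf_op (pi0 A) n (\<lambda>x. x i) C = C i"
    using cinf_ring.op_proj[OF level_ring i, of a 0] a i by simp
next
  fix m n :: nat and g \<phi> C
  assume g: "smooth m g" and \<phi>: "\<And>j. j < m \<Longrightarrow> smooth n (\<phi> j)"
    and C: "\<And>i. i < n \<Longrightarrow> C i \<in> carrier (pi0 A)"
  obtain a where "\<forall>i<n. a i \<in> carrier (level A 0) \<and> C i = pi0_class A (a i)"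
    using pi0_representatives[of n C, OF C] by blast
  then have a: "\<And>i. i < n \<Longrightarrow> a i \<in> carrier (level A 0)" "\<And>i. i < n \<Longrightarrow> C i = pi0_class A (a i)"
    by simp_all
  have "cinf_op (pi0 A) m g (\<lambda>j. cinf_op (pi0 A) n (\<phi> j) C)
      = pi0_class A (cinf_op (level A 0) m g (\<lambda>j. cinf_op (level A 0) n (\<phi> j) a))"
  proof (rule pi0_op[OF smooth_respects_pi0[OF g]])
    fix j assume "j < m"
    note sm = \<phi>[OF this]
    show "cinf_op (level A 0) n (\<phi> j) a \<in> carrier (level A 0)"
      by (intro cinf_ring.op_closed[OF level_ring sm] a(1))
    show "cinf_op (pi0 A) n (\<phi> j) C = pi0_class A (cinf_op (level A 0) n (\<phi> j) a)"
      by (rule pi0_op[OF smooth_respects_pi0[OF sm] a])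
  qed
  also have "\<dots> = pi0_class A (cinf_op (level A 0) n (\<lambda>x. g (\<lambda>j. \<phi> j x)) a)"
    using cinf_ring.op_comp[OF level_ring, of m g n \<phi> a 0] g \<phi> a(1) by simp
  also have "\<dots> = cinf_op (pi0 A) n (\<lambda>x. g (\<lambda>j. \<phi> j x)) C"
    by (rule pi0_op[OF composite_respects_pi0[of m g n \<phi>, OF g \<phi>] a, symmetric])
  finally show "cinf_op (pi0 A) m g (\<lambda>j. cinf_op (pi0 A) n (\<phi> j) C)
      = cinf_op (pi0 A) n (\<lambda>x. g (\<lambda>j. \<phi> j x)) C" .
qed

lemma pi0_class_hom: "pi0_class A \<in> cinf_hom (level A 0) (pi0 A)"
proof -
  have "pi0_class A (cinf_op (level A 0) n f a) = cinf_op (pi0 A) n f (\<lambda>i. pi0_class A (a i))"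
    if "smooth n f" "\<forall>i<n. a i \<in> carrier (level A 0)" for n f a
    using pi0_op[OF smooth_respects_pi0[OF that(1)], of a "\<lambda>i. pi0_class A (a i)"] that(2) by simp
  then show ?thesis
    unfolding cinf_hom_def by (auto simp: carrier_pi0)
qed

end

context simplicial_cinf_sheaf
begin

lemma sec_sheaf_level [simp]: "sec (sheaf_level F k) U = level (ssec F U) k"
  and res_sheaf_level [simp]: "res (sheaf_level F k) = sres F k"
  by (simp_all add: sheaf_level_def)

lemma sec_pi0_presheaf [simp]: "sec (pi0_presheaf F) U = pi0 (ssec F U)"
  by (simp add: pi0_presheaf_def)

lemma level_presheaf: "cinf_presheaf X (sheaf_level F k)"
  using level_sheaf by (simp add: cinf_sheaf_def)

lemma sres_hom:
  "\<lbrakk>openin X U; openin X V; V \<subseteq> U\<rbrakk> \<Longrightarrow> sres F k U V \<in> cinf_hom (level (ssec F U) k) (level (ssec F V) k)"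
  using cinf_presheaf.res_hom[OF level_presheaf[of k]] by simp

text \<open>
  Restriction commutes with the faces, so it maps edges to edges.
\<close>

lemma sres_pi0_rel:
  assumes UV: "openin X U" "openin X V" "V \<subseteq> U" and ab: "(a, b) \<in> pi0_rel (ssec F U)"
  shows "(sres F 0 U V a, sres F 0 U V b) \<in> pi0_rel (ssec F V)"
proof -
  interpret U: simplicial_cinf_ring "ssec F U" using ssec_simplicial UV by blast
  interpret V: simplicial_cinf_ring "ssec F V" using ssec_simplicial UV by blast
  have edge: "(sres F 0 U V x, sres F 0 U V y) \<in> V.edges" if xy: "(x, y) \<in> U.edges" for x y
  proof -
    obtain z where z: "z \<in> carrier (level (ssec F U) 1)" "x = face (ssec F U) 0 0 z" "y = face (ssec F U) 0 1 z"
      using xy by (auto simp: U.edges_def)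
    have "sres F 1 U V z \<in> carrier (level (ssec F V) 1)"
      using cinf_hom_closed[OF sres_hom[OF UV]] z(1) .
    moreover have "sres F 0 U V x = face (ssec F V) 0 0 (sres F 1 U V z)"
      "sres F 0 U V y = face (ssec F V) 0 1 (sres F 1 U V z)"
      using sres_face[OF UV, of _ 0 z] z by simp_all
    ultimately show ?thesis unfolding V.edges_def by blast
  qed
  have "(a, b) \<in> (U.edges \<union> U.edges\<inverse>)\<^sup>*" using ab by (simp add: U.pi0_rel_edges)
  then have "(sres F 0 U V a, sres F 0 U V b) \<in> (V.edges \<union> V.edges\<inverse>)\<^sup>*"
  proof (induction rule: rtrancl_induct)
    case (step y z)
    then have "(sres F 0 U V y, sres F 0 U V z) \<in> V.edges \<union> V.edges\<inverse>"
      using edge by blast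
    with step.IH show ?case by (rule rtrancl_into_rtrancl)
  qed simp
  then show ?thesis
    using ab cinf_hom_closed[OF sres_hom[OF UV, of 0]] by (simp add: U.pi0_rel_edges V.pi0_rel_edges)
qed

lemma res_pi0_class:
  assumes UV: "openin X U" "openin X V" "V \<subseteq> U" and a: "a \<in> carrier (level (ssec F U) 0)"
  shows "res (pi0_presheaf F) U V (pi0_class (ssec F U) a) = pi0_class (ssec F V) (sres F 0 U V a)"
proof -
  interpret U: simplicial_cinf_ring "ssec F U" using ssec_simplicial UV by blast
  interpret V: simplicial_cinf_ring "ssec F V" using ssec_simplicial UV by blast
  have "(a, a) \<in> pi0_rel (ssec F U)" using a by (simp add: U.pi0_rel_edges)
  moreover have "trans (pi0_rel (ssec F V))" using V.equiv_pi0_rel by (simp add: equiv_def)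
  ultimately show ?thesis
    unfolding pi0_presheaf_def pi0_class_def
    using sres_pi0_rel[OF UV] by (auto dest: transD)
qed

lemma pi0_presheaf: "cinf_presheaf X (pi0_presheaf F)"
proof (rule cinf_presheaf.intro)
  fix U assume U: "openin X U"
  interpret U: simplicial_cinf_ring "ssec F U" using ssec_simplicial U by blast
  show "cinf_ring (sec (pi0_presheaf F) U)"
    using U.pi0_cinf_ring by simp
  show "res (pi0_presheaf F) U U s = s" if "s \<in> carrier (sec (pi0_presheaf F) U)" for s
    using that res_pi0_class[OF U U] cinf_presheaf.res_id[OF level_presheaf[of 0] U]
    by (auto simp: U.carrier_pi0)
  fix V assume V: "openin X V" "V \<subseteq> U"
  interpret V: simplicial_cinf_ring "ssec F V" using ssec_simplicial V by blast
  note r = sres_hom[OF U V, of 0]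
  show "res (pi0_presheaf F) U V \<in> cinf_hom (sec (pi0_presheaf F) U) (sec (pi0_presheaf F) V)"
    unfolding cinf_hom_def mem_Collect_eq
  proof (intro conjI allI impI)
    show "res (pi0_presheaf F) U V \<in> carrier (sec (pi0_presheaf F) U) \<rightarrow> carrier (sec (pi0_presheaf F) V)"
      using res_pi0_class[OF U V] cinf_hom_closed[OF r] by (auto simp: U.carrier_pi0 V.carrier_pi0)
    fix n f C assume f: "smooth n f" and C: "\<forall>i<n. C i \<in> carrier (sec (pi0_presheaf F) U)"
    obtain a where a: "\<forall>i<n. a i \<in> carrier (level (ssec F U) 0) \<and> C i = pi0_class (ssec F U) (a i)"
      using U.pi0_representatives[of n C] C by auto
    then have a': "\<And>i. i < n \<Longrightarrow> a i \<in> carrier (level (ssec F U) 0)"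
      "\<And>i. i < n \<Longrightarrow> C i = pi0_class (ssec F U) (a i)" by simp_all
    have "cinf_op (pi0 (ssec F U)) n f C = pi0_class (ssec F U) (cinf_op (level (ssec F U) 0) n f a)"
      by (rule U.pi0_op[OF U.smooth_respects_pi0[OF f] a'])
    moreover have "cinf_op (pi0 (ssec F V)) n f (\<lambda>i. res (pi0_presheaf F) U V (C i))
        = pi0_class (ssec F V) (cinf_op (level (ssec F V) 0) n f (\<lambda>i. sres F 0 U V (a i)))"
    proof (rule V.pi0_op[OF V.smooth_respects_pi0[OF f]])
      fix i assume "i < n"
      then show "sres F 0 U V (a i) \<in> carrier (level (ssec F V) 0)"
        "res (pi0_presheaf F) U V (C i) = pi0_class (ssec F V) (sres F 0 U V (a i))"
        using a' res_pi0_class[OF U V] cinf_hom_closed[OF r] by auto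
    qed
    moreover have "sres F 0 U V (cinf_op (level (ssec F U) 0) n f a)
        = cinf_op (level (ssec F V) 0) n f (\<lambda>i. sres F 0 U V (a i))"
      using cinf_hom_op[OF r f, of a] a'(1) by simp
    moreover have "cinf_op (level (ssec F U) 0) n f a \<in> carrier (level (ssec F U) 0)"
      by (intro cinf_ring.op_closed[OF U.level_ring f] a'(1))
    ultimately show "res (pi0_presheaf F) U V (cinf_op (sec (pi0_presheaf F) U) n f C)
        = cinf_op (sec (pi0_presheaf F) V) n f (\<lambda>i. res (pi0_presheaf F) U V (C i))"
      using res_pi0_class[OF U V] by simp
  qed
  fix W s assume W: "openin X W" "W \<subseteq> V" and s: "s \<in> carrier (sec (pi0_presheaf F) U)"
  obtain a where a: "a \<in> carrier (level (ssec F U) 0)" "s = pi0_class (ssec F U) a"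
    using s by (auto simp: U.carrier_pi0)
  show "res (pi0_presheaf F) V W (res (pi0_presheaf F) U V s) = res (pi0_presheaf F) U W s"
    using a W V U res_pi0_class[OF U V a(1)] res_pi0_class[OF V(1) W cinf_hom_closed[OF r a(1)]]
      res_pi0_class[OF U W(1) _ a(1)] cinf_presheaf.res_comp[OF level_presheaf[of 0] U V(1) W(1) W(2) V(2)]
    by simp
qed

text \<open>
  The canonical morphism from \<open>O\<^sub>0\<close> to the sheaf \<open>\<pi>\<^sub>0\<close>.
\<close>

definition to_pi0 :: "'x set \<Rightarrow> 'a \<Rightarrow> 'x \<Rightarrow> ('x set \<times> 'a set) set" where
  "to_pi0 U s = (\<lambda>q\<in>U. germ X (pi0_presheaf F) q U (pi0_class (ssec F U) s))"

lemma to_pi0_hom: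
  assumes U: "openin X U"
  shows "to_pi0 U \<in> cinf_hom (level (ssec F U) 0) (sec (pi0_sheaf X F) U)"
proof -
  interpret U: simplicial_cinf_ring "ssec F U" using ssec_simplicial U by blast
  interpret P: cinf_presheaf X "pi0_presheaf F" by (rule pi0_presheaf)
  have "to_pi0 U s \<in> carrier (sec (pi0_sheaf X F) U)" if s: "s \<in> carrier (level (ssec F U) 0)" for s
  proof -
    have "pi0_class (ssec F U) s \<in> carrier (sec (pi0_presheaf F) U)"
      using s by (simp add: U.carrier_pi0)
    then show ?thesis
      using U unfolding pi0_sheaf_def sheafification_def sections_over_def to_pi0_def by auto
  qed
  moreover have "to_pi0 U (cinf_op (level (ssec F U) 0) n f a)
      = cinf_op (sec (pi0_sheaf X F) U) n f (\<lambda>i. to_pi0 U (a i))"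
    if f: "smooth n f" and a: "\<forall>i<n. a i \<in> carrier (level (ssec F U) 0)" for n f a
  proof -
    have "germ X (pi0_presheaf F) q U (pi0_class (ssec F U) (cinf_op (level (ssec F U) 0) n f a))
        = cinf_op (stalk X (pi0_presheaf F) q) n f (\<lambda>i. germ X (pi0_presheaf F) q U (pi0_class (ssec F U) (a i)))"
      if "q \<in> U" for q
      using cinf_hom_op[OF U.pi0_class_hom f, of a] a
        cinf_hom_op[OF P.germ_hom[OF U that] f, of "\<lambda>i. pi0_class (ssec F U) (a i)"]
      by (simp add: U.carrier_pi0)
    then show ?thesis
      by (auto simp: pi0_sheaf_def sheafification_def to_pi0_def intro!: restrict_ext)
  qed
  ultimately show ?thesis unfolding cinf_hom_def by blast
qed

lemma to_pi0_sres:
  assumes UV: "openin X U" "openin X V" "V \<subseteq> U" and s: "s \<in> carrier (level (ssec F U) 0)"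
  shows "to_pi0 V (sres F 0 U V s) = res (pi0_sheaf X F) U V (to_pi0 U s)"
proof -
  interpret U: simplicial_cinf_ring "ssec F U" using ssec_simplicial UV by blast
  interpret P: cinf_presheaf X "pi0_presheaf F" by (rule pi0_presheaf)
  have "germ X (pi0_presheaf F) q V (pi0_class (ssec F V) (sres F 0 U V s))
      = germ X (pi0_presheaf F) q U (pi0_class (ssec F U) s)" if "q \<in> V" for q
    using P.germ_res[OF UV that, of "pi0_class (ssec F U) s"] s res_pi0_class[OF UV s]
    by (simp add: U.carrier_pi0)
  then show ?thesis
    using UV(3) by (auto simp: pi0_sheaf_def sheafification_def to_pi0_def fun_eq_iff)
qed

text \<open>
  The morphism \<open>to_pi0\<close> is locally surjective, and finitely many sections lift over a common
  neighbourhood.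
\<close>

lemma pi0_sheaf_local_lifts:
  fixes n :: nat
  assumes U: "openin X U" and p: "p \<in> U"
    and u: "\<And>i. i < n \<Longrightarrow> u i \<in> carrier (sec (pi0_sheaf X F) U)"
  shows "\<exists>V s. openin X V \<and> p \<in> V \<and> V \<subseteq> U \<and>
    (\<forall>i<n. s i \<in> carrier (level (ssec F V) 0) \<and> res (pi0_sheaf X F) U V (u i) = to_pi0 V (s i))"
  using u
proof (induction n)
  case 0
  then show ?case using U p by blast
next
  case (Suc n)
  have "\<And>i. i < n \<Longrightarrow> u i \<in> carrier (sec (pi0_sheaf X F) U)" using Suc.prems by simp
  from Suc.IH[OF this] obtain V s where V: "openin X V" "p \<in> V" "V \<subseteq> U"
    and s: "\<forall>i<n. s i \<in> carrier (level (ssec F V) 0) \<and> res (pi0_sheaf X F) U V (u i) = to_pi0 V (s i)"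
    by blast
  have u_n: "u n \<in> sections_over X (pi0_presheaf F) U"
    using Suc.prems[of n] by (simp add: pi0_sheaf_def sheafification_def)
  obtain W t where W: "openin X W" "p \<in> W" and t: "t \<in> carrier (sec (pi0_presheaf F) W)"
    and un: "\<forall>q \<in> W \<inter> U. u n q = germ X (pi0_presheaf F) q W t"
    using sections_over_local[OF u_n p] by (elim exE conjE)
  interpret W: simplicial_cinf_ring "ssec F W" using ssec_simplicial W by blast
  obtain a where a: "a \<in> carrier (level (ssec F W) 0)" "t = pi0_class (ssec F W) a"
    using t by (auto simp: W.carrier_pi0)
  let ?V = "V \<inter> W"
  have V': "openin X ?V" using V W by blast
  let ?s = "\<lambda>i. if i < n then sres F 0 V ?V (s i) else sres F 0 W ?V a"
  have "?s i \<in> carrier (level (ssec F ?V) 0) \<and> res (pi0_sheaf X F) U ?V (u i) = to_pi0 ?V (?s i)"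
    if "i < Suc n" for i
  proof (cases "i < n")
    case True
    then have si: "s i \<in> carrier (level (ssec F V) 0)" "res (pi0_sheaf X F) U V (u i) = to_pi0 V (s i)"
      using s by blast+
    have "to_pi0 ?V (sres F 0 V ?V (s i)) = res (pi0_sheaf X F) V ?V (res (pi0_sheaf X F) U V (u i))"
      using to_pi0_sres[OF V(1) V' _ si(1)] si(2) by simp
    also have "\<dots> = res (pi0_sheaf X F) U ?V (u i)"
      by (auto simp: pi0_sheaf_def sheafification_def fun_eq_iff)
    finally show ?thesis
      using True cinf_hom_closed[OF sres_hom[OF V(1) V'] si(1)] by simp
  next
    case False
    then have i: "i = n" using that by simp
    have "to_pi0 ?V (sres F 0 W ?V a) = res (pi0_sheaf X F) W ?V (to_pi0 W a)"
      using to_pi0_sres[OF W(1) V' _ a(1)] by simp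
    also have "\<dots> = res (pi0_sheaf X F) U ?V (u n)"
      using un a(2) V(3) by (auto simp: pi0_sheaf_def sheafification_def to_pi0_def fun_eq_iff)
    finally show ?thesis
      using i cinf_hom_closed[OF sres_hom[OF W(1) V'] a(1)] by simp
  qed
  then have "\<forall>i<Suc n. ?s i \<in> carrier (level (ssec F ?V) 0) \<and> res (pi0_sheaf X F) U ?V (u i) = to_pi0 ?V (?s i)"
    by blast
  then show ?case
    using V W V' by (intro exI[of _ ?V] exI[of _ ?s] conjI) auto
qed

end

text \<open>
  A germ is a unit if and only if the section has an inverse on some neighbourhood, and a morphism of presheaves
  preserves inverses of sections.
\<close>

lemma unit_germ_image:
  assumes P: "cinf_presheaf X P" and Q: "cinf_presheaf X Q"
    and h: "\<And>U. openin X U \<Longrightarrow> h U \<in> cinf_hom (sec P U) (sec Q U)"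
    and natural: "\<And>U V s. \<lbrakk>openin X U; openin X V; V \<subseteq> U; s \<in> carrier (sec P U)\<rbrakk>
      \<Longrightarrow> h V (res P U V s) = res Q U V (h U s)"
    and U: "openin X U" "p \<in> U" and s: "s \<in> carrier (sec P U)"
    and unit: "germ X P p U s \<in> Units (ring_of (stalk X P p))"
  shows "germ X Q p U (h U s) \<in> Units (ring_of (stalk X Q p))"
proof -
  interpret P: cinf_presheaf X P by fact
  interpret Q: cinf_presheaf X Q by fact
  have pX: "p \<in> topspace X" using U openin_subset by blast
  interpret PS: cring "ring_of (stalk X P p)" by (rule cinf_ring.cring_ring_of[OF P.stalk_cinf_ring[OF pX]])
  interpret QS: cring "ring_of (stalk X Q p)" by (rule cinf_ring.cring_ring_of[OF Q.stalk_cinf_ring[OF pX]])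
  obtain \<gamma> where \<gamma>: "\<gamma> \<in> carrier (stalk X P p)"
    "germ X P p U s \<otimes>\<^bsub>ring_of (stalk X P p)\<^esub> \<gamma> = \<one>\<^bsub>ring_of (stalk X P p)\<^esub>"
    using PS.Units_inv_closed[OF unit] PS.Units_r_inv[OF unit] by simp
  obtain V t where V: "openin X V" "p \<in> V" and t: "t \<in> carrier (sec P V)" "\<gamma> = germ X P p V t"
    using \<gamma>(1) by (auto simp: stalk_def)
  let ?W = "U \<inter> V"
  have W: "openin X ?W" "p \<in> ?W" using U V by auto
  interpret PW: cring "ring_of (sec P ?W)" by (rule cinf_ring.cring_ring_of[OF P.sec_ring[OF W(1)]])
  interpret gP: ring_hom_ring "ring_of (sec P ?W)" "ring_of (stalk X P p)" "germ X P p ?W"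
    by (rule P.germ_ring_hom[OF W])
  let ?s = "res P U ?W s" and ?t = "res P V ?W t"
  have st: "?s \<in> carrier (sec P ?W)" "?t \<in> carrier (sec P ?W)"
    using P.res_closed U V W s t by auto
  have prod: "?s \<otimes>\<^bsub>ring_of (sec P ?W)\<^esub> ?t \<in> carrier (sec P ?W)"
    "\<one>\<^bsub>ring_of (sec P ?W)\<^esub> \<in> carrier (sec P ?W)"
    using PW.m_closed[of ?s ?t] st PW.one_closed by simp_all
  have "germ X P p ?W (?s \<otimes>\<^bsub>ring_of (sec P ?W)\<^esub> ?t) = germ X P p ?W (\<one>\<^bsub>ring_of (sec P ?W)\<^esub>)"
    using gP.hom_mult[of ?s ?t] gP.hom_one st \<gamma>(2) t P.germ_res[of U ?W p s] P.germ_res[of V ?W p t] U V W s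
    by simp
  then obtain N where N: "openin X N" "p \<in> N" "N \<subseteq> ?W"
    and eq: "res P ?W N (?s \<otimes>\<^bsub>ring_of (sec P ?W)\<^esub> ?t) = res P ?W N (\<one>\<^bsub>ring_of (sec P ?W)\<^esub>)"
    using P.germ_eq_iff[OF W prod(1) W prod(2)] by auto
  note rr = cinf_hom_ring_hom[OF P.res_hom[OF W(1) N(1,3)] P.sec_ring[OF W(1)] P.sec_ring[OF N(1)]]
  interpret rN: ring_hom_ring "ring_of (sec P ?W)" "ring_of (sec P N)" "res P ?W N" by (rule rr)
  interpret hN: ring_hom_ring "ring_of (sec P N)" "ring_of (sec Q N)" "h N"
    by (rule cinf_hom_ring_hom[OF h[OF N(1)] P.sec_ring[OF N(1)] Q.sec_ring[OF N(1)]])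
  interpret gQ: ring_hom_ring "ring_of (sec Q N)" "ring_of (stalk X Q p)" "germ X Q p N"
    by (rule Q.germ_ring_hom[OF N(1,2)])
  have s': "res P ?W N ?s = res P U N s"
    using P.res_comp[of U ?W N s] U W N s by simp
  let ?s' = "res P U N s" and ?t' = "res P ?W N ?t"
  have cl: "?s' \<in> carrier (ring_of (sec P N))" "?t' \<in> carrier (ring_of (sec P N))"
    using rN.hom_closed st s' by (metis ring_of_simps(1))+
  have "?s' \<otimes>\<^bsub>ring_of (sec P N)\<^esub> ?t' = \<one>\<^bsub>ring_of (sec P N)\<^esub>"
    using eq rN.hom_mult[of ?s ?t] rN.hom_one st s' by simp
  then have "germ X Q p N (h N ?s') \<otimes>\<^bsub>ring_of (stalk X Q p)\<^esub> germ X Q p N (h N ?t')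
      = \<one>\<^bsub>ring_of (stalk X Q p)\<^esub>"
    using cl hN.hom_mult[of ?s' ?t'] gQ.hom_mult[of "h N ?s'" "h N ?t'"] hN.hom_closed hN.hom_one gQ.hom_one
    by metis
  moreover have "germ X Q p N (h N ?s') = germ X Q p U (h U s)"
    using natural[OF U(1) N(1) _ s] N(3) Q.germ_res[OF U(1) N(1) _ N(2), of "h U s"]
      cinf_hom_closed[OF h[OF U(1)] s] by auto
  moreover have "germ X Q p N (h N ?s') \<in> carrier (ring_of (stalk X Q p))"
    "germ X Q p N (h N ?t') \<in> carrier (ring_of (stalk X Q p))"
    by (rule gQ.hom_closed[OF hN.hom_closed[OF cl(1)]] gQ.hom_closed[OF hN.hom_closed[OF cl(2)]])+
  ultimately show ?thesis
    using QS.m_comm unfolding Units_def by fastforce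
qed

section \<open>Softness of the structure sheaf\<close>

lemma smooth_functions_op_proj: "cinf_op (smooth_functions n) n f (\<lambda>i x. x i) = f"
  by (simp add: smooth_functions_def)

text \<open>
  The generators are the images of the coordinate functions: every smooth \<open>f\<close> is the operation \<open>f\<close> applied to these.
\<close>

lemma finitely_generated_by_ops:
  assumes "finitely_generated A"
  obtains n x where "\<And>i. i < n \<Longrightarrow> x i \<in> carrier A"
    "\<And>a. a \<in> carrier A \<Longrightarrow> \<exists>f. smooth n f \<and> a = cinf_op A n f x"
proof -
  obtain n h where h: "h \<in> cinf_hom (smooth_functions n) A"
    and surj: "h ` carrier (smooth_functions n) = carrier A"
    using assms by (auto simp: finitely_generated_def)
  have proj: "(\<lambda>x. x i) \<in> carrier (smooth_functions n)" if "i < n" for i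
    using smooth_proj[OF that] by (simp add: smooth_functions_def)
  have "h f = cinf_op A n f (\<lambda>i. h (\<lambda>x. x i))" if "smooth n f" for f
    using cinf_hom_op[OF h that, of "\<lambda>i x. x i"] proj smooth_functions_op_proj[of n f] by simp
  moreover have "\<exists>f. smooth n f \<and> a = h f" if "a \<in> carrier A" for a
    using surj that by (auto simp: smooth_functions_def)
  ultimately show thesis
    using that[of n "\<lambda>i. h (\<lambda>x. x i)"] cinf_hom_closed[OF h proj] by metis
qed

text \<open>
  The point \<open>c\<close> consists of the residues of \<open>a\<close>, and \<open>f(c)\<close> is the residue of \<open>f(a)\<close>.
\<close>

lemma (in cinf_residue_ideal) evaluation_point:
  fixes n :: nat
  assumes a: "\<And>i. i < n \<Longrightarrow> a i \<in> carrier A"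
  shows "\<exists>c. \<forall>f r. smooth n f \<longrightarrow> cinf_op A n f a = cinf_const A r \<longrightarrow> f c = r"
proof -
  have "\<forall>i. \<exists>r. i < n \<longrightarrow> a i \<ominus>\<^bsub>ring_of A\<^esub> cinf_const A r \<in> M"
    using real_residue a by blast
  from choice[OF this] obtain c where c: "\<And>i. i < n \<Longrightarrow> a i \<ominus>\<^bsub>ring_of A\<^esub> cinf_const A (c i) \<in> M"
    by blast
  have "f c = r" if f: "smooth n f" and eq: "cinf_op A n f a = cinf_const A r" for f r
  proof -
    have "cinf_const A r \<ominus>\<^bsub>ring_of A\<^esub> cinf_const A (f c) \<in> M"
      using residue_op[of n f a c, OF f a c] eq by simp
    moreover have "cinf_const A r \<ominus>\<^bsub>ring_of A\<^esub> cinf_const A (f c) = cinf_const A (r - f c)"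
      unfolding cinf_const_def by (rule op_minus) (auto intro: smooth_const)
    ultimately show ?thesis using const_in_M_iff by simp
  qed
  then show ?thesis by blast
qed

lemma (in cinf_residue_ideal) zero_notin_Units: "\<zero>\<^bsub>ring_of A\<^esub> \<notin> Units (ring_of A)"
  using unit_notin_M const_in_M_iff[of 0] by (auto simp: ring_of_simps)

context simplicial_cinf_space
begin

sublocale Q: cinf_sheaf X "pi0_sheaf X F"
  using pi0_soft by (simp add: soft_sheaf_def)

sublocale P: cinf_sheaf X "sheaf_level F 0"
  by (rule level_sheaf)

lemma pi0_stalk_residue_ideal:
  assumes "p \<in> topspace X"
  obtains M where "cinf_residue_ideal (stalk X (pi0_sheaf X F) p) M"
  using local_cinf_ring_residue_ideal[OF Q.stalk_cinf_ring[OF assms] pi0_local[OF assms]] .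

text \<open>
  Softness is applied to the closed set \<open>(X - W) \<union> {p}\<close>.  The germs \<open>1\<close> at \<open>p\<close> and \<open>0\<close> elsewhere form a section
  over it, since \<open>W\<close> separates \<open>p\<close> from \<open>X - W\<close> and points are closed in a Hausdorff space.
\<close>

lemma pi0_separating_section:
  assumes W: "openin X W" and p: "p \<in> W"
  obtains u where "u \<in> carrier (sec (pi0_sheaf X F) (topspace X))"
    "germ X (pi0_sheaf X F) p (topspace X) u = cinf_const (stalk X (pi0_sheaf X F) p) 1"
    "\<And>q. q \<in> topspace X - W \<Longrightarrow>
      germ X (pi0_sheaf X F) q (topspace X) u = cinf_const (stalk X (pi0_sheaf X F) q) 0"
proof -
  let ?X = "topspace X" and ?Q = "pi0_sheaf X F"
  have pX: "p \<in> ?X" using W p openin_subset by blast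
  have p_closed: "closedin X {p}"
    using closedin_Hausdorff_sing_eq[OF Hausdorff] pX by blast
  define S where "S = (?X - W) \<union> {p}"
  define \<sigma> where "\<sigma> = (\<lambda>q\<in>S. cinf_const (stalk X ?Q q) (if q = p then 1 else 0))"
  have "closedin X S"
    unfolding S_def using W p_closed by (intro closedin_Un) auto
  moreover have "\<sigma> \<in> sections_over X ?Q S"
  proof -
    have "\<exists>V. openin X V \<and> q \<in> V \<and> (\<exists>t \<in> carrier (sec ?Q V). \<forall>q' \<in> V \<inter> S. \<sigma> q' = germ X ?Q q' V t)"
      if q: "q \<in> S" for q
    proof -
      define V where "V = (if q = p then W else ?X - {p})"
      define t where "t = cinf_const (sec ?Q V) (if q = p then 1 else 0)"
      have V: "openin X V" "q \<in> V"
        using W p p_closed q by (auto simp: V_def S_def)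
      have "t \<in> carrier (sec ?Q V)"
        unfolding t_def by (rule cinf_ring.const_closed[OF Q.sec_ring[OF V(1)]])
      moreover have "\<sigma> q' = germ X ?Q q' V t" if "q' \<in> V \<inter> S" for q'
        using that Q.germ_const[OF V(1), of q'] by (auto simp: \<sigma>_def t_def V_def S_def split: if_splits)
      ultimately show ?thesis using V by blast
    qed
    then show ?thesis by (simp add: sections_over_def \<sigma>_def)
  qed
  ultimately obtain u where u: "u \<in> carrier (sec ?Q ?X)" "\<forall>q\<in>S. germ X ?Q q ?X u = \<sigma> q"
    using pi0_soft unfolding soft_sheaf_def by blast
  show thesis
    by (rule that[OF u(1)]) (use u(2) p in \<open>auto simp: S_def \<sigma>_def\<close>)
qed

text \<open>
  The generators are fixed before \<open>p\<close> and \<open>W\<close>.  This order matters for the existence of bump sections, where \<open>W\<close> will be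
  a set over which these generators lift.
\<close>

lemma pi0_generators_separate:
  obtains n x where "\<And>i. i < n \<Longrightarrow> x i \<in> carrier (sec (pi0_sheaf X F) (topspace X))"
    "\<And>p W. openin X W \<Longrightarrow> p \<in> W \<Longrightarrow> \<exists>f. smooth n f \<and>
      germ X (pi0_sheaf X F) p (topspace X) (cinf_op (sec (pi0_sheaf X F) (topspace X)) n f x)
        = cinf_const (stalk X (pi0_sheaf X F) p) 1 \<and>
      (\<forall>q \<in> topspace X - W.
        germ X (pi0_sheaf X F) q (topspace X) (cinf_op (sec (pi0_sheaf X F) (topspace X)) n f x)
          = cinf_const (stalk X (pi0_sheaf X F) q) 0)"
proof -
  obtain n x where x: "\<And>i. i < n \<Longrightarrow> x i \<in> carrier (sec (pi0_sheaf X F) (topspace X))"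
    and gen: "\<And>a. a \<in> carrier (sec (pi0_sheaf X F) (topspace X)) \<Longrightarrow>
      \<exists>f. smooth n f \<and> a = cinf_op (sec (pi0_sheaf X F) (topspace X)) n f x"
    using finitely_generated_by_ops[OF pi0_finitely_generated[OF openin_topspace]] by blast
  show thesis
  proof (rule that[OF x])
    fix p W assume W: "openin X W" "p \<in> W"
    obtain u where u: "u \<in> carrier (sec (pi0_sheaf X F) (topspace X))"
      "germ X (pi0_sheaf X F) p (topspace X) u = cinf_const (stalk X (pi0_sheaf X F) p) 1"
      "\<And>q. q \<in> topspace X - W \<Longrightarrow>
        germ X (pi0_sheaf X F) q (topspace X) u = cinf_const (stalk X (pi0_sheaf X F) q) 0"
      by (rule pi0_separating_section[OF W]) blast
    obtain f where "smooth n f" "u = cinf_op (sec (pi0_sheaf X F) (topspace X)) n f x"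
      using gen[OF u(1)] by blast
    then show "\<exists>f. smooth n f \<and>
      germ X (pi0_sheaf X F) p (topspace X) (cinf_op (sec (pi0_sheaf X F) (topspace X)) n f x)
        = cinf_const (stalk X (pi0_sheaf X F) p) 1 \<and>
      (\<forall>q \<in> topspace X - W.
        germ X (pi0_sheaf X F) q (topspace X) (cinf_op (sec (pi0_sheaf X F) (topspace X)) n f x)
          = cinf_const (stalk X (pi0_sheaf X F) q) 0)"
      using u(2,3) by blast
  qed
qed

text \<open>
  The map \<open>\<xi>\<close> sends a point to the residues of the generators.  For a point \<open>p\<close> of an open set \<open>W\<close> there is a
  smooth \<open>f\<close> with \<open>f(\<xi>(p)) = 1\<close> and \<open>f \<circ> \<xi> = 0\<close> off \<open>W\<close>, so the preimage of the open set \<open>{f \<noteq> 0}\<close> is a set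
  between \<open>{p}\<close> and \<open>W\<close>.  An open cover of the space is thereby controlled by open sets of sequences of
  reals, where countable subcovers exist.
\<close>

lemma Lindelof_topology: "Lindelof_space X"
proof -
  let ?X = "topspace X" and ?Q = "pi0_sheaf X F"
  obtain n x where x: "\<And>i. i < n \<Longrightarrow> x i \<in> carrier (sec ?Q ?X)"
    and sep: "\<And>p W. openin X W \<Longrightarrow> p \<in> W \<Longrightarrow> \<exists>f. smooth n f \<and>
      germ X ?Q p ?X (cinf_op (sec ?Q ?X) n f x) = cinf_const (stalk X ?Q p) 1 \<and>
      (\<forall>q \<in> ?X - W. germ X ?Q q ?X (cinf_op (sec ?Q ?X) n f x) = cinf_const (stalk X ?Q q) 0)"
    by (rule pi0_generators_separate) blast
  have "\<exists>c. \<forall>f r. smooth n f \<longrightarrow>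
      germ X ?Q q ?X (cinf_op (sec ?Q ?X) n f x) = cinf_const (stalk X ?Q q) r \<longrightarrow> f c = r" if q: "q \<in> ?X" for q
  proof -
    obtain M where "cinf_residue_ideal (stalk X ?Q q) M" by (rule pi0_stalk_residue_ideal[OF q])
    then interpret S: cinf_residue_ideal "stalk X ?Q q" M .
    note h = Q.germ_hom[OF openin_topspace q]
    have "\<exists>c. \<forall>f r. smooth n f \<longrightarrow>
        cinf_op (stalk X ?Q q) n f (\<lambda>i. germ X ?Q q ?X (x i)) = cinf_const (stalk X ?Q q) r \<longrightarrow> f c = r"
      by (rule S.evaluation_point) (rule cinf_hom_closed[OF h x])
    moreover have "germ X ?Q q ?X (cinf_op (sec ?Q ?X) n f x)
        = cinf_op (stalk X ?Q q) n f (\<lambda>i. germ X ?Q q ?X (x i))" if "smooth n f" for f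
      using cinf_hom_op[OF h that, of x] x by simp
    ultimately show ?thesis by (metis (lifting))
  qed
  then obtain \<xi> where \<xi>: "\<And>q f r. q \<in> ?X \<Longrightarrow> smooth n f \<Longrightarrow>
      germ X ?Q q ?X (cinf_op (sec ?Q ?X) n f x) = cinf_const (stalk X ?Q q) r \<Longrightarrow> f (\<xi> q) = r"
    by (metis (lifting))
  show ?thesis unfolding Lindelof_space_def
  proof (intro allI impI, elim conjE)
    fix \<U> assume U: "\<forall>U\<in>\<U>. openin X U" and cover: "\<Union>\<U> = ?X"
    define \<G> where "\<G> = {G :: (nat \<Rightarrow> real) set. open G \<and> (\<exists>U\<in>\<U>. \<forall>q\<in>?X. \<xi> q \<in> G \<longrightarrow> q \<in> U)}"
    have G_cover: "\<exists>G\<in>\<G>. \<xi> p \<in> G" if p: "p \<in> ?X" for p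
    proof -
      obtain W where W: "W \<in> \<U>" "p \<in> W" using cover p by blast
      obtain f where f: "smooth n f"
        "germ X ?Q p ?X (cinf_op (sec ?Q ?X) n f x) = cinf_const (stalk X ?Q p) 1"
        "\<forall>q \<in> ?X - W. germ X ?Q q ?X (cinf_op (sec ?Q ?X) n f x) = cinf_const (stalk X ?Q q) 0"
        using sep[of W p] U W by blast
      have "open {y. f y \<noteq> 0}"
        using smooth_continuous[OF f(1)] by (intro open_Collect_neq continuous_on_const)
      moreover have "\<forall>q\<in>?X. f (\<xi> q) \<noteq> 0 \<longrightarrow> q \<in> W" using \<xi>[OF _ f(1)] f(3) by blast
      moreover have "f (\<xi> p) = 1" using \<xi>[OF p f(1,2)] .
      ultimately have G: "{y. f y \<noteq> 0} \<in> \<G>" "\<xi> p \<in> {y. f y \<noteq> 0}"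
        using W(1) by (auto simp: \<G>_def)
      show ?thesis by (rule bexI[where P = "\<lambda>G. \<xi> p \<in> G", OF G(2) G(1)])
    qed
    have "\<And>G. G \<in> \<G> \<Longrightarrow> open G" by (simp add: \<G>_def)
    then obtain \<G>' where G': "\<G>' \<subseteq> \<G>" "countable \<G>'" "\<Union>\<G>' = \<Union>\<G>"
      by (rule Lindelof)
    have "\<forall>G\<in>\<G>. \<exists>U. U \<in> \<U> \<and> (\<forall>q\<in>?X. \<xi> q \<in> G \<longrightarrow> q \<in> U)" by (auto simp: \<G>_def)
    from bchoice[OF this] obtain k where
      k: "\<forall>G\<in>\<G>. k G \<in> \<U> \<and> (\<forall>q\<in>?X. \<xi> q \<in> G \<longrightarrow> q \<in> k G)" by blast
    have kG: "k G \<in> \<U>" "\<And>q. q \<in> ?X \<Longrightarrow> \<xi> q \<in> G \<Longrightarrow> q \<in> k G" if "G \<in> \<G>'" for G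
      using k subsetD[OF G'(1) that] by auto
    then have sub: "k ` \<G>' \<subseteq> \<U>" by auto
    have "\<Union>(k ` \<G>') = ?X"
    proof (intro equalityI subsetI)
      fix q assume "q \<in> \<Union>(k ` \<G>')"
      then show "q \<in> ?X" using Union_mono[OF sub] unfolding cover by (rule rev_subsetD)
    next
      fix q assume q: "q \<in> ?X"
      have "\<xi> q \<in> \<Union>\<G>'" unfolding G'(3) using G_cover[OF q] by simp
      then obtain G where "G \<in> \<G>'" "\<xi> q \<in> G" ..
      then show "q \<in> \<Union>(k ` \<G>')" using kG(2)[OF _ q] by auto
    qed
    then show "\<exists>\<V>. countable \<V> \<and> \<V> \<subseteq> \<U> \<and> \<Union>\<V> = ?X"
      using sub countable_image[OF G'(2)] by (intro exI[of _ "k ` \<G>'"] conjI)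
  qed
qed

text \<open>
  Otherwise \<open>0\<close> would be a unit in a stalk of \<open>\<pi>\<^sub>0\<close>, which is local and hence not the zero ring.
\<close>

lemma nonunit_germ_if_pi0_germ_zero:
  assumes V: "openin X V" "q \<in> V" and s: "s \<in> carrier (level (ssec F V) 0)"
    and zero: "germ X (pi0_sheaf X F) q V (to_pi0 V s) = \<zero>\<^bsub>ring_of (stalk X (pi0_sheaf X F) q)\<^esub>"
  shows "germ X (sheaf_level F 0) q V s \<notin> Units (ring_of (stalk X (sheaf_level F 0) q))"
proof
  assume "germ X (sheaf_level F 0) q V s \<in> Units (ring_of (stalk X (sheaf_level F 0) q))"
  then have "germ X (pi0_sheaf X F) q V (to_pi0 V s) \<in> Units (ring_of (stalk X (pi0_sheaf X F) q))"
    using s to_pi0_hom to_pi0_sres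
    by (intro unit_germ_image[OF P.cinf_presheaf_axioms Q.cinf_presheaf_axioms _ _ V]) auto
  moreover have "q \<in> topspace X" using V openin_subset by blast
  then obtain M where "cinf_residue_ideal (stalk X (pi0_sheaf X F) q) M"
    by (rule pi0_stalk_residue_ideal)
  ultimately show False using cinf_residue_ideal.zero_notin_Units zero by metis
qed

end

context localized_simplicial_cinf_space
begin

text \<open>
  The section \<open>s - c\<close> maps to a section of \<open>\<pi>\<^sub>0\<close> with germ \<open>0\<close>, so its germ is not a unit and \<open>s\<close> has residue \<open>c\<close> at \<open>q\<close>.
  The step function is equal to \<open>c\<close> near \<open>c\<close>.
\<close>

lemma smooth_step_germ:
  assumes V: "openin X V" "q \<in> V" and s: "s \<in> carrier (level (ssec F V) 0)"
    and c: "c = 0 \<or> c = 1"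
    and germ_c: "germ X (pi0_sheaf X F) q V (to_pi0 V s) = cinf_const (stalk X (pi0_sheaf X F) q) c"
  shows "germ X (sheaf_level F 0) q V (cinf_op (level (ssec F V) 0) 1 (\<lambda>x. smooth_step (x 0)) (\<lambda>_. s))
    = cinf_const (stalk X (sheaf_level F 0) q) c"
proof -
  let ?P = "sheaf_level F 0" and ?Q = "pi0_sheaf X F"
  let ?L = "ring_of (level (ssec F V) 0)" and ?SP = "ring_of (stalk X ?P q)" and ?SQ = "ring_of (stalk X ?Q q)"
  have qX: "q \<in> topspace X" using V openin_subset by blast
  obtain M where "cinf_residue_ideal (stalk X ?P q) M"
    using local_cinf_ring_residue_ideal[OF P.stalk_cinf_ring[OF qX] stalk_local[OF qX]] .
  then interpret M: cinf_residue_ideal "stalk X ?P q" M .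
  have L: "cinf_ring (level (ssec F V) 0)" using P.sec_ring[OF V(1)] by simp
  interpret L: cring ?L by (rule cinf_ring.cring_ring_of[OF L])
  interpret SP: cring ?SP by (rule M.cring_ring_of)
  interpret SQ: cring ?SQ by (rule cinf_ring.cring_ring_of[OF Q.stalk_cinf_ring[OF qX]])
  interpret SecQ: cring "ring_of (sec ?Q V)" by (rule cinf_ring.cring_ring_of[OF Q.sec_ring[OF V(1)]])
  interpret e: ring_hom_ring ?L "ring_of (sec ?Q V)" "to_pi0 V"
    by (rule cinf_hom_ring_hom[OF to_pi0_hom[OF V(1)] L Q.sec_ring[OF V(1)]])
  interpret gQ: ring_hom_ring "ring_of (sec ?Q V)" ?SQ "germ X ?Q q V"
    by (rule Q.germ_ring_hom[OF V])
  interpret gP: ring_hom_ring ?L ?SP "germ X ?P q V"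
    using P.germ_ring_hom[OF V] by simp
  let ?c = "cinf_const (level (ssec F V) 0) c"
  have sL: "s \<in> carrier ?L" "?c \<in> carrier ?L"
    using s cinf_ring.const_closed[OF L] by simp_all
  have germ_const: "germ X ?P q V ?c = cinf_const (stalk X ?P q) c"
    using P.germ_const[OF V] by simp
  have "germ X ?Q q V (to_pi0 V ?c) = cinf_const (stalk X ?Q q) c"
    using cinf_hom_const[OF to_pi0_hom[OF V(1)] Q.sec_ring[OF V(1)]] Q.germ_const[OF V] by simp
  then have "germ X ?Q q V (to_pi0 V (s \<ominus>\<^bsub>?L\<^esub> ?c)) = \<zero>\<^bsub>?SQ\<^esub>"
    using germ_c sL gQ.hom_closed[OF e.hom_closed[OF sL(1)]]
    by (simp only: L.minus_eq e.hom_add e.hom_a_inv gQ.hom_add gQ.hom_a_inv e.hom_closed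
        L.a_inv_closed SecQ.a_inv_closed SQ.r_neg)
  then have "germ X ?P q V (s \<ominus>\<^bsub>?L\<^esub> ?c) \<in> M"
    using nonunit_germ_if_pi0_germ_zero[OF V] L.minus_closed[OF sL] M.nonunit_in_M
      gP.hom_closed[OF L.minus_closed[OF sL]] by simp
  then have diff: "germ X ?P q V s \<ominus>\<^bsub>?SP\<^esub> cinf_const (stalk X ?P q) c \<in> M"
    using sL germ_const by (simp only: L.minus_eq SP.minus_eq gP.hom_add gP.hom_a_inv L.a_inv_closed)
  have germ_s: "germ X ?P q V s \<in> carrier (stalk X ?P q)"
    using gP.hom_closed[OF sL(1)] by simp
  have "germ X ?P q V (cinf_op (level (ssec F V) 0) 1 (\<lambda>x. smooth_step (x 0)) (\<lambda>_. s))
      = cinf_op (stalk X ?P q) 1 (\<lambda>x. smooth_step (x 0)) (\<lambda>_. germ X ?P q V s)"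
    using cinf_hom_op[OF P.germ_hom[OF V], of 1 "\<lambda>x. smooth_step (x 0)" "\<lambda>_. s"] s
    by (simp add: smooth_smooth_step smooth_proj)
  also have "\<dots> = cinf_const (stalk X ?P q) c"
  proof (cases "c = 0")
    case True
    have "germ X ?P q V s \<in> M"
      using diff True SP.minus_eq SP.minus_zero SP.r_zero germ_s by (metis ring_of_simps(1,5))
    then show ?thesis using M.smooth_step_op_M True by (simp add: ring_of_simps)
  next
    case False
    then have "c = 1" using c by simp
    then show ?thesis
      using M.smooth_step_op_1[OF germ_s] diff by (simp add: ring_of_simps)
  qed
  finally show ?thesis .
qed

text \<open>
  Over \<open>V\<close>, where the generators lift to \<open>s\<close>, the section \<open>a = f(s)\<close> lifts \<open>u = f(x)\<close>, which is
  \<open>1\<close> at \<open>p\<close> and \<open>0\<close> off \<open>V\<close>.  The step function applied to \<open>a\<close> has germ \<open>0\<close> wherever \<open>u\<close> has.  As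
  the zero set of the germs of \<open>u\<close> is open and contains the complement of \<open>V\<close>, extension by zero is possible.
\<close>

lemma bump_sections:
  assumes W: "openin X W" and p: "p \<in> W"
  shows "\<exists>e P. e \<in> carrier (sec (sheaf_level F 0) (topspace X)) \<and> openin X P \<and> p \<in> P \<and>
    (\<forall>q\<in>P. germ X (sheaf_level F 0) q (topspace X) e = \<one>\<^bsub>ring_of (stalk X (sheaf_level F 0) q)\<^esub>) \<and>
    (\<forall>q\<in>topspace X - W. germ X (sheaf_level F 0) q (topspace X) e = \<zero>\<^bsub>ring_of (stalk X (sheaf_level F 0) q)\<^esub>)"
proof -
  let ?X = "topspace X" and ?P = "sheaf_level F 0" and ?Q = "pi0_sheaf X F"
  have WX: "W \<subseteq> ?X" using W openin_subset by blast
  obtain n x where x: "\<And>i. i < n \<Longrightarrow> x i \<in> carrier (sec ?Q ?X)"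
    and sep: "\<And>p W. openin X W \<Longrightarrow> p \<in> W \<Longrightarrow> \<exists>f. smooth n f \<and>
      germ X ?Q p ?X (cinf_op (sec ?Q ?X) n f x) = cinf_const (stalk X ?Q p) 1 \<and>
      (\<forall>q \<in> ?X - W. germ X ?Q q ?X (cinf_op (sec ?Q ?X) n f x) = cinf_const (stalk X ?Q q) 0)"
    by (rule pi0_generators_separate) blast
  have "res ?Q ?X W (x i) \<in> carrier (sec ?Q W)" if "i < n" for i
    using Q.res_closed[OF openin_topspace W WX x[OF that]] .
  from pi0_sheaf_local_lifts[OF W p this, of n "\<lambda>i. i"] obtain V s where V: "openin X V" "p \<in> V" "V \<subseteq> W"
    and lift: "\<forall>i<n. s i \<in> carrier (level (ssec F V) 0) \<and> res ?Q W V (res ?Q ?X W (x i)) = to_pi0 V (s i)"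
    by blast
  have VX: "V \<subseteq> ?X" using V WX by blast
  have s: "s i \<in> carrier (level (ssec F V) 0)" "to_pi0 V (s i) = res ?Q ?X V (x i)" if "i < n" for i
    using lift that Q.res_comp[OF openin_topspace W V(1) V(3) WX x[OF that]] by auto
  obtain f where f: "smooth n f"
    "germ X ?Q p ?X (cinf_op (sec ?Q ?X) n f x) = cinf_const (stalk X ?Q p) 1"
    "\<forall>q \<in> ?X - V. germ X ?Q q ?X (cinf_op (sec ?Q ?X) n f x) = cinf_const (stalk X ?Q q) 0"
    using sep[OF V(1,2)] by blast
  define u where "u = cinf_op (sec ?Q ?X) n f x"
  define a where "a = cinf_op (level (ssec F V) 0) n f s"
  define b where "b = cinf_op (level (ssec F V) 0) 1 (\<lambda>x. smooth_step (x 0)) (\<lambda>_. a)"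
  have L: "cinf_ring (level (ssec F V) 0)" using P.sec_ring[OF V(1)] by simp
  have u: "u \<in> carrier (sec ?Q ?X)"
    unfolding u_def by (intro cinf_ring.op_closed[OF Q.sec_ring[OF openin_topspace] f(1)] x)
  have a: "a \<in> carrier (level (ssec F V) 0)"
    unfolding a_def by (intro cinf_ring.op_closed[OF L f(1)] s)
  have b: "b \<in> carrier (sec ?P V)"
    unfolding b_def using cinf_ring.op_closed[OF L, of 1 "\<lambda>x. smooth_step (x 0)" "\<lambda>_. a"] a
    by (simp add: smooth_smooth_step smooth_proj)
  have "to_pi0 V a = cinf_op (sec ?Q V) n f (\<lambda>i. to_pi0 V (s i))"
    unfolding a_def by (rule cinf_hom_op[OF to_pi0_hom[OF V(1)] f(1)]) (rule s)
  also have "\<dots> = cinf_op (sec ?Q V) n f (\<lambda>i. res ?Q ?X V (x i))"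
    by (rule cinf_ring.op_cong[OF Q.sec_ring[OF V(1)] f(1)])
       (rule cinf_hom_closed[OF to_pi0_hom[OF V(1)] s(1)], assumption, rule s(2))
  also have "\<dots> = res ?Q ?X V u"
    unfolding u_def using cinf_hom_op[OF Q.res_hom[OF openin_topspace V(1) VX] f(1), of x] x by simp
  finally have germ_a: "germ X ?Q q V (to_pi0 V a) = germ X ?Q q ?X u" if "q \<in> V" for q
    using Q.germ_res[OF openin_topspace V(1) VX that u] by simp
  have germ_b: "germ X ?P q V b = cinf_const (stalk X ?P q) c"
    if "q \<in> V" "c = 0 \<or> c = 1" "germ X ?Q q ?X u = cinf_const (stalk X ?Q q) c" for q c
    unfolding b_def using smooth_step_germ[OF V(1) that(1) a that(2)] germ_a that by simp
  define N where "N c = {q \<in> ?X. germ X ?Q q ?X u = cinf_const (stalk X ?Q q) c}" for c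
  have N: "openin X (N c)" for c
    unfolding N_def by (rule Q.openin_germ_eq_const[OF u])
  have "germ X ?P q V b = \<zero>\<^bsub>ring_of (stalk X ?P q)\<^esub>" if "q \<in> V \<inter> N 0" for q
    using germ_b[of q 0] that by (simp add: N_def ring_of_simps)
  moreover have "?X \<subseteq> V \<union> N 0" using f(3) by (auto simp: N_def u_def)
  ultimately obtain e where e: "e \<in> carrier (sec ?P ?X)"
    "\<And>q. q \<in> V \<Longrightarrow> germ X ?P q ?X e = germ X ?P q V b"
    "\<And>q. q \<in> ?X - V \<Longrightarrow> germ X ?P q ?X e = \<zero>\<^bsub>ring_of (stalk X ?P q)\<^esub>"
    using P.extend_by_zero[OF V(1) N[of 0] _ b] by blast
  have "\<forall>q\<in>V \<inter> N 1. germ X ?P q ?X e = \<one>\<^bsub>ring_of (stalk X ?P q)\<^esub>"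
    using e(2) germ_b[of _ 1] by (simp add: N_def ring_of_simps)
  moreover have "openin X (V \<inter> N 1)" "p \<in> V \<inter> N 1"
    using V N f(2) VX by (auto simp: N_def u_def)
  moreover have "\<forall>q\<in>?X - W. germ X ?P q ?X e = \<zero>\<^bsub>ring_of (stalk X ?P q)\<^esub>"
    using e(3) V(3) by blast
  ultimately show ?thesis using e(1) by blast
qed

end

theorem proposition4:
  fixes X :: "'x topology" and F :: "('x, 'a) simplicial_presheaf"
  assumes "localized_simplicial_cinf_space X F"
  shows "soft_sheaf X (sheaf_level F 0)"
proof -
  interpret localized_simplicial_cinf_space X F by fact
  show ?thesis
    by (rule P.soft_if_bump_sections[OF Lindelof_topology bump_sections])
qed

end
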